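(* Let $(X,d,\mu)$ be a space of homogeneous type with upper dimension $\omega$ and wavelet basis $\{\psi_\alpha^k\}$ of Hölder exponent $\eta$. Suppose $\beta,\gamma\in(0,\eta)$ and $\frac{\omega}{\omega+\eta}<p<\infty$. Fix $N\in\mathbb{N}$. Then there is a constant $C>0$ such that for all $f\in(\mathring{G}(\beta,\gamma))'$, $$\Big\|\Big\{\sum_{k'}\sum_{\alpha'\in\mathscr{X}^{k'+N}}\Big[\sup_{z\in Q_{\alpha'}^{k'+N}}|D_{k'}(f)(z)|^2\Big]\chi_{Q_{\alpha'}^{k'+N}}(\cdot)\Big\}^{1/2}\Big\|_{L^p(X)}\le C\Big\|\Big\{\sum_k\sum_{\alpha\in\mathscr{Y}^k}\big|\langle\psi_\alpha^k,f\rangle\widetilde\chi_{Q_\alpha^k}(\cdot)\big|^2\Big\}^{1/2}\Big\|_{L^p(X)}.$$ Moreover, for a fixed sufficiently large integer $N$, there is a constant $C>0$ such that for all $f\in(\mathring{G}(\beta,\gamma))'$, $$\Big\|\Big\{\sum_k\sum_{\alpha\in\mathscr{Y}^k}\big|\langle\psi_\alpha^k,f\rangle\widetilde\chi_{Q_\alpha^k}(\cdot)\big|^2\Big\}^{1/2}\Big\|_{L^p(X)}\le C\Big\|\Big\{\sum_{k'}\sum_{\alpha'\in\mathscr{X}^{k'+N}}\Big[\inf_{z\in Q_{\alpha'}^{k'+N}}|D_{k'}(f)(z)|^2\Big]\chi_{Q_{\alpha'}^{k'+N}}(\cdot)\Big\}^{1/2}\Big\|_{L^p(X)}.$$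
   Context: Space of homogeneous type: $(X,d,\mu)$ where $d$ is a quasi-metric on $X$ ($d(x,y)=d(y,x)\ge 0$, $d(x,y)=0$ iff $x=y$, and $d(x,y)\le A_0[d(x,z)+d(z,y)]$ for a constant $A_0\ge 1$), and $\mu$ is a nonzero measure with $\mu(B(x,2r))\le C_\mu\,\mu(B(x,r))<\infty$ for all $x\in X$, $r>0$, where $B(x,r)=\{y: d(x,y)<r\}$. Standing assumptions: $\mu(X)=\infty$ and $\mu(B(x,r))>0$ for all $x\in X$, $r>0$. No further assumptions on $d$ or $\mu$. An upper dimension of $\mu$ is a number $\omega>0$ such that for some $C$, $\mu(B(x,\lambda r))\le C\lambda^\omega\mu(B(x,r))$ for all $x\in X$, $\lambda\ge1$, $r>0$. Notation: $V_r(x)=\mu(B(x,r))$, $V(x,y)=\mu(B(x,d(x,y)))$. Reference dyadic points: fix a small $\delta\in(0,1)$ (e.g. $\delta\le 10^{-3}A_0^{-10}$). $\mathscr{X}^0$ is a maximal collection of $1$-separated points of $X$; inductively for $k\ge1$, $\mathscr{X}^k\supseteq\mathscr{X}^{k-1}$ and $\mathscr{X}^{-k}\subseteq\mathscr{X}^{-(k-1)}$ are maximal $\delta^k$- and $\delta^{-k}$-separated collections in $X$ and $\mathscr{X}^{-(k-1)}$ respectively. Thus distinct points of $\mathscr{X}^k=\{x_\alpha^k\}_\alpha$ are at distance $\ge\delta^k$ and $\min_\alpha d(x,x_\alpha^k)<2A_0\delta^k$ for all $x\in X$. Put $\mathscr{Y}^k=\mathscr{X}^{k+1}\setminus\mathscr{X}^k$,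 with points denoted $y_\alpha^k$ (indices $\alpha$ are identified with points). Dyadic cubes (Hytönen--Kairema): associated with these points are half-open dyadic cubes $Q_\alpha^k$, $k\in\mathbb{Z}$, $\alpha\in\mathscr{X}^k$, with center $x_\alpha^k$: for each $k$ they partition $X$; if $\ell\ge k$ then either $Q_\beta^\ell\subseteq Q_\alpha^k$ or they are disjoint; $B(x_\alpha^k,c_1\delta^k)\subseteq Q_\alpha^k\subseteq B(x_\alpha^k,C_1\delta^k)$ with $c_1=(3A_0^2)^{-1}$, $C_1=4A_0^2$. For $\alpha\in\mathscr{Y}^k$ (in sums over $\mathscr{Y}^k$), $Q_\alpha^k$ denotes the dyadic cube centered at $y_\alpha^k\in\mathscr{X}^{k+1}$ (of generation $k+1$). $\widetilde\chi_Q=\chi_Q\,\mu(Q)^{-1/2}$. Wavelets: $\{\psi_\alpha^k\}_{k\in\mathbb{Z},\alpha\in\mathscr{Y}^k}$ is the Auscher--Hytönen orthonormal basis of $L^2(X)$, which satisfies, with $a=(1+2\log_2A_0)^{-1}$ and constants $C<\infty$, $\nu>0$, $\eta\in(0,1]$ independent of $k,\alpha,x,y$: $|\psi_\alpha^k(x)|\le C\mu(B(y_\alpha^k,\delta^k))^{-1/2}\exp(-\nu(d(y_\alpha^k,x)/\delta^k)^a)$; $|\psi_\alpha^k(x)-\psi_\alpha^k(y)|\le C\mu(B(y_\alpha^k,\delta^k))^{-1/2}(d(x,y)/\delta^k)^\eta\exp(-\nu(d(y_\alpha^k,x)/\delta^k)^a)$ whenever $d(x,y)\le\delta^k$; and $\int_X\psi_\alpha^k\,d\mu=0$.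 The wavelet operators are $D_k(f)(x)=\sum_{\alpha\in\mathscr{Y}^k}\langle\psi_\alpha^k,f\rangle\psi_\alpha^k(x)$, with kernel $D_k(x,y)=\sum_{\alpha\in\mathscr{Y}^k}\psi_\alpha^k(x)\psi_\alpha^k(y)$. Test functions: for $x_0\in X$, $r>0$, $\beta\in(0,\eta]$, $\gamma>0$, $G(x_0,r,\beta,\gamma)$ is the set of functions $f$ on $X$ for which there is $C>0$ with (i) $|f(x)|\le C\frac{1}{V_r(x_0)+V(x,x_0)}\big(\frac{r}{r+d(x,x_0)}\big)^\gamma$ for all $x\in X$; (ii) $|f(x)-f(y)|\le C\big(\frac{d(x,y)}{r+d(x,x_0)}\big)^\beta\frac{1}{V_r(x_0)+V(x,x_0)}\big(\frac{r}{r+d(x,x_0)}\big)^\gamma$ for all $x,y$ with $d(x,y)<(2A_0)^{-1}(r+d(x,x_0))$; and (iii) $\int_X f\,d\mu=0$. Its norm is the infimum of $C$ for which (i) and (ii) hold. Fix $x_0$ and set $G(\beta,\gamma)=G(x_0,1,\beta,\gamma)$. $\mathring{G}(\beta,\gamma)$ is the completion of $G(\eta,\gamma)$ in the norm of $G(\beta,\gamma)$, with that norm, and $(\mathring{G}(\beta,\gamma))'$ is the space of bounded linear functionals on it; $\langle\cdot,\cdot\rangle$ denotes the pairing. *)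

theory Defs
  imports "HOL-Analysis.Analysis"
begin

section \<open>Spaces of homogeneous type\<close>

definition qball :: "('a \<Rightarrow> 'a \<Rightarrow> real) \<Rightarrow> 'a \<Rightarrow> real \<Rightarrow> 'a set" where
  "qball d x r = {y. d x y < r}"

(* The underlying set X is the whole type.  Quasi-metric balls need not be open, so their
   measurability is part of the assumption that they have a measure; the sigma-algebra is
   otherwise arbitrary. *)
locale homogeneous_type =
  fixes M :: "'a measure" and d :: "'a \<Rightarrow> 'a \<Rightarrow> real" and A\<^sub>0 :: real
  assumes space_eq: "space M = UNIV"
    and A\<^sub>0_ge_1: "A\<^sub>0 \<ge> 1"
    and dist_nonneg: "d x y \<ge> 0"
    and dist_eq_0_iff: "d x y = 0 \<longleftrightarrow> x = y"
    and dist_commute: "d x y = d y x"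
    and quasi_triangle: "d x y \<le> A\<^sub>0 * (d x z + d z y)"
    and qball_measurable: "qball d x r \<in> sets M"
    and doubling: "\<exists>C. \<forall>x r. r > 0 \<longrightarrow>
          emeasure M (qball d x (2 * r)) \<le> ennreal C * emeasure M (qball d x r)"
    and qball_finite: "r > 0 \<Longrightarrow> emeasure M (qball d x r) < \<infinity>"
    and qball_pos: "r > 0 \<Longrightarrow> emeasure M (qball d x r) > 0"
    and measure_infinite: "emeasure M UNIV = \<infinity>"

definition upper_dimension :: "'a measure \<Rightarrow> ('a \<Rightarrow> 'a \<Rightarrow> real) \<Rightarrow> real \<Rightarrow> bool" where
  "upper_dimension M d \<omega> \<longleftrightarrow> \<omega> > 0 \<and>
     (\<exists>C. \<forall>x t r. t \<ge> 1 \<longrightarrow> r > 0 \<longrightarrow>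
        measure M (qball d x (t * r)) \<le> C * t powr \<omega> * measure M (qball d x r))"

section \<open>Reference dyadic points and dyadic cubes\<close>

definition separated :: "('a \<Rightarrow> 'a \<Rightarrow> real) \<Rightarrow> real \<Rightarrow> 'a set \<Rightarrow> bool" where
  "separated d r S \<longleftrightarrow> (\<forall>x\<in>S. \<forall>y\<in>S. x \<noteq> y \<longrightarrow> d x y \<ge> r)"

definition maximal_separated :: "('a \<Rightarrow> 'a \<Rightarrow> real) \<Rightarrow> real \<Rightarrow> 'a set \<Rightarrow> 'a set \<Rightarrow> bool" where
  "maximal_separated d r T S \<longleftrightarrow> S \<subseteq> T \<and> separated d r S \<and>
     (\<forall>S'. S \<subseteq> S' \<longrightarrow> S' \<subseteq> T \<longrightarrow> separated d r S' \<longrightarrow> S' = S)"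

locale reference_points = homogeneous_type M d A\<^sub>0
  for M :: "'a measure" and d :: "'a \<Rightarrow> 'a \<Rightarrow> real" and A\<^sub>0 :: real +
  fixes \<delta> :: real and \<X> :: "int \<Rightarrow> 'a set"
  assumes \<delta>_pos: "\<delta> > 0"
    and \<delta>_small: "\<delta> \<le> 1 / (10 ^ 3 * A\<^sub>0 ^ 10)"
    and points_0: "maximal_separated d 1 UNIV (\<X> 0)"
    and points_mono: "k \<ge> 1 \<Longrightarrow> \<X> (k - 1) \<subseteq> \<X> k"
    and points_pos: "k \<ge> 1 \<Longrightarrow> maximal_separated d (\<delta> powi k) UNIV (\<X> k)"
    and points_neg: "k \<ge> 1 \<Longrightarrow> maximal_separated d (\<delta> powi (- k)) (\<X> (- (k - 1))) (\<X> (- k))"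

definition new_points :: "(int \<Rightarrow> 'a set) \<Rightarrow> int \<Rightarrow> 'a set" where
  "new_points \<X> k = \<X> (k + 1) - \<X> k"

locale dyadic_cubes = reference_points M d A\<^sub>0 \<delta> \<X>
  for M :: "'a measure" and d :: "'a \<Rightarrow> 'a \<Rightarrow> real" and A\<^sub>0 \<delta> :: real
    and \<X> :: "int \<Rightarrow> 'a set" +
  fixes Q :: "int \<Rightarrow> 'a \<Rightarrow> 'a set"
  assumes cube_measurable: "\<alpha> \<in> \<X> k \<Longrightarrow> Q k \<alpha> \<in> sets M"
    and cube_cover: "(\<Union>\<alpha>\<in>\<X> k. Q k \<alpha>) = UNIV"
    and cube_disjoint: "\<alpha> \<in> \<X> k \<Longrightarrow> \<beta> \<in> \<X> k \<Longrightarrow> \<alpha> \<noteq> \<beta> \<Longrightarrow> Q k \<alpha> \<inter> Q k \<beta> = {}"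
    and cube_nested: "k \<le> l \<Longrightarrow> \<alpha> \<in> \<X> k \<Longrightarrow> \<beta> \<in> \<X> l \<Longrightarrow>
          Q l \<beta> \<subseteq> Q k \<alpha> \<or> Q l \<beta> \<inter> Q k \<alpha> = {}"
    and cube_inner: "\<alpha> \<in> \<X> k \<Longrightarrow> qball d \<alpha> (1 / (3 * A\<^sub>0 ^ 2) * \<delta> powi k) \<subseteq> Q k \<alpha>"
    and cube_outer: "\<alpha> \<in> \<X> k \<Longrightarrow> Q k \<alpha> \<subseteq> qball d \<alpha> (4 * A\<^sub>0 ^ 2 * \<delta> powi k)"

definition normalized_indicator :: "'a measure \<Rightarrow> 'a set \<Rightarrow> 'a \<Rightarrow> real" where
  "normalized_indicator M S x = indicator S x / sqrt (measure M S)"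

section \<open>Wavelet bases\<close>

definition L2_functions :: "'a measure \<Rightarrow> ('a \<Rightarrow> real) set" where
  "L2_functions M = {f \<in> borel_measurable M. integrable M (\<lambda>x. (f x)\<^sup>2)}"

definition orthonormal_basis_L2 :: "'a measure \<Rightarrow> 'i set \<Rightarrow> ('i \<Rightarrow> 'a \<Rightarrow> real) \<Rightarrow> bool" where
  "orthonormal_basis_L2 M I e \<longleftrightarrow>
     (\<forall>i\<in>I. e i \<in> L2_functions M) \<and>
     (\<forall>i\<in>I. \<forall>j\<in>I. (\<integral>x. e i x * e j x \<partial>M) = (if i = j then 1 else 0)) \<and>
     (\<forall>f\<in>L2_functions M.
        ((\<lambda>J. \<integral>x. (f x - (\<Sum>i\<in>J. (\<integral>y. e i y * f y \<partial>M) * e i x))\<^sup>2 \<partial>M) \<longlongrightarrow> 0)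
          (finite_subsets_at_top I))"

locale wavelet_basis = dyadic_cubes M d A\<^sub>0 \<delta> \<X> Q
  for M :: "'a measure" and d :: "'a \<Rightarrow> 'a \<Rightarrow> real" and A\<^sub>0 \<delta> :: real
    and \<X> :: "int \<Rightarrow> 'a set" and Q :: "int \<Rightarrow> 'a \<Rightarrow> 'a set" +
  fixes \<eta> :: real and \<psi> :: "int \<Rightarrow> 'a \<Rightarrow> 'a \<Rightarrow> real"
  assumes \<eta>_pos: "\<eta> > 0" and \<eta>_le_1: "\<eta> \<le> 1"
    and basis: "orthonormal_basis_L2 M (SIGMA k:UNIV. new_points \<X> k) (\<lambda>(k, \<alpha>). \<psi> k \<alpha>)"
    and estimates: "\<exists>C \<nu>. \<nu> > 0 \<and> (\<forall>k. \<forall>\<alpha>\<in>new_points \<X> k.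
          (\<forall>x. \<bar>\<psi> k \<alpha> x\<bar> \<le> C / sqrt (measure M (qball d \<alpha> (\<delta> powi k))) *
                 exp (- \<nu> * (d \<alpha> x / \<delta> powi k) powr (1 / (1 + 2 * log 2 A\<^sub>0)))) \<and>
          (\<forall>x y. d x y \<le> \<delta> powi k \<longrightarrow>
             \<bar>\<psi> k \<alpha> x - \<psi> k \<alpha> y\<bar> \<le> C / sqrt (measure M (qball d \<alpha> (\<delta> powi k))) *
                 (d x y / \<delta> powi k) powr \<eta> *
                 exp (- \<nu> * (d \<alpha> x / \<delta> powi k) powr (1 / (1 + 2 * log 2 A\<^sub>0)))))"
    and cancellation: "\<alpha> \<in> new_points \<X> k \<Longrightarrow> has_bochner_integral M (\<psi> k \<alpha>) 0"

section \<open>Test functions and distributions\<close>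

(* Test functions and functionals take values in a scalar field 'b (real or complex). *)

definition test_weight ::
    "'a measure \<Rightarrow> ('a \<Rightarrow> 'a \<Rightarrow> real) \<Rightarrow> 'a \<Rightarrow> real \<Rightarrow> real \<Rightarrow> 'a \<Rightarrow> real" where
  "test_weight M d x\<^sub>0 r \<gamma> x =
     1 / (measure M (qball d x\<^sub>0 r) + measure M (qball d x (d x x\<^sub>0))) *
     (r / (r + d x x\<^sub>0)) powr \<gamma>"

definition test_bound ::
    "'a measure \<Rightarrow> ('a \<Rightarrow> 'a \<Rightarrow> real) \<Rightarrow> real \<Rightarrow> 'a \<Rightarrow> real \<Rightarrow> real \<Rightarrow> real \<Rightarrow>
     ('a \<Rightarrow> 'b::real_normed_vector) \<Rightarrow> real \<Rightarrow> bool" where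
  "test_bound M d A\<^sub>0 x\<^sub>0 r \<beta> \<gamma> f C \<longleftrightarrow>
     (\<forall>x. norm (f x) \<le> C * test_weight M d x\<^sub>0 r \<gamma> x) \<and>
     (\<forall>x y. d x y < 1 / (2 * A\<^sub>0) * (r + d x x\<^sub>0) \<longrightarrow>
        norm (f x - f y) \<le> C * (d x y / (r + d x x\<^sub>0)) powr \<beta> * test_weight M d x\<^sub>0 r \<gamma> x)"

definition test_space ::
    "'a measure \<Rightarrow> ('a \<Rightarrow> 'a \<Rightarrow> real) \<Rightarrow> real \<Rightarrow> 'a \<Rightarrow> real \<Rightarrow> real \<Rightarrow> real \<Rightarrow>
     ('a \<Rightarrow> 'b::{real_normed_field, banach, second_countable_topology}) set" where
  "test_space M d A\<^sub>0 x\<^sub>0 r \<beta> \<gamma> =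
     {f. (\<exists>C>0. test_bound M d A\<^sub>0 x\<^sub>0 r \<beta> \<gamma> f C) \<and> has_bochner_integral M f 0}"

definition test_norm ::
    "'a measure \<Rightarrow> ('a \<Rightarrow> 'a \<Rightarrow> real) \<Rightarrow> real \<Rightarrow> 'a \<Rightarrow> real \<Rightarrow> real \<Rightarrow> real \<Rightarrow>
     ('a \<Rightarrow> 'b::real_normed_vector) \<Rightarrow> real" where
  "test_norm M d A\<^sub>0 x\<^sub>0 r \<beta> \<gamma> f = Inf {C. C > 0 \<and> test_bound M d A\<^sub>0 x\<^sub>0 r \<beta> \<gamma> f C}"

(* For \<beta> \<le> \<eta> the space G(\<eta>,\<gamma>) is contained in the Banach space G(\<beta>,\<gamma>), so its completion in the
   norm of G(\<beta>,\<gamma>) is its closure in G(\<beta>,\<gamma>). *)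
definition completed_test_space ::
    "'a measure \<Rightarrow> ('a \<Rightarrow> 'a \<Rightarrow> real) \<Rightarrow> real \<Rightarrow> 'a \<Rightarrow> real \<Rightarrow> real \<Rightarrow> real \<Rightarrow>
     ('a \<Rightarrow> 'b::{real_normed_field, banach, second_countable_topology}) set" where
  "completed_test_space M d A\<^sub>0 x\<^sub>0 \<eta> \<beta> \<gamma> =
     {f \<in> test_space M d A\<^sub>0 x\<^sub>0 1 \<beta> \<gamma>.
        \<forall>\<epsilon>>0. \<exists>g\<in>test_space M d A\<^sub>0 x\<^sub>0 1 \<eta> \<gamma>. test_norm M d A\<^sub>0 x\<^sub>0 1 \<beta> \<gamma> (\<lambda>x. f x - g x) < \<epsilon>}"

(* A functional is represented by any map on all functions whose restriction to the completed
   test space is linear and bounded; its values elsewhere are irrelevant. *)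
definition distributions ::
    "'a measure \<Rightarrow> ('a \<Rightarrow> 'a \<Rightarrow> real) \<Rightarrow> real \<Rightarrow> 'a \<Rightarrow> real \<Rightarrow> real \<Rightarrow> real \<Rightarrow>
     (('a \<Rightarrow> 'b) \<Rightarrow> 'b::{real_normed_field, banach, second_countable_topology}) set" where
  "distributions M d A\<^sub>0 x\<^sub>0 \<eta> \<beta> \<gamma> =
     {f. (\<forall>g\<in>completed_test_space M d A\<^sub>0 x\<^sub>0 \<eta> \<beta> \<gamma>. \<forall>h\<in>completed_test_space M d A\<^sub>0 x\<^sub>0 \<eta> \<beta> \<gamma>.
            f (\<lambda>x. g x + h x) = f g + f h) \<and>
         (\<forall>c. \<forall>g\<in>completed_test_space M d A\<^sub>0 x\<^sub>0 \<eta> \<beta> \<gamma>. f (\<lambda>x. c * g x) = c * f g) \<and>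
         (\<exists>B. \<forall>g\<in>completed_test_space M d A\<^sub>0 x\<^sub>0 \<eta> \<beta> \<gamma>.
            norm (f g) \<le> B * test_norm M d A\<^sub>0 x\<^sub>0 1 \<beta> \<gamma> g)}"

definition wavelet_coeff ::
    "(int \<Rightarrow> 'a \<Rightarrow> 'a \<Rightarrow> real) \<Rightarrow> (('a \<Rightarrow> 'b) \<Rightarrow> 'b::real_normed_field) \<Rightarrow> int \<Rightarrow> 'a \<Rightarrow> 'b" where
  "wavelet_coeff \<psi> f k \<alpha> = f (\<lambda>x. of_real (\<psi> k \<alpha> x))"

definition wavelet_operator ::
    "(int \<Rightarrow> 'a set) \<Rightarrow> (int \<Rightarrow> 'a \<Rightarrow> 'a \<Rightarrow> real) \<Rightarrow> int \<Rightarrow>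
     (('a \<Rightarrow> 'b) \<Rightarrow> 'b::real_normed_field) \<Rightarrow> 'a \<Rightarrow> 'b" where
  "wavelet_operator \<X> \<psi> k f x =
     (\<Sum>\<^sub>\<infinity>\<alpha>\<in>new_points \<X> k. wavelet_coeff \<psi> f k \<alpha> * of_real (\<psi> k \<alpha> x))"

section \<open>Square functions and their \<open>L\<^sup>p\<close> (quasi-)norms\<close>

(* Used with p > 0 only. *)
definition ennreal_powr :: "ennreal \<Rightarrow> real \<Rightarrow> ennreal" where
  "ennreal_powr x p = (if x = \<infinity> then \<infinity> else ennreal (enn2real x powr p))"

definition Lp_norm :: "'a measure \<Rightarrow> real \<Rightarrow> ('a \<Rightarrow> ennreal) \<Rightarrow> ennreal" where
  "Lp_norm M p g = ennreal_powr (\<integral>\<^sup>+x. ennreal_powr (g x) p \<partial>M) (1 / p)"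

(* The cube centred at the point \<alpha> of new_points \<X> k has generation k + 1. *)
definition wavelet_square_function ::
    "'a measure \<Rightarrow> (int \<Rightarrow> 'a set) \<Rightarrow> (int \<Rightarrow> 'a \<Rightarrow> 'a set) \<Rightarrow> (int \<Rightarrow> 'a \<Rightarrow> 'a \<Rightarrow> real) \<Rightarrow>
     (('a \<Rightarrow> 'b) \<Rightarrow> 'b::real_normed_field) \<Rightarrow> 'a \<Rightarrow> ennreal" where
  "wavelet_square_function M \<X> Q \<psi> f x = ennreal_powr
     (\<Sum>\<^sub>\<infinity>k. \<Sum>\<^sub>\<infinity>\<alpha>\<in>new_points \<X> k.
        ennreal ((norm (wavelet_coeff \<psi> f k \<alpha>) * normalized_indicator M (Q (k + 1) \<alpha>) x)\<^sup>2))
     (1 / 2)"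

definition sup_square_function ::
    "(int \<Rightarrow> 'a set) \<Rightarrow> (int \<Rightarrow> 'a \<Rightarrow> 'a set) \<Rightarrow> (int \<Rightarrow> 'a \<Rightarrow> 'a \<Rightarrow> real) \<Rightarrow> nat \<Rightarrow>
     (('a \<Rightarrow> 'b) \<Rightarrow> 'b::real_normed_field) \<Rightarrow> 'a \<Rightarrow> ennreal" where
  "sup_square_function \<X> Q \<psi> N f x = ennreal_powr
     (\<Sum>\<^sub>\<infinity>k. \<Sum>\<^sub>\<infinity>\<alpha>\<in>\<X> (k + int N).
        (SUP z\<in>Q (k + int N) \<alpha>. ennreal ((norm (wavelet_operator \<X> \<psi> k f z))\<^sup>2)) *
        indicator (Q (k + int N) \<alpha>) x)
     (1 / 2)"

definition inf_square_function ::
    "(int \<Rightarrow> 'a set) \<Rightarrow> (int \<Rightarrow> 'a \<Rightarrow> 'a set) \<Rightarrow> (int \<Rightarrow> 'a \<Rightarrow> 'a \<Rightarrow> real) \<Rightarrow> nat \<Rightarrow>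
     (('a \<Rightarrow> 'b) \<Rightarrow> 'b::real_normed_field) \<Rightarrow> 'a \<Rightarrow> ennreal" where
  "inf_square_function \<X> Q \<psi> N f x = ennreal_powr
     (\<Sum>\<^sub>\<infinity>k. \<Sum>\<^sub>\<infinity>\<alpha>\<in>\<X> (k + int N).
        (INF z\<in>Q (k + int N) \<alpha>. ennreal ((norm (wavelet_operator \<X> \<psi> k f z))\<^sup>2)) *
        indicator (Q (k + int N) \<alpha>) x)
     (1 / 2)"

end

theory Submission
  imports Defs
begin

text \<open>
  The function \<open>D\<^sub>k f\<close> is built from the coefficients of the single level \<open>k\<close>, and these can in turn be
  recovered from \<open>D\<^sub>k f\<close> by orthonormality. Both inequalities therefore reduce to estimates at one level,
  followed by an inequality that combines the levels in \<open>L\<^sup>p\<close>.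

  The combining inequality is \<open>smoothing\<close>: for every \<open>q > 0\<close> and nonnegative numbers \<open>b Q\<close> attached to the cubes,
  \<open>\<integral> (\<Sum>Q. b Q * w Q)^q \<le> C * \<integral> (\<Sum>Q. b Q * indicator Q)^q\<close>, where \<open>w Q\<close> is the weight
  \<open>(1 + d(x, center) / \<delta>^k)^(- L)\<close> with large \<open>L\<close>. It is used with \<open>q = p / 2\<close>. To prove it, the terms are ordered by
  generation and \<open>(\<Sum>i. a i)^q\<close> is compared with \<open>\<Sum>i. a i * (\<Sum>j not finer than i. a j)^(q - 1)\<close>. A sum over
  cubes not finer than \<open>Q\<close> hardly changes between a point of \<open>Q\<close> and a point near \<open>Q\<close>, and changes at most polynomially
  farther away. For \<open>q \<le> 1\<close> the power \<open>q - 1\<close> is nonpositive and a lower bound for the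
  partial sums in terms of indicators suffices (\<open>finite_smoothing_concave\<close>). For \<open>q \<ge> 1\<close> the weights are decomposed into
  dilated balls, which leads to \<open>\<integral> W^q \<le> C * \<integral> F * W^(q - 1)\<close> for the smoothed sum \<open>W\<close> and the original sum \<open>F\<close>;
  Young's inequality and absorption finish the argument (\<open>finite_smoothing_convex\<close>).

  For the first inequality, the decay of the wavelets and Cauchy--Schwarz bound \<open>|D\<^sub>k f(z)|\<^sup>2\<close> by a weighted sum of
  \<open>|\<langle>\<psi>, f\<rangle>|\<^sup>2 / \<mu>(Q)\<close>, uniformly for \<open>z\<close> in a cube of generation \<open>k + N\<close> (\<open>wavelet_sum_bound\<close>).

  For the second one, write a coefficient as the integral of \<open>\<psi> * D\<^sub>k f\<close> and replace \<open>D\<^sub>k f\<close> on each cube of generation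
  \<open>k + N\<close> by the infimum of its norm there. Hoelder regularity bounds the error by \<open>\<delta>^(N * \<eta>)\<close> times a weighted sum of the
  coefficients of the same level (\<open>amplitude_le_cell_min\<close>). When \<open>N\<close> is large this is absorbed
  (\<open>amplitude_le_cell_min_sum\<close>), at a fixed level and point. The absorption requires the weighted sum
  to be finite, and it is: a bounded functional on the test space has wavelet coefficients
  of at most polynomial growth at each level (\<open>dominated_coeffs_of_distribution\<close>).
\<close>

section \<open>Countable sums of extended nonnegative numbers\<close>

abbreviation nsum :: "'i set \<Rightarrow> ('i \<Rightarrow> ennreal) \<Rightarrow> ennreal" where
  "nsum A f \<equiv> (\<integral>\<^sup>+i. f i \<partial>count_space A)"

text \<open>One sequence of finite sets computes every sum over a countable set, so a sum of functions is an
  increasing limit of finite sums, simultaneously at all points.\<close>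

lemma exhausting_finite_sets:
  assumes "countable A"
  obtains J :: "nat \<Rightarrow> 'i set" where "incseq J" "\<And>n. finite (J n)" "\<And>n. J n \<subseteq> A"
    "\<And>f. nsum A f = (SUP n. sum f (J n))"
proof (cases "A = {}")
  case True
  then show ?thesis by (intro that[of "\<lambda>_. {}"]) (auto simp: incseq_def nn_integral_empty)
next
  case False
  define J where "J n = from_nat_into A ` {..<n}" for n
  have J: "incseq J" "\<And>n. finite (J n)" "\<And>n. J n \<subseteq> A"
    using from_nat_into[OF False] by (auto simp: J_def incseq_def)
  have "nsum A f = (SUP n. sum f (J n))" for f :: "'i \<Rightarrow> ennreal"
  proof -
    have un: "\<exists>n. i \<in> J n" if "i \<in> A" for i
      using from_nat_into_surj[OF assms that] by (auto simp: J_def)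
    have "f i = (SUP n. f i * indicator (J n) i)" if "i \<in> A" for i
    proof (rule antisym)
      obtain n where "i \<in> J n" using un[OF \<open>i \<in> A\<close>] by blast
      then have "f i = f i * indicator (J n) i" by simp
      also have "\<dots> \<le> (SUP n. f i * indicator (J n) i)" by (rule SUP_upper) simp
      finally show "f i \<le> (SUP n. f i * indicator (J n) i)" .
    qed (auto intro!: SUP_least split: split_indicator)
    then have "nsum A f = nsum A (\<lambda>i. SUP n. f i * indicator (J n) i)"
      by (intro nn_integral_cong) auto
    also have "\<dots> = (SUP n. nsum A (\<lambda>i. f i * indicator (J n) i))"
      using J(1) by (intro nn_integral_monotone_convergence_SUP)
        (auto simp: incseq_def le_fun_def split: split_indicator)
    also have "\<dots> = (SUP n. sum f (J n))"
    proof (intro SUP_cong refl)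
      fix n
      show "nsum A (\<lambda>i. f i * indicator (J n) i) = sum f (J n)"
        using J by (subst nn_integral_count_space'[of "J n"]) (auto split: split_indicator intro!: sum.cong)
    qed
    finally show ?thesis .
  qed
  with J show ?thesis by (intro that)
qed

lemma sum_le_nsum:
  assumes "finite F" "F \<subseteq> A"
  shows "sum f F \<le> nsum A f"
proof -
  have "sum f F = nsum A (\<lambda>i. f i * indicator F i)"
    using assms by (subst nn_integral_count_space'[of F]) (auto split: split_indicator intro!: sum.cong)
  also have "\<dots> \<le> nsum A f" by (intro nn_integral_mono) (auto split: split_indicator)
  finally show ?thesis .
qed

lemma nsum_leI:
  fixes f :: "'i \<Rightarrow> ennreal"
  assumes "countable A" "\<And>F. finite F \<Longrightarrow> F \<subseteq> A \<Longrightarrow> sum f F \<le> C"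
  shows "nsum A f \<le> C"
proof -
  obtain J :: "nat \<Rightarrow> 'i set" where J: "incseq J" "\<And>n. finite (J n)" "\<And>n. J n \<subseteq> A"
    "\<And>f. nsum A f = (SUP n. sum f (J n))"
    by (rule exhausting_finite_sets[OF assms(1)]) blast
  show ?thesis
    unfolding J(4) by (intro SUP_least assms(2) J(2,3))
qed

lemma infsum_ennreal_eq_nsum:
  fixes f :: "'i \<Rightarrow> ennreal"
  assumes "countable A"
  shows "infsum f A = nsum A f"
proof -
  have "infsum f A = (SUP F\<in>{F. finite F \<and> F \<subseteq> A}. sum f F)"
    by (rule nonneg_infsum_complete) auto
  also have "\<dots> = nsum A f"
    using sum_le_nsum[of _ A f] assms
    by (intro antisym SUP_least nsum_leI) (auto intro: SUP_upper)
  finally show ?thesis .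
qed

lemma nsum_Sigma:
  assumes "countable A"
  shows "nsum (Sigma A B) f = nsum A (\<lambda>k. nsum (B k) (\<lambda>\<alpha>. f (k, \<alpha>)))"
proof -
  have "nsum (Sigma A B) f = nsum (Sigma A B) (\<lambda>i. nsum A (\<lambda>k. f i * indicator {fst i} k))"
    by (intro nn_integral_cong) (auto simp: nn_integral_cmult)
  also have "\<dots> = nsum A (\<lambda>k. nsum (Sigma A B) (\<lambda>i. f i * indicator {fst i} k))"
    by (intro nn_integral_count_space_nn_integral assms) auto
  also have "\<dots> = nsum A (\<lambda>k. nsum (B k) (\<lambda>\<alpha>. f (k, \<alpha>)))"
  proof (intro nn_integral_cong)
    fix k assume "k \<in> space (count_space A)"
    then have k: "k \<in> A" by simp
    have "nsum (Sigma A B) (\<lambda>i. f i * indicator {fst i} k) = nsum (Pair k ` B k) f"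
      using k by (subst (1 2) nn_integral_count_space_indicator)
        (auto intro!: nn_integral_cong split: split_indicator)
    also have "\<dots> = nsum (B k) (\<lambda>\<alpha>. f (k, \<alpha>))"
      by (rule nn_integral_bij_count_space[symmetric]) (auto simp: bij_betw_def inj_on_def)
    finally show "nsum (Sigma A B) (\<lambda>i. f i * indicator {fst i} k) = nsum (B k) (\<lambda>\<alpha>. f (k, \<alpha>))" .
  qed
  finally show ?thesis .
qed

lemma nsum_subset_mono:
  assumes "A \<subseteq> B" "\<And>i. i \<in> A \<Longrightarrow> f i \<le> g i"
  shows "nsum A f \<le> nsum B g"
  using assms by (subst (1 2) nn_integral_count_space_indicator)
    (auto intro!: nn_integral_mono split: split_indicator)

lemma nsum_split:
  assumes "J \<subseteq> A"
  shows "nsum A f = nsum J f + nsum (A - J) f"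
proof -
  have "nsum A f = nsum A (\<lambda>i. f i * indicator J i + f i * indicator (A - J) i)"
    by (intro nn_integral_cong) (auto split: split_indicator)
  also have "\<dots> = nsum A (\<lambda>i. f i * indicator J i) + nsum A (\<lambda>i. f i * indicator (A - J) i)"
    by (rule nn_integral_add) auto
  also have "nsum A (\<lambda>i. f i * indicator J i) = nsum J f"
    using assms by (subst (1 2) nn_integral_count_space_indicator) (auto intro!: nn_integral_cong split: split_indicator)
  also have "nsum A (\<lambda>i. f i * indicator (A - J) i) = nsum (A - J) f"
    by (subst (1 2) nn_integral_count_space_indicator) (auto intro!: nn_integral_cong split: split_indicator)
  finally show ?thesis .
qed

lemma nsum_small_tail:
  fixes f :: "'i \<Rightarrow> ennreal"
  assumes A: "countable A" and fin: "nsum A f < \<infinity>" and "i \<in> A" "(e :: real) > 0"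
  shows "\<exists>J. finite J \<and> J \<subseteq> A \<and> i \<in> J \<and> nsum (A - J) f \<le> ennreal e"
proof -
  obtain J :: "nat \<Rightarrow> 'i set" where J: "incseq J" "\<And>n. finite (J n)" "\<And>n. J n \<subseteq> A"
    "\<And>f. nsum A f = (SUP n. sum f (J n))"
    by (rule exhausting_finite_sets[OF A]) blast
  obtain n where n: "nsum A f < sum f (J n) + ennreal e"
  proof -
    have "\<exists>n\<in>UNIV. nsum A f < sum f (J n) + ennreal e"
      using fin \<open>e > 0\<close> by (intro SUP_approx_ennreal J(4)) auto
    then show thesis using that by blast
  qed
  let ?J = "insert i (J n)"
  have sub: "?J \<subseteq> A" "finite ?J" using J(2,3) \<open>i \<in> A\<close> by auto
  have "sum f ?J + nsum (A - ?J) f = nsum A f"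
    using nsum_split[OF sub(1), of f] sub(2) by (simp add: nn_integral_count_space_finite del: sum.insert_if)
  also have "\<dots> \<le> sum f (J n) + ennreal e" using n by simp
  also have "\<dots> \<le> sum f ?J + ennreal e" using sub(2) by (intro add_right_mono sum_mono2) auto
  finally have "sum f ?J + nsum (A - ?J) f \<le> sum f ?J + ennreal e" .
  moreover have "sum f ?J < \<infinity>" using sum_le_nsum[OF sub(2,1), of f] fin by simp
  ultimately have "nsum (A - ?J) f \<le> ennreal e" by (auto simp: ennreal_add_left_cancel_le)
  then show ?thesis using sub by blast
qed

lemma nsum_int_shift: "nsum UNIV (\<lambda>k::int. g (k + j)) = nsum UNIV g"
  by (rule nn_integral_bij_count_space) (auto intro: bij_betw_byWitness[where f' = "\<lambda>k. k - j"])

lemma nsum_Cauchy_Schwarz: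
  fixes a u :: "'i \<Rightarrow> real"
  assumes "countable A" "\<And>i. a i \<ge> 0" "\<And>i. u i \<ge> 0"
  shows "(nsum A (\<lambda>i. ennreal (a i * u i)))\<^sup>2 \<le> nsum A (\<lambda>i. ennreal (u i)) * nsum A (\<lambda>i. ennreal ((a i)\<^sup>2 * u i))"
proof -
  obtain J :: "nat \<Rightarrow> 'i set" where J: "incseq J" "\<And>n. finite (J n)" "\<And>n. J n \<subseteq> A"
    "\<And>f. nsum A f = (SUP n. sum f (J n))"
    by (rule exhausting_finite_sets[OF assms(1)]) blast
  let ?s = "\<lambda>n. sum (\<lambda>i. ennreal (a i * u i)) (J n)"
  have mono: "?s m \<le> ?s n" if "m \<le> n" for m n
    using J that by (auto simp: incseq_def intro!: sum_mono2)
  have sq: "?s n * ?s n \<le> nsum A (\<lambda>i. ennreal (u i)) * nsum A (\<lambda>i. ennreal ((a i)\<^sup>2 * u i))" for n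
  proof -
    have "(\<Sum>i\<in>J n. a i * u i)\<^sup>2 \<le> (\<Sum>i\<in>J n. u i) * (\<Sum>i\<in>J n. (a i)\<^sup>2 * u i)"
      using Cauchy_Schwarz_ineq_sum[of "\<lambda>i. sqrt (u i)" "\<lambda>i. a i * sqrt (u i)" "J n"] assms
      by (simp add: power_mult_distrib mult_ac)
    then have "ennreal ((\<Sum>i\<in>J n. a i * u i)\<^sup>2) \<le> ennreal ((\<Sum>i\<in>J n. u i) * (\<Sum>i\<in>J n. (a i)\<^sup>2 * u i))"
      by (rule ennreal_leI)
    then have "?s n * ?s n \<le> sum (\<lambda>i. ennreal (u i)) (J n) * sum (\<lambda>i. ennreal ((a i)\<^sup>2 * u i)) (J n)"
      using assms by (simp add: sum_ennreal sum_nonneg ennreal_mult'[symmetric] power2_eq_square)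
    also have "\<dots> \<le> nsum A (\<lambda>i. ennreal (u i)) * nsum A (\<lambda>i. ennreal ((a i)\<^sup>2 * u i))"
      using J by (intro mult_mono sum_le_nsum) auto
    finally show ?thesis .
  qed
  have "(nsum A (\<lambda>i. ennreal (a i * u i)))\<^sup>2 = (SUP m. SUP n. ?s n * ?s m)"
    by (simp add: J(4) power2_eq_square SUP_mult_left_ennreal SUP_mult_right_ennreal)
  also have "\<dots> \<le> nsum A (\<lambda>i. ennreal (u i)) * nsum A (\<lambda>i. ennreal ((a i)\<^sup>2 * u i))"
  proof (intro SUP_least)
    fix m n
    have "?s n * ?s m \<le> ?s (max m n) * ?s (max m n)"
      by (intro mult_mono mono) auto
    also note sq
    finally show "?s n * ?s m \<le> nsum A (\<lambda>i. ennreal (u i)) * nsum A (\<lambda>i. ennreal ((a i)\<^sup>2 * u i))" .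
  qed
  finally show ?thesis .
qed

lemma borel_measurable_nsum:
  fixes f :: "'i \<Rightarrow> 'a \<Rightarrow> ennreal"
  assumes "countable A" "\<And>i. i \<in> A \<Longrightarrow> f i \<in> borel_measurable M"
  shows "(\<lambda>x. nsum A (\<lambda>i. f i x)) \<in> borel_measurable M"
proof -
  obtain J :: "nat \<Rightarrow> 'i set" where J: "incseq J" "\<And>n. finite (J n)" "\<And>n. J n \<subseteq> A"
    "\<And>f. nsum A f = (SUP n. sum f (J n))"
    by (rule exhausting_finite_sets[OF assms(1)]) blast
  have "(\<lambda>x. SUP n. \<Sum>i\<in>J n. f i x) \<in> borel_measurable M"
    using J(3) assms(2) by (intro borel_measurable_SUP borel_measurable_sum) auto
  then show ?thesis unfolding J(4) .
qed

lemma norm_summable_of_nsum_finite: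
  fixes g :: "'i \<Rightarrow> 'b::real_normed_vector"
  assumes "nsum A (\<lambda>i. ennreal (norm (g i))) < \<infinity>"
  shows "(\<lambda>i. norm (g i)) summable_on A"
proof (rule nonneg_bdd_above_summable_on)
  show "bdd_above (sum (\<lambda>i. norm (g i)) ` {F. F \<subseteq> A \<and> finite F})"
  proof (rule bdd_aboveI2[of _ _ "enn2real (nsum A (\<lambda>i. ennreal (norm (g i))))"])
    fix F assume F: "F \<in> {F. F \<subseteq> A \<and> finite F}"
    have "ennreal (\<Sum>i\<in>F. norm (g i)) = (\<Sum>i\<in>F. ennreal (norm (g i)))" by (simp add: sum_ennreal)
    also have "\<dots> \<le> nsum A (\<lambda>i. ennreal (norm (g i)))" using F by (intro sum_le_nsum) auto
    also have "\<dots> = ennreal (enn2real (nsum A (\<lambda>i. ennreal (norm (g i)))))" using assms by simp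
    finally show "(\<Sum>i\<in>F. norm (g i)) \<le> enn2real (nsum A (\<lambda>i. ennreal (norm (g i))))"
      by (subst (asm) ennreal_le_iff) auto
  qed
qed auto

text \<open>If the right-hand side is infinite there is nothing to show; otherwise the family is absolutely
  summable.\<close>

lemma norm_infsum_le_nsum:
  fixes g :: "'i \<Rightarrow> 'b::banach"
  shows "ennreal (norm (infsum g A)) \<le> nsum A (\<lambda>i. ennreal (norm (g i)))"
proof (cases "nsum A (\<lambda>i. ennreal (norm (g i))) < \<infinity>")
  case True
  have s: "(\<lambda>i. norm (g i)) summable_on A" by (rule norm_summable_of_nsum_finite[OF True])
  have "ennreal (norm (infsum g A)) \<le> ennreal (infsum (\<lambda>i. norm (g i)) A)"
    using s by (intro ennreal_leI norm_infsum_bound)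
  also have "\<dots> = (SUP F\<in>{F. finite F \<and> F \<subseteq> A}. ennreal (\<Sum>i\<in>F. norm (g i)))"
    using s by (intro infsum_nonneg_is_SUPREMUM_ennreal) auto
  also have "\<dots> \<le> nsum A (\<lambda>i. ennreal (norm (g i)))"
  proof (rule SUP_least)
    fix F assume "F \<in> {F. finite F \<and> F \<subseteq> A}"
    then have "(\<Sum>i\<in>F. ennreal (norm (g i))) \<le> nsum A (\<lambda>i. ennreal (norm (g i)))"
      by (intro sum_le_nsum) auto
    then show "ennreal (\<Sum>i\<in>F. norm (g i)) \<le> nsum A (\<lambda>i. ennreal (norm (g i)))"
      by (simp add: sum_ennreal)
  qed
  finally show ?thesis .
qed (simp add: not_less top_unique)

section \<open>Powers, infima and absorption in the extended half-line\<close>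

lemma ennreal_powr_ennreal: "x \<ge> 0 \<Longrightarrow> ennreal_powr (ennreal x) p = ennreal (x powr p)"
  by (simp add: ennreal_powr_def)

lemma ennreal_powr_powr:
  assumes "p > 0" "q > 0"
  shows "ennreal_powr (ennreal_powr x p) q = ennreal_powr x (p * q)"
  by (cases x) (auto simp: ennreal_powr_def powr_powr)

lemma ennreal_powr_1: "ennreal_powr x 1 = x"
  by (cases x) (auto simp: ennreal_powr_def)

lemma ennreal_powr_mono:
  assumes "x \<le> y" "p > 0"
  shows "ennreal_powr x p \<le> ennreal_powr y p"
proof (cases y)
  case (real s)
  then obtain r where r: "x = ennreal r" "r \<ge> 0" using assms(1) by (cases x) (auto simp: top_unique)
  then have "r \<le> s" using assms real by simp
  then show ?thesis using r real assms by (simp add: ennreal_powr_ennreal ennreal_leI powr_mono2)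
qed (simp add: ennreal_powr_def)

text \<open>Powers with reciprocal exponents form a Galois connection; hence powers commute with suprema.\<close>

lemma ennreal_powr_le_iff:
  assumes "p > 0"
  shows "ennreal_powr x p \<le> y \<longleftrightarrow> x \<le> ennreal_powr y (1 / p)"
proof
  assume "ennreal_powr x p \<le> y"
  then have "ennreal_powr (ennreal_powr x p) (1 / p) \<le> ennreal_powr y (1 / p)"
    using assms by (intro ennreal_powr_mono) auto
  then show "x \<le> ennreal_powr y (1 / p)" using assms by (simp add: ennreal_powr_powr ennreal_powr_1)
next
  assume "x \<le> ennreal_powr y (1 / p)"
  then have "ennreal_powr x p \<le> ennreal_powr (ennreal_powr y (1 / p)) p"
    using assms by (intro ennreal_powr_mono) auto
  then show "ennreal_powr x p \<le> y" using assms by (simp add: ennreal_powr_powr ennreal_powr_1)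
qed

lemma ennreal_powr_SUP:
  assumes "p > 0"
  shows "ennreal_powr (SUP n. f n) p = (SUP n. ennreal_powr (f n) p)"
proof (rule antisym)
  show "ennreal_powr (SUP n. f n) p \<le> (SUP n. ennreal_powr (f n) p)"
    using assms by (auto simp: ennreal_powr_le_iff SUP_le_iff)
      (auto simp: ennreal_powr_le_iff[symmetric] intro: SUP_upper)
  show "(SUP n. ennreal_powr (f n) p) \<le> ennreal_powr (SUP n. f n) p"
    using assms by (intro SUP_least ennreal_powr_mono SUP_upper) auto
qed

lemma ennreal_powr_cmult:
  assumes "c > 0"
  shows "ennreal_powr (ennreal c * x) p = ennreal (c powr p) * ennreal_powr x p"
  using assms by (cases x) (auto simp: ennreal_powr_def ennreal_mult_top ennreal_mult'[symmetric] powr_mult)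

lemma borel_measurable_ennreal_powr [measurable (raw)]:
  assumes [measurable]: "f \<in> borel_measurable M"
  shows "(\<lambda>x. ennreal_powr (f x) p) \<in> borel_measurable M"
  unfolding ennreal_powr_def by measurable

lemma Lp_norm_le_of_powr_integral_le:
  assumes p: "p > 0" and C: "C > 0"
    and le: "(\<integral>\<^sup>+x. ennreal_powr (F x) (p / 2) \<partial>M) \<le> ennreal C * (\<integral>\<^sup>+x. ennreal_powr (G x) (p / 2) \<partial>M)"
  shows "Lp_norm M p (\<lambda>x. ennreal_powr (F x) (1/2)) \<le> ennreal (C powr (1 / p)) * Lp_norm M p (\<lambda>x. ennreal_powr (G x) (1/2))"
proof -
  have "Lp_norm M p (\<lambda>x. ennreal_powr (F x) (1/2)) = ennreal_powr (\<integral>\<^sup>+x. ennreal_powr (F x) (p / 2) \<partial>M) (1 / p)" for F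
    using p unfolding Lp_norm_def by (simp add: ennreal_powr_powr)
  then show ?thesis
    using ennreal_powr_mono[OF le, of "1 / p"] p C by (simp add: ennreal_powr_cmult)
qed

lemma ennreal_absorb_half:
  fixes I R :: ennreal
  assumes "I \<le> ennreal (1/2) * I + R" "I < \<infinity>"
  shows "I \<le> 2 * R"
proof (cases R)
  case (real r)
  obtain i where i: "I = ennreal i" "i \<ge> 0" using assms(2) by (cases I) auto
  have "ennreal (1/2 * i + r) = ennreal (1/2 * i) + ennreal r"
    using i real by (intro ennreal_plus) auto
  also have "ennreal (1/2 * i) = ennreal (1/2) * ennreal i"
    using i by (intro ennreal_mult) auto
  finally have "ennreal i \<le> ennreal (1/2 * i + r)"
    using assms(1) i real by simp
  then have "i \<le> 1/2 * i + r" using i real by (subst (asm) ennreal_le_iff) auto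
  then have "ennreal i \<le> ennreal (2 * r)" by (intro ennreal_leI) simp
  then show ?thesis using i real by (simp add: ennreal_mult)
qed (simp add: ennreal_mult_top)

lemma ennreal_sqrt_INF_bound:
  fixes g :: "'a \<Rightarrow> real"
  assumes S: "S \<noteq> {}" and g: "\<And>z. z \<in> S \<Longrightarrow> g z \<ge> 0"
  shows "(INF z\<in>S. ennreal ((g z)\<^sup>2)) = ennreal ((sqrt (enn2real (INF z\<in>S. ennreal ((g z)\<^sup>2))))\<^sup>2)"
    and "(\<And>z. z \<in> S \<Longrightarrow> t \<le> g z + e) \<Longrightarrow> t \<le> sqrt (enn2real (INF z\<in>S. ennreal ((g z)\<^sup>2))) + e"
proof -
  let ?I = "INF z\<in>S. ennreal ((g z)\<^sup>2)"
  obtain z0 where "z0 \<in> S" using S by blast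
  then have "?I \<le> ennreal ((g z0)\<^sup>2)" by (rule INF_lower)
  then have "?I < top" by (rule le_less_trans) simp
  then show eq: "?I = ennreal ((sqrt (enn2real ?I))\<^sup>2)" by simp
  show "t \<le> sqrt (enn2real ?I) + e" if le: "\<And>z. z \<in> S \<Longrightarrow> t \<le> g z + e"
  proof (cases "t \<le> e")
    case True
    then show ?thesis by (smt (verit) enn2real_nonneg real_sqrt_ge_zero)
  next
    case False
    have "ennreal ((t - e)\<^sup>2) \<le> ?I"
    proof (intro INF_greatest ennreal_leI power_mono)
      fix z assume "z \<in> S"
      then show "t - e \<le> g z" using le[of z] by simp
    qed (use False in auto)
    then have "ennreal ((t - e)\<^sup>2) \<le> ennreal ((sqrt (enn2real ?I))\<^sup>2)" using eq by simp
    then have "(t - e)\<^sup>2 \<le> (sqrt (enn2real ?I))\<^sup>2" by (subst (asm) ennreal_le_iff) auto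
    then have "t - e \<le> sqrt (enn2real ?I)" by (rule power2_le_imp_le) simp
    then show ?thesis by simp
  qed
qed

lemma ennreal_le_of_all_real_eps:
  fixes x y :: ennreal
  assumes "C \<ge> 0" "\<And>e. e > 0 \<Longrightarrow> x \<le> y + ennreal C * ennreal e"
  shows "x \<le> y"
proof (rule ennreal_le_epsilon)
  fix e :: real assume "e > 0"
  then have "x \<le> y + ennreal C * ennreal (e / (C + 1))" using assms(1) by (intro assms(2)) auto
  also have "ennreal C * ennreal (e / (C + 1)) = ennreal (C * (e / (C + 1)))"
    using assms(1) \<open>e > 0\<close> by (intro ennreal_mult[symmetric]) auto
  also have "\<dots> \<le> ennreal e"
    using assms(1) \<open>e > 0\<close> by (intro ennreal_leI) (simp add: field_simps)
  finally show "x \<le> y + ennreal e" by (simp add: add_left_mono)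
qed

lemma le_nn_integral_of_le_on:
  assumes S: "S \<in> sets M" "emeasure M S = ennreal m" "m > 0"
    and le: "\<And>y. y \<in> S \<Longrightarrow> A \<le> ennreal m * g y"
  shows "A \<le> (\<integral>\<^sup>+y. g y * indicator S y \<partial>M)"
proof -
  have "A = A / ennreal m * ennreal m"
    using S by (simp add: ennreal_divide_times divide_mult_eq ennreal_mult_divide_eq)
  also have "\<dots> = (\<integral>\<^sup>+y. (A / ennreal m) * indicator S y \<partial>M)"
    using S by (subst nn_integral_cmult_indicator) auto
  also have "\<dots> \<le> (\<integral>\<^sup>+y. g y * indicator S y \<partial>M)"
  proof (intro nn_integral_mono)
    fix y
    have "A / ennreal m \<le> g y" if "y \<in> S"
      using le[OF that] S(3) by (intro divide_le_posI_ennreal) auto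
    then show "A / ennreal m * indicator S y \<le> g y * indicator S y"
      by (auto split: split_indicator)
  qed
  finally show ?thesis .
qed

section \<open>Polynomially decaying weights\<close>

text \<open>The power weight that replaces the indicator of a ball of radius \<open>r\<close>: up to a factor
  it does not change when \<open>x\<close> or \<open>y\<close> moves by a multiple of \<open>r\<close>, and for large \<open>L\<close> it is
  integrable and summable over the points of one generation.\<close>

definition bump :: "('a \<Rightarrow> 'a \<Rightarrow> real) \<Rightarrow> real \<Rightarrow> real \<Rightarrow> 'a \<Rightarrow> 'a \<Rightarrow> real" where
  "bump d L r x y = (1 + d x y / r) powr (- L)"

context homogeneous_type
begin

lemma dist_self [simp]: "d x x = 0"
  using dist_eq_0_iff by blast

lemma borel_measurable_dist [measurable]: "(\<lambda>y. d x y) \<in> borel_measurable M"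
proof (rule borel_measurableI_less)
  fix a
  have "{y \<in> space M. d x y < a} = qball d x a"
    by (auto simp: qball_def space_eq)
  then show "{y \<in> space M. d x y < a} \<in> sets M"
    using qball_measurable by simp
qed

lemma borel_measurable_dist' [measurable]: "(\<lambda>y. d y x) \<in> borel_measurable M"
  using borel_measurable_dist[of x] dist_commute by simp

lemma borel_measurable_bump [measurable]:
  "(\<lambda>y. bump d L r x y) \<in> borel_measurable M" "(\<lambda>y. bump d L r y x) \<in> borel_measurable M"
  unfolding bump_def by measurable

lemma bump_base_ge_1: "r > 0 \<Longrightarrow> 1 \<le> 1 + d x y / r"
  using dist_nonneg by simp

lemma bump_pos: "r > 0 \<Longrightarrow> 0 < bump d L r x y"
  unfolding bump_def using bump_base_ge_1[of r x y] by simp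

lemma bump_nonneg [simp]: "0 \<le> bump d L r x y"
  unfolding bump_def by simp

lemma bump_le_1: "r > 0 \<Longrightarrow> L \<ge> 0 \<Longrightarrow> bump d L r x y \<le> 1"
  unfolding bump_def using bump_base_ge_1[of r x y] by (simp add: powr_minus powr_le1 ge_one_powr_ge_zero inverse_le_1_iff)

lemma bump_self [simp]: "bump d L r x x = 1"
  by (simp add: bump_def)

lemma bump_commute: "bump d L r x y = bump d L r y x"
  by (simp add: bump_def dist_commute)

lemma bump_antimono: "r > 0 \<Longrightarrow> L \<le> L' \<Longrightarrow> bump d L' r x y \<le> bump d L r x y"
  unfolding bump_def using bump_base_ge_1[of r x y] by (simp add: powr_mono)

lemma bump_mult: "r > 0 \<Longrightarrow> bump d L r x y * bump d L' r x y = bump d (L + L') r x y"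
  unfolding bump_def by (simp add: powr_add[symmetric] algebra_simps)

lemma bump_powr: "r > 0 \<Longrightarrow> bump d L r x y powr s = bump d (L * s) r x y"
  unfolding bump_def by (simp add: powr_powr)

text \<open>The constant \<open>1\<close> in the weight turns the quasi-triangle inequality into a
  submultiplicative one; all comparisons of weights below come from this.\<close>

lemma bump_triangle_base:
  assumes "r > 0"
  shows "1 + d x z / r \<le> A\<^sub>0 * (1 + d x y / r) * (1 + d y z / r)"
proof -
  have "1 + d x z / r \<le> A\<^sub>0 * 1 + A\<^sub>0 * (d x y + d y z) / r + A\<^sub>0 * (d x y / r) * (d y z / r)"
    using quasi_triangle[of x z y] A\<^sub>0_ge_1 assms dist_nonneg
    by (intro add_increasing2 add_mono divide_right_mono mult_nonneg_nonneg) auto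
  also have "\<dots> = A\<^sub>0 * (1 + d x y / r) * (1 + d y z / r)"
    using assms by (simp add: field_simps)
  finally show ?thesis .
qed

lemma bump_triangle:
  assumes "r > 0" "L \<ge> 0"
  shows "bump d L r x y * bump d L r y z \<le> A\<^sub>0 powr L * bump d L r x z"
proof -
  have "(1 + d x z / r) powr L \<le> (A\<^sub>0 * (1 + d x y / r) * (1 + d y z / r)) powr L"
    using bump_triangle_base[of r x z y] bump_base_ge_1[of r] assms by (intro powr_mono2) (auto simp: dist_nonneg)
  also have "\<dots> = A\<^sub>0 powr L * (1 + d x y / r) powr L * (1 + d y z / r) powr L"
    using A\<^sub>0_ge_1 bump_base_ge_1[of r] assms by (simp add: powr_mult dist_nonneg)
  finally show ?thesis
    unfolding bump_def powr_minus using bump_base_ge_1[of r x z] bump_base_ge_1[of r x y] bump_base_ge_1[of r y z] assms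
    by (simp add: field_simps)
qed

lemma bump_ge_of_near:
  assumes "r > 0" "L \<ge> 0" "d x y \<le> c * r"
  shows "(1 + c) powr (- L) \<le> bump d L r x y"
  unfolding bump_def using assms bump_base_ge_1[of r x y]
  by (intro powr_mono2') (auto simp: field_simps)

text \<open>Weights at two points within \<open>c * r\<close> of each other are comparable: put the bounded weight of
  \<open>(x, y)\<close> into the submultiplicative inequality.\<close>

lemma bump_shift:
  assumes "r > 0" "L \<ge> 0" "d x y \<le> c * r"
  shows "bump d L r x z \<le> (A\<^sub>0 * (1 + c)) powr L * bump d L r y z"
proof -
  have c: "1 + c > 0"
    using assms dist_nonneg[of x y] by (smt (verit) mult_nonneg_nonneg mult_neg_pos)
  have "(1 + c) powr (- L) * bump d L r x z \<le> bump d L r y x * bump d L r x z"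
    using bump_ge_of_near[OF assms] by (intro mult_right_mono) (auto simp: bump_commute[of _ _ y])
  also have "\<dots> \<le> A\<^sub>0 powr L * bump d L r y z"
    by (rule bump_triangle) fact+
  finally have "bump d L r x z \<le> (1 + c) powr L * (A\<^sub>0 powr L * bump d L r y z)"
    using c by (simp add: powr_minus field_simps)
  then show ?thesis
    using c A\<^sub>0_ge_1 by (simp add: powr_mult mult_ac)
qed

lemma bump_rescale:
  assumes "0 < r" "r \<le> R" "L \<ge> 0"
  shows "bump d L R x y \<le> (R / r) powr L * bump d L r x y"
proof -
  have "1 + d x y / r \<le> (R / r) * (1 + d x y / R)"
    using assms dist_nonneg[of x y] by (simp add: field_simps)
  then have "(1 + d x y / r) powr L \<le> ((R / r) * (1 + d x y / R)) powr L"
    using assms bump_base_ge_1[of r x y] by (intro powr_mono2) auto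
  also have "\<dots> = (R / r) powr L * (1 + d x y / R) powr L"
    by (rule powr_mult)
  finally show ?thesis
    unfolding bump_def powr_minus using bump_base_ge_1[of r x y] bump_base_ge_1[of R x y] assms
    by (simp add: field_simps)
qed

text \<open>Dyadic shells: \<open>n\<close> is the least exponent for which \<open>y\<close> lies in the ball of radius
  \<open>2^n * r\<close>; if it is positive then \<open>y\<close> is outside the previous ball, which bounds the weight.\<close>

lemma bump_shell:
  assumes r: "r > 0" and L: "L \<ge> 0"
  obtains n where "d x y < 2 ^ n * r" "bump d L r x y \<le> 2 powr L * (1/2) powr (real n * L)"
proof -
  obtain n0 where n0: "d x y / r < 2 ^ n0" using real_arch_pow[of 2 "d x y / r"] by auto
  define n where "n = (LEAST n. d x y / r < 2 ^ n)"
  have n: "d x y / r < 2 ^ n" unfolding n_def using n0 by (rule LeastI)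
  have "bump d L r x y \<le> 2 powr L * (1/2) powr (real n * L)"
  proof (cases n)
    case 0
    have "bump d L r x y \<le> 1" using r L by (intro bump_le_1) auto
    also have "\<dots> \<le> 2 powr L" using L by (intro ge_one_powr_ge_zero) auto
    finally show ?thesis using 0 by simp
  next
    case (Suc m)
    have "\<not> d x y / r < 2 ^ m" unfolding n_def using Suc n_def not_less_Least[of m "\<lambda>n. d x y / r < 2 ^ n"] by simp
    then have m: "2 ^ m \<le> 1 + d x y / r" by simp
    have "bump d L r x y \<le> (2 ^ m) powr (- L)"
      unfolding bump_def using m L by (intro powr_mono2') auto
    also have "\<dots> = 2 powr L * (1/2) powr (real n * L)"
      using Suc by (simp add: powr_realpow[symmetric] powr_powr powr_divide powr_minus_divide[symmetric] powr_add[symmetric] algebra_simps)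
    finally show ?thesis .
  qed
  with n r show ?thesis by (intro that[of n]) (auto simp: field_simps)
qed

lemma bump_scale_mono:
  assumes "0 < r" "r \<le> R" "L \<ge> 0"
  shows "bump d L r x y \<le> bump d L R x y"
  unfolding bump_def using assms dist_nonneg[of x y] bump_base_ge_1[of R x y]
  by (intro powr_mono2') (auto intro!: divide_left_mono mult_pos_pos add_pos_nonneg)

text \<open>Of the two steps from \<open>x\<close> to \<open>z\<close> the longer one is at least a multiple of \<open>d x z\<close>, so its
  weight is at most a multiple of the weight of \<open>(x, z)\<close>. In contrast to \<open>bump_triangle\<close>
  this keeps a decaying factor, with no loss in the exponent, so that sums over \<open>y\<close> converge.\<close>

lemma bump_mult_le:
  assumes r: "r > 0" and L: "L \<ge> 0"
  shows "bump d L r x y * bump d L r y z \<le> (2 * A\<^sub>0) powr L * (bump d L r x z * (bump d L r x y + bump d L r y z))"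
proof -
  have A: "A\<^sub>0 > 0" using A\<^sub>0_ge_1 by simp
  have main: "bump d L r x y * bump d L r y z \<le> (2 * A\<^sub>0) powr L * (bump d L r x z * bump d L r y z)"
    if le: "d y z \<le> d x y" for x y z
  proof -
    have "d x z \<le> A\<^sub>0 * (d x y + d x y)"
      using quasi_triangle[of x z y] le mult_left_mono[of "d x y + d y z" "d x y + d x y" A\<^sub>0] A by linarith
    then have "d x z / r \<le> 2 * A\<^sub>0 * (d x y / r)"
      using r by (simp add: field_simps)
    then have "1 + d x z / r \<le> 2 * A\<^sub>0 * (1 + d x y / r)"
      using A\<^sub>0_ge_1 by (simp add: distrib_left)
    then have "(2 * A\<^sub>0 * (1 + d x y / r)) powr (- L) \<le> (1 + d x z / r) powr (- L)"
      using L bump_base_ge_1[OF r, of x z] by (intro powr_mono2') auto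
    then have "(2 * A\<^sub>0) powr (- L) * bump d L r x y \<le> bump d L r x z"
      by (simp add: bump_def powr_mult)
    then have "bump d L r x y \<le> (2 * A\<^sub>0) powr L * bump d L r x z"
      using A by (simp add: powr_minus field_simps)
    then have "bump d L r x y * bump d L r y z \<le> ((2 * A\<^sub>0) powr L * bump d L r x z) * bump d L r y z"
      by (rule mult_right_mono) simp
    then show ?thesis by (simp only: mult.assoc)
  qed
  show ?thesis
  proof (cases "d y z \<le> d x y")
    case True
    have "(2 * A\<^sub>0) powr L * (bump d L r x z * bump d L r y z)
       \<le> (2 * A\<^sub>0) powr L * (bump d L r x z * (bump d L r x y + bump d L r y z))"
      by (intro mult_left_mono) auto
    then show ?thesis using main[OF True] by linarith
  next
    case False
    then have "bump d L r z y * bump d L r y x \<le> (2 * A\<^sub>0) powr L * (bump d L r z x * bump d L r y x)"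
      by (intro main) (simp add: dist_commute)
    also have "\<dots> = (2 * A\<^sub>0) powr L * (bump d L r x z * bump d L r x y)"
      by (simp add: bump_commute)
    also have "\<dots> \<le> (2 * A\<^sub>0) powr L * (bump d L r x z * (bump d L r x y + bump d L r y z))"
      by (intro mult_left_mono) auto
    finally show ?thesis by (simp add: bump_commute[of _ _ z y] bump_commute[of _ _ y x] mult.commute)
  qed
qed

end

section \<open>Volumes of balls and dyadic cubes\<close>

text \<open>The locale fixes one dimension bound with an explicit constant, so that constants depending only
  on the space can be written down.\<close>

locale doubling_cubes = dyadic_cubes M d A\<^sub>0 \<delta> \<X> Q
  for M :: "'a measure" and d :: "'a \<Rightarrow> 'a \<Rightarrow> real" and A\<^sub>0 \<delta> :: real
    and \<X> :: "int \<Rightarrow> 'a set" and Q :: "int \<Rightarrow> 'a \<Rightarrow> 'a set" +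
  fixes \<omega> K :: real
  assumes \<omega>_pos: "\<omega> > 0" and K_ge_1: "K \<ge> 1"
    and growth: "t \<ge> 1 \<Longrightarrow> r > 0 \<Longrightarrow>
        measure M (qball d x (t * r)) \<le> K * t powr \<omega> * measure M (qball d x r)"

context doubling_cubes
begin

abbreviation scale :: "int \<Rightarrow> real" where "scale k \<equiv> \<delta> powi k"

abbreviation V :: "real \<Rightarrow> 'a \<Rightarrow> real" where "V r x \<equiv> measure M (qball d x r)"

abbreviation w :: "real \<Rightarrow> real \<Rightarrow> 'a \<Rightarrow> 'a \<Rightarrow> real" where "w \<equiv> bump d"

lemma \<delta>_simps [simp]: "0 < \<delta>" "0 \<le> \<delta>" "\<delta> \<noteq> 0"
  using \<delta>_pos by auto

lemma scale_pos: "0 < scale k"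
  using \<delta>_pos by simp

lemma \<delta>_less_1: "\<delta> < 1"
proof -
  have "(1::real) \<le> A\<^sub>0 ^ 10" using A\<^sub>0_ge_1 by simp
  then have "10 ^ 3 * A\<^sub>0 ^ 10 \<ge> 1000" by simp
  then have "1 / (10 ^ 3 * A\<^sub>0 ^ 10) \<le> 1 / 1000" by (intro divide_left_mono) auto
  then show ?thesis using \<delta>_small by linarith
qed

lemma scale_antimono: "j \<le> k \<Longrightarrow> scale k \<le> scale j"
  using \<delta>_pos \<delta>_less_1 by (intro power_int_decreasing) auto

lemma scale_add: "scale (k + j) = scale k * scale j"
  by (simp add: power_int_add)

lemma scale_Suc: "scale (k + 1) = \<delta> * scale k"
  by (simp add: scale_add)

lemma A\<^sub>0_pos [simp]: "0 < A\<^sub>0" "0 \<le> A\<^sub>0" "A\<^sub>0 \<noteq> 0"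
  using A\<^sub>0_ge_1 by auto

lemma A\<^sub>0_sq: "1 \<le> A\<^sub>0\<^sup>2"
  using A\<^sub>0_ge_1 by simp

lemma K_pos [simp]: "0 < K" "0 \<le> K" "K \<noteq> 0"
  using K_ge_1 by auto

lemma emeasure_qball: "r > 0 \<Longrightarrow> emeasure M (qball d x r) = ennreal (V r x)"
  using qball_finite[of r x] by (simp add: emeasure_eq_ennreal_measure less_top)

lemma V_pos: "r > 0 \<Longrightarrow> 0 < V r x"
  using qball_pos[of r x] emeasure_qball[of r x] by simp

lemma measure_mono_in_ball:
  assumes "S \<in> sets M" "S \<subseteq> qball d x r" "r > 0"
  shows "measure M S \<le> V r x" "emeasure M S = ennreal (measure M S)"
proof -
  have fin: "emeasure M (qball d x r) \<noteq> \<infinity>" using qball_finite[of r x] assms by simp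
  then show "measure M S \<le> V r x"
    using assms qball_measurable by (intro measure_mono_fmeasurable) (auto simp: fmeasurable_def less_top)
  have "emeasure M S \<le> emeasure M (qball d x r)" using assms qball_measurable by (intro emeasure_mono) auto
  then show "emeasure M S = ennreal (measure M S)"
    using fin by (intro emeasure_eq_ennreal_measure) (auto simp: top_unique)
qed

text \<open>Volumes of balls of equal radius at different centers differ at most polynomially in the distance:
  one ball lies in the dilate of the other by \<open>A\<^sub>0 * (1 + d x y / r)\<close>.\<close>

lemma V_compare:
  assumes "r > 0"
  shows "V r y * w \<omega> r x y \<le> K * A\<^sub>0 powr \<omega> * V r x"
proof -
  have t: "1 \<le> A\<^sub>0 * (1 + d x y / r)"
    using A\<^sub>0_ge_1 bump_base_ge_1[OF assms, of x y] by (metis mult_mono mult_1 zero_le_one order_trans)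
  have "qball d y r \<subseteq> qball d x (A\<^sub>0 * (1 + d x y / r) * r)"
  proof
    fix z assume "z \<in> qball d y r"
    then have "d x z < A\<^sub>0 * (d x y + r)"
      using quasi_triangle[of x z y] A\<^sub>0_ge_1 unfolding qball_def
      by (smt (verit, best) mem_Collect_eq mult_less_cancel_left_pos)
    also have "\<dots> = A\<^sub>0 * (1 + d x y / r) * r" using assms by (simp add: field_simps)
    finally show "z \<in> qball d x (A\<^sub>0 * (1 + d x y / r) * r)" by (simp add: qball_def)
  qed
  then have "V r y \<le> V (A\<^sub>0 * (1 + d x y / r) * r) x"
    using t assms qball_measurable by (intro measure_mono_in_ball) auto
  also have "\<dots> \<le> K * (A\<^sub>0 * (1 + d x y / r)) powr \<omega> * V r x"
    using t assms by (rule growth)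
  also have "\<dots> = K * A\<^sub>0 powr \<omega> * V r x / w \<omega> r x y"
    unfolding bump_def powr_minus using A\<^sub>0_ge_1 bump_base_ge_1[OF assms, of x y]
    by (simp add: powr_mult divide_inverse)
  finally show ?thesis using bump_pos[OF assms] by (simp add: field_simps)
qed

text \<open>Summing over dyadic shells: the weight decays like \<open>2^(- m * (\<omega> + 1))\<close> while the volume
  grows like \<open>2^(m * \<omega>)\<close>.\<close>

lemma nn_integral_bump:
  assumes r: "r > 0" and L: "L \<ge> \<omega> + 1"
  shows "(\<integral>\<^sup>+y. ennreal (w L r x y) \<partial>M) \<le> ennreal (2 powr (\<omega> + 2) * K * V r x)"
proof -
  let ?B = "\<lambda>m. qball d x (2 ^ m * r)"
  have le: "ennreal (w L r x y) \<le> (\<Sum>m. ennreal (2 powr (\<omega> + 1) * (1/2) powr (real m * (\<omega> + 1))) * indicator (?B m) y)" for y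
  proof -
    obtain n where n: "d x y < 2 ^ n * r" "w (\<omega> + 1) r x y \<le> 2 powr (\<omega> + 1) * (1/2) powr (real n * (\<omega> + 1))"
      using bump_shell[OF r, of "\<omega> + 1" x y] \<omega>_pos by auto
    have "w L r x y \<le> w (\<omega> + 1) r x y" using r L by (intro bump_antimono) auto
    also note n(2)
    finally have "ennreal (w L r x y) \<le> (\<lambda>m. ennreal (2 powr (\<omega> + 1) * (1/2) powr (real m * (\<omega> + 1))) * indicator (?B m) y) n"
      using n r by (auto simp: qball_def intro!: ennreal_leI)
    also have "\<dots> \<le> (\<Sum>m. ennreal (2 powr (\<omega> + 1) * (1/2) powr (real m * (\<omega> + 1))) * indicator (?B m) y)"
      by (rule sum_le_suminf[of _ "{n}", simplified]) auto
    finally show ?thesis .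
  qed
  have "(\<integral>\<^sup>+y. ennreal (w L r x y) \<partial>M) \<le> (\<integral>\<^sup>+y. (\<Sum>m. ennreal (2 powr (\<omega> + 1) * (1/2) powr (real m * (\<omega> + 1))) * indicator (?B m) y) \<partial>M)"
    by (intro nn_integral_mono le)
  also have "\<dots> = (\<Sum>m. ennreal (2 powr (\<omega> + 1) * (1/2) powr (real m * (\<omega> + 1))) * emeasure M (?B m))"
    using qball_measurable by (subst nn_integral_suminf) (auto simp: nn_integral_cmult_indicator)
  also have "\<dots> \<le> (\<Sum>m. ennreal (2 powr (\<omega> + 1) * K * V r x * (1/2) ^ m))"
  proof (intro suminf_le)
    fix m
    have "2 powr (\<omega> + 1) * (1/2) powr (real m * (\<omega> + 1)) * V (2 ^ m * r) x
        \<le> 2 powr (\<omega> + 1) * (1/2) powr (real m * (\<omega> + 1)) * (K * (2 ^ m) powr \<omega> * V r x)"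
      using growth[of "2 ^ m" r x] r by (intro mult_left_mono) auto
    also have "\<dots> = 2 powr (\<omega> + 1) * K * V r x * (1/2) ^ m"
      by (simp add: powr_realpow[symmetric] powr_powr powr_divide powr_minus_divide algebra_simps powr_add)
    finally show "ennreal (2 powr (\<omega> + 1) * (1/2) powr (real m * (\<omega> + 1))) * emeasure M (?B m) \<le> ennreal (2 powr (\<omega> + 1) * K * V r x * (1/2) ^ m)"
      using r by (subst emeasure_qball) (auto simp: ennreal_mult'[symmetric] intro!: ennreal_leI)
  qed auto
  also have "\<dots> = ennreal (\<Sum>m. 2 powr (\<omega> + 1) * K * V r x * (1/2) ^ m)"
    using K_ge_1 by (intro suminf_ennreal_eq summable_sums[THEN sums_unique, symmetric] summable_sums summable_mult) auto
  also have "(\<Sum>m. 2 powr (\<omega> + 1) * K * V r x * (1/2) ^ m) = 2 powr (\<omega> + 2) * K * V r x"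
    by (subst suminf_mult) (auto simp: suminf_geometric powr_add)
  finally show ?thesis .
qed

lemma cube_near: "\<alpha> \<in> \<X> k \<Longrightarrow> y \<in> Q k \<alpha> \<Longrightarrow> d \<alpha> y \<le> 4 * A\<^sub>0\<^sup>2 * scale k"
  using cube_outer[of \<alpha> k] by (auto simp: qball_def)

lemma cube_diameter:
  assumes "\<alpha> \<in> \<X> k" "y \<in> Q k \<alpha>" "z \<in> Q k \<alpha>"
  shows "d y z \<le> 8 * A\<^sub>0 ^ 3 * scale k"
proof -
  have "d y z \<le> A\<^sub>0 * (d y \<alpha> + d \<alpha> z)" by (rule quasi_triangle)
  also have "\<dots> \<le> A\<^sub>0 * (4 * A\<^sub>0\<^sup>2 * scale k + 4 * A\<^sub>0\<^sup>2 * scale k)"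
    using cube_near[OF assms(1)] assms dist_commute[of y \<alpha>] by (intro mult_left_mono add_mono) auto
  finally show ?thesis by (simp add: power2_eq_square power3_eq_cube)
qed

lemma emeasure_cube: "\<alpha> \<in> \<X> k \<Longrightarrow> emeasure M (Q k \<alpha>) = ennreal (measure M (Q k \<alpha>))"
  using A\<^sub>0_ge_1 by (intro measure_mono_in_ball(2)[OF _ cube_outer] cube_measurable) auto

lemma measure_cube_le: "\<alpha> \<in> \<X> k \<Longrightarrow> measure M (Q k \<alpha>) \<le> K * (4 * A\<^sub>0\<^sup>2) powr \<omega> * V (scale k) \<alpha>"
  using measure_mono_in_ball(1)[OF cube_measurable cube_outer, of \<alpha> k] growth[of "4 * A\<^sub>0\<^sup>2" "scale k" \<alpha>] A\<^sub>0_sq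
  by (smt (verit) scale_pos mult_pos_pos)

lemma measure_cube_ge:
  assumes "\<alpha> \<in> \<X> k"
  shows "V (scale k) \<alpha> \<le> K * (3 * A\<^sub>0\<^sup>2) powr \<omega> * measure M (Q k \<alpha>)"
proof -
  let ?r = "1 / (3 * A\<^sub>0\<^sup>2) * scale k"
  have r: "?r > 0" by (intro mult_pos_pos divide_pos_pos) auto
  have "V (3 * A\<^sub>0\<^sup>2 * ?r) \<alpha> \<le> K * (3 * A\<^sub>0\<^sup>2) powr \<omega> * V ?r \<alpha>"
    using A\<^sub>0_sq r by (intro growth) auto
  moreover have "V ?r \<alpha> \<le> measure M (Q k \<alpha>)"
    using cube_inner[OF assms] emeasure_cube[OF assms] qball_measurable cube_measurable[OF assms]
    by (intro measure_mono_fmeasurable) (auto simp: fmeasurable_def)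
  ultimately have "V (3 * A\<^sub>0\<^sup>2 * ?r) \<alpha> \<le> K * (3 * A\<^sub>0\<^sup>2) powr \<omega> * measure M (Q k \<alpha>)"
    by (rule order_trans[OF _ mult_left_mono]) (intro mult_nonneg_nonneg; simp)
  moreover have "3 * A\<^sub>0\<^sup>2 * ?r = scale k" using A\<^sub>0_ge_1 by simp
  ultimately show ?thesis by simp
qed

lemma cube_measure_pos: "\<alpha> \<in> \<X> k \<Longrightarrow> 0 < measure M (Q k \<alpha>)"
  using measure_cube_ge[of \<alpha> k] V_pos[of "scale k" \<alpha>] measure_nonneg[of M "Q k \<alpha>"] scale_pos[of k]
  by (metis less_le mult_zero_right not_less)

text \<open>A sum over centers is compared with an integral: the weight at a center is at most a multiple of
  its average over the cube, and the exponent \<open>\<omega>\<close> that \<open>L\<close> has in reserve pays for the different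
  volumes of cubes far from \<open>x\<close>. Finite subsets come first because countability of the set of
  centers is a consequence.\<close>

lemma finite_bump_sum_bound:
  "\<exists>C\<ge>1. \<forall>k x L F. L \<ge> 2 * \<omega> + 1 \<longrightarrow> finite F \<longrightarrow> F \<subseteq> \<X> k \<longrightarrow> (\<Sum>\<alpha>\<in>F. w L (scale k) x \<alpha>) \<le> C"
proof -
  define D where "D = (A\<^sub>0 * (1 + 4 * A\<^sub>0\<^sup>2)) powr (\<omega> + 1)"
  define c where "c = K * A\<^sub>0 powr \<omega> * (K * (3 * A\<^sub>0\<^sup>2) powr \<omega>) * D"
  define C where "C = c * (2 powr (\<omega> + 2) * K)"
  have pos: "D > 0" "c > 0" "C > 0"
    unfolding D_def c_def C_def using A\<^sub>0_sq by (auto intro!: mult_pos_pos)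
  have "(\<Sum>\<alpha>\<in>F. w L (scale k) x \<alpha>) \<le> C"
    if L: "L \<ge> 2 * \<omega> + 1" and F: "finite F" "F \<subseteq> \<X> k" for k x L F
  proof -
    let ?r = "scale k" and ?v = "w (\<omega> + 1) (scale k) x"
    have Vx: "V ?r x > 0" by (rule V_pos) simp
    have [measurable]: "\<alpha> \<in> F \<Longrightarrow> Q k \<alpha> \<in> sets M" for \<alpha> using F cube_measurable by blast
    have le: "ennreal (w L ?r x \<alpha>) \<le> ennreal (c / V ?r x) * (\<integral>\<^sup>+y. ennreal (?v y) * indicator (Q k \<alpha>) y \<partial>M)"
      if "\<alpha> \<in> F" for \<alpha>
    proof -
      have \<alpha>: "\<alpha> \<in> \<X> k" using that F by blast
      have "w L ?r x \<alpha> \<le> w (\<omega> + 1 + \<omega>) ?r x \<alpha>"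
        using L by (intro bump_antimono) auto
      also have "\<dots> = ?v \<alpha> * w \<omega> ?r x \<alpha>" by (simp add: bump_mult)
      also have "w \<omega> ?r x \<alpha> = w \<omega> ?r \<alpha> x" by (rule bump_commute)
      also have "w \<omega> ?r \<alpha> x \<le> K * A\<^sub>0 powr \<omega> * V ?r \<alpha> / V ?r x"
        using V_compare[of ?r x \<alpha>] Vx by (simp add: field_simps)
      also have "\<dots> \<le> K * A\<^sub>0 powr \<omega> * (K * (3 * A\<^sub>0\<^sup>2) powr \<omega> * measure M (Q k \<alpha>)) / V ?r x"
        using measure_cube_ge[OF \<alpha>] K_ge_1 Vx by (intro divide_right_mono mult_left_mono) auto
      also have "?v \<alpha> * \<dots> = c / V ?r x * (?v \<alpha> / D * measure M (Q k \<alpha>))"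
        using pos by (simp add: c_def)
      finally have "w L ?r x \<alpha> \<le> c / V ?r x * (?v \<alpha> / D * measure M (Q k \<alpha>))"
        by (simp add: mult_left_mono)
      then have "ennreal (w L ?r x \<alpha>) \<le> ennreal (c / V ?r x * (?v \<alpha> / D * measure M (Q k \<alpha>)))"
        by (rule ennreal_leI)
      also have "\<dots> = ennreal (c / V ?r x) * (\<integral>\<^sup>+y. ennreal (?v \<alpha> / D) * indicator (Q k \<alpha>) y \<partial>M)"
        using pos Vx that emeasure_cube[OF \<alpha>] by (subst nn_integral_cmult_indicator) (auto simp: ennreal_mult[symmetric])
      also have "\<dots> \<le> ennreal (c / V ?r x) * (\<integral>\<^sup>+y. ennreal (?v y) * indicator (Q k \<alpha>) y \<partial>M)"
      proof (intro mult_left_mono nn_integral_mono)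
        fix y
        have "?v \<alpha> / D \<le> ?v y" if "y \<in> Q k \<alpha>"
          using bump_shift[OF _ _ cube_near[OF \<alpha> that], of "\<omega> + 1" x] \<omega>_pos pos
          by (simp add: D_def bump_commute[of _ _ x] field_simps)
        then show "ennreal (?v \<alpha> / D) * indicator (Q k \<alpha>) y \<le> ennreal (?v y) * indicator (Q k \<alpha>) y"
          by (auto split: split_indicator intro!: ennreal_leI)
      qed auto
      finally show ?thesis .
    qed
    have "ennreal (\<Sum>\<alpha>\<in>F. w L ?r x \<alpha>) = (\<Sum>\<alpha>\<in>F. ennreal (w L ?r x \<alpha>))"
      by (simp add: sum_ennreal)
    also have "\<dots> \<le> (\<Sum>\<alpha>\<in>F. ennreal (c / V ?r x) * (\<integral>\<^sup>+y. ennreal (?v y) * indicator (Q k \<alpha>) y \<partial>M))"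
      by (intro sum_mono le)
    also have "\<dots> = ennreal (c / V ?r x) * (\<integral>\<^sup>+y. (\<Sum>\<alpha>\<in>F. ennreal (?v y) * indicator (Q k \<alpha>) y) \<partial>M)"
      by (subst nn_integral_sum) (auto simp: sum_distrib_left)
    also have "\<dots> \<le> ennreal (c / V ?r x) * (\<integral>\<^sup>+y. ennreal (?v y) \<partial>M)"
    proof (intro mult_left_mono nn_integral_mono)
      fix y
      have "disjoint_family_on (Q k) F"
        using F cube_disjoint[of _ k] unfolding disjoint_family_on_def by blast
      then have "(\<Sum>\<alpha>\<in>F. indicator (Q k \<alpha>) y :: ennreal) = indicator (\<Union>\<alpha>\<in>F. Q k \<alpha>) y"
        using F by (simp add: indicator_UN_disjoint)
      then have "(\<Sum>\<alpha>\<in>F. ennreal (?v y) * indicator (Q k \<alpha>) y) = ennreal (?v y) * indicator (\<Union>\<alpha>\<in>F. Q k \<alpha>) y"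
        by (simp add: sum_distrib_left[symmetric])
      then show "(\<Sum>\<alpha>\<in>F. ennreal (?v y) * indicator (Q k \<alpha>) y) \<le> ennreal (?v y)"
        by (auto split: split_indicator)
    qed auto
    also have "\<dots> \<le> ennreal (c / V ?r x) * ennreal (2 powr (\<omega> + 2) * K * V ?r x)"
      by (intro mult_left_mono nn_integral_bump) auto
    also have "\<dots> = ennreal C"
      using Vx pos K_ge_1 by (simp add: ennreal_mult[symmetric] C_def)
    finally show ?thesis using pos by (subst (asm) ennreal_le_iff) auto
  qed
  then show ?thesis by (intro exI[of _ "max 1 C"]) (auto simp: le_max_iff_disj)
qed

text \<open>A family of positive numbers with bounded finite sums is countable.\<close>

lemma countable_points: "countable (\<X> k)"
proof -
  obtain C where C: "\<And>x F. finite F \<Longrightarrow> F \<subseteq> \<X> k \<Longrightarrow> (\<Sum>\<alpha>\<in>F. w (2 * \<omega> + 1) (scale k) x \<alpha>) \<le> C"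
    using finite_bump_sum_bound by fastforce
  have "w (2 * \<omega> + 1) (scale k) x summable_on \<X> k" for x
    by (rule nonneg_bdd_above_summable_on) (auto intro!: bdd_aboveI[of _ C] C)
  then have "countable {\<alpha> \<in> \<X> k. w (2 * \<omega> + 1) (scale k) undefined \<alpha> \<noteq> 0}"
    using summable_countable_real by blast
  moreover have "{\<alpha> \<in> \<X> k. w (2 * \<omega> + 1) (scale k) undefined \<alpha> \<noteq> 0} = \<X> k"
    using bump_pos[of "scale k"] by (auto simp: less_le)
  ultimately show ?thesis by simp
qed

lemma bump_sum_bound:
  "\<exists>C\<ge>1. \<forall>k x L. L \<ge> 2 * \<omega> + 1 \<longrightarrow> nsum (\<X> k) (\<lambda>\<alpha>. ennreal (w L (scale k) x \<alpha>)) \<le> ennreal C"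
proof -
  obtain C where C: "C \<ge> 1"
    "\<And>k x L F. L \<ge> 2 * \<omega> + 1 \<Longrightarrow> finite F \<Longrightarrow> F \<subseteq> \<X> k \<Longrightarrow> (\<Sum>\<alpha>\<in>F. w L (scale k) x \<alpha>) \<le> C"
    using finite_bump_sum_bound by blast
  have "nsum (\<X> k) (\<lambda>\<alpha>. ennreal (w L (scale k) x \<alpha>)) \<le> ennreal C" if "L \<ge> 2 * \<omega> + 1" for k x L
    using C(2)[OF that] by (intro nsum_leI countable_points) (auto simp: sum_ennreal intro!: ennreal_leI)
  then show ?thesis using C(1) by blast
qed

lemma countable_new_points: "countable (new_points \<X> k)"
  using countable_points[of "k + 1"] by (rule countable_subset[rotated]) (auto simp: new_points_def)

lemma nsum_cells_le:
  assumes "\<And>\<alpha>. \<alpha> \<in> \<X> k \<Longrightarrow> x \<in> Q k \<alpha> \<Longrightarrow> g \<alpha> \<le> B"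
  shows "nsum (\<X> k) (\<lambda>\<alpha>. g \<alpha> * indicator (Q k \<alpha>) x) \<le> B"
proof -
  obtain \<alpha> where \<alpha>: "\<alpha> \<in> \<X> k" "x \<in> Q k \<alpha>" using cube_cover[of k] by blast
  have "nsum (\<X> k) (\<lambda>\<alpha>. g \<alpha> * indicator (Q k \<alpha>) x) = (\<Sum>\<alpha>\<in>{\<alpha>}. g \<alpha> * indicator (Q k \<alpha>) x)"
    using \<alpha> cube_disjoint[of _ k] by (intro nn_integral_count_space') (auto split: split_indicator)
  then show ?thesis using assms[OF \<alpha>] \<alpha> by simp
qed

lemma nsum_cells_ge:
  assumes "\<alpha> \<in> \<X> k" "x \<in> Q k \<alpha>"
  shows "g \<alpha> \<le> nsum (\<X> k) (\<lambda>\<alpha>. g \<alpha> * indicator (Q k \<alpha>) x)"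
  using sum_le_nsum[of "{\<alpha>}" "\<X> k" "\<lambda>\<alpha>. g \<alpha> * indicator (Q k \<alpha>) x"] assms by simp

text \<open>Half of the exponent \<open>2 * L\<close> moves the weight of \<open>y\<close> from \<open>z\<close> to \<open>x\<close> and the other half is integrated,
  so the exponent of the weight of \<open>y\<close> is preserved.\<close>

lemma nn_integral_bump_bump:
  assumes r: "r > 0" and L: "L \<ge> \<omega> + 1"
  shows "(\<integral>\<^sup>+z. ennreal (w (2 * L) r x z * w L r y z) \<partial>M)
    \<le> ennreal (A\<^sub>0 powr L * (2 powr (\<omega> + 2) * K) * V r x * w L r x y)"
proof -
  have L0: "L \<ge> 0" using L \<omega>_pos by simp
  have "(\<integral>\<^sup>+z. ennreal (w (2 * L) r x z * w L r y z) \<partial>M)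
      \<le> (\<integral>\<^sup>+z. ennreal (A\<^sub>0 powr L * w L r x y) * ennreal (w L r x z) \<partial>M)"
  proof (intro nn_integral_mono)
    fix z
    have "w (2 * L) r x z * w L r y z = w L r x z * (w L r x z * w L r z y)"
      using bump_mult[OF r, of L x z L] by (simp add: bump_commute[of _ _ y z])
    also have "\<dots> \<le> w L r x z * (A\<^sub>0 powr L * w L r x y)"
      by (intro mult_left_mono bump_triangle r L0) auto
    finally have "w (2 * L) r x z * w L r y z \<le> (A\<^sub>0 powr L * w L r x y) * w L r x z"
      by (simp only: mult.commute)
    then show "ennreal (w (2 * L) r x z * w L r y z) \<le> ennreal (A\<^sub>0 powr L * w L r x y) * ennreal (w L r x z)"
      by (subst ennreal_mult[symmetric]) (auto intro!: ennreal_leI)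
  qed
  also have "\<dots> = ennreal (A\<^sub>0 powr L * w L r x y) * (\<integral>\<^sup>+z. ennreal (w L r x z) \<partial>M)"
    by (rule nn_integral_cmult) measurable
  also have "\<dots> \<le> ennreal (A\<^sub>0 powr L * w L r x y) * ennreal (2 powr (\<omega> + 2) * K * V r x)"
    by (intro mult_left_mono nn_integral_bump r L) auto
  also have "\<dots> = ennreal (A\<^sub>0 powr L * (2 powr (\<omega> + 2) * K) * V r x * w L r x y)"
    by (subst ennreal_mult[symmetric]) (auto simp: mult_ac)
  finally show ?thesis .
qed

text \<open>The weight is essentially constant on a cube that is not coarser than the scale; \<open>\<omega>\<close> of the
  exponent is spent on comparing the volumes at \<open>x\<close> and at \<open>\<alpha>\<close>.\<close>

lemma nn_integral_bump_cube:
  assumes L: "L \<ge> \<omega>" and kl: "k \<le> l" and \<alpha>: "\<alpha> \<in> \<X> l"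
  shows "(\<integral>\<^sup>+z. ennreal (w (2 * L) (scale k) x z) * indicator (Q l \<alpha>) z \<partial>M)
    \<le> ennreal ((A\<^sub>0 * (1 + 4 * A\<^sub>0\<^sup>2)) powr (2 * L) * (K * (4 * A\<^sub>0\<^sup>2) powr \<omega>) * (K * A\<^sub>0 powr \<omega>) * V (scale k) x * w L (scale k) x \<alpha>)"
proof -
  let ?r = "scale k" and ?D = "(A\<^sub>0 * (1 + 4 * A\<^sub>0\<^sup>2)) powr (2 * L)"
  have L0: "2 * L \<ge> 0" using L \<omega>_pos by simp
  have [measurable]: "Q l \<alpha> \<in> sets M" by (rule cube_measurable[OF \<alpha>])
  have "(\<integral>\<^sup>+z. ennreal (w (2 * L) ?r x z) * indicator (Q l \<alpha>) z \<partial>M)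
    \<le> (\<integral>\<^sup>+z. ennreal (?D * w (2 * L) ?r x \<alpha>) * indicator (Q l \<alpha>) z \<partial>M)"
  proof (intro nn_integral_mono)
    fix z
    have "w (2 * L) ?r x z \<le> ?D * w (2 * L) ?r x \<alpha>" if "z \<in> Q l \<alpha>"
    proof -
      have "d z \<alpha> \<le> 4 * A\<^sub>0\<^sup>2 * scale l" using cube_near[OF \<alpha> that] by (simp add: dist_commute)
      also have "\<dots> \<le> 4 * A\<^sub>0\<^sup>2 * ?r" by (intro mult_left_mono scale_antimono kl) auto
      finally show ?thesis
        using bump_shift[OF scale_pos L0, of z \<alpha> "4 * A\<^sub>0\<^sup>2" k x] by (simp add: bump_commute[of _ _ x])
    qed
    then show "ennreal (w (2 * L) ?r x z) * indicator (Q l \<alpha>) z \<le> ennreal (?D * w (2 * L) ?r x \<alpha>) * indicator (Q l \<alpha>) z"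
      by (auto split: split_indicator intro!: ennreal_leI)
  qed
  also have "\<dots> = ennreal (?D * w (2 * L) ?r x \<alpha> * measure M (Q l \<alpha>))"
    using emeasure_cube[OF \<alpha>] by (subst nn_integral_cmult_indicator) (auto simp: ennreal_mult[symmetric])
  also have "\<dots> \<le> ennreal (?D * (K * (4 * A\<^sub>0\<^sup>2) powr \<omega>) * (K * A\<^sub>0 powr \<omega>) * V ?r x * w L ?r x \<alpha>)"
  proof (rule ennreal_leI)
    have m: "measure M (Q l \<alpha>) \<le> K * (4 * A\<^sub>0\<^sup>2) powr \<omega> * V ?r \<alpha>"
    proof -
      have "measure M (Q l \<alpha>) \<le> K * (4 * A\<^sub>0\<^sup>2) powr \<omega> * V (scale l) \<alpha>" by (rule measure_cube_le[OF \<alpha>])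
      also have "\<dots> \<le> K * (4 * A\<^sub>0\<^sup>2) powr \<omega> * V ?r \<alpha>"
        using scale_antimono[OF kl]
        by (intro mult_left_mono measure_mono_in_ball qball_measurable) (auto simp: qball_def)
      finally show ?thesis .
    qed
    \<comment> \<open>spend \<open>\<omega>\<close> of the exponent on the volume and discard the rest\<close>
    have "w (2 * L) ?r x \<alpha> = w L ?r x \<alpha> * w (L - \<omega>) ?r x \<alpha> * w \<omega> ?r x \<alpha>"
      by (simp add: bump_mult)
    also have "\<dots> \<le> w L ?r x \<alpha> * 1 * w \<omega> ?r x \<alpha>"
      using L by (intro mult_right_mono mult_left_mono bump_le_1) auto
    finally have "w (2 * L) ?r x \<alpha> * measure M (Q l \<alpha>) \<le> w L ?r x \<alpha> * w \<omega> ?r x \<alpha> * (K * (4 * A\<^sub>0\<^sup>2) powr \<omega> * V ?r \<alpha>)"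
      using m by (intro mult_mono) auto
    also have "\<dots> = w L ?r x \<alpha> * (K * (4 * A\<^sub>0\<^sup>2) powr \<omega>) * (V ?r \<alpha> * w \<omega> ?r x \<alpha>)"
      by (simp only: mult_ac)
    also have "\<dots> \<le> w L ?r x \<alpha> * (K * (4 * A\<^sub>0\<^sup>2) powr \<omega>) * (K * A\<^sub>0 powr \<omega> * V ?r x)"
      by (intro mult_left_mono V_compare mult_nonneg_nonneg) auto
    finally have "?D * (w (2 * L) ?r x \<alpha> * measure M (Q l \<alpha>)) \<le> ?D * (w L ?r x \<alpha> * (K * (4 * A\<^sub>0\<^sup>2) powr \<omega>) * (K * A\<^sub>0 powr \<omega> * V ?r x))"
      by (rule mult_left_mono) simp
    then show "?D * w (2 * L) ?r x \<alpha> * measure M (Q l \<alpha>) \<le> ?D * (K * (4 * A\<^sub>0\<^sup>2) powr \<omega>) * (K * A\<^sub>0 powr \<omega>) * V ?r x * w L ?r x \<alpha>"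
      by (simp only: mult_ac)
  qed
  finally show ?thesis .
qed

end

section \<open>Powers of sums ordered by level\<close>

text \<open>By the mean value theorem the increment of \<open>t powr q\<close> is \<open>q * h * z powr (q - 1)\<close> with \<open>z\<close>
  between \<open>x\<close> and \<open>x + h\<close>; the two signs of \<open>q - 1\<close> give opposite inequalities.\<close>

lemma powr_increment:
  fixes x h q :: real
  assumes "x \<ge> 0" "h \<ge> 0" "q > 0"
  shows "q \<ge> 1 \<Longrightarrow> (x + h) powr q \<le> x powr q + q * (h * (x + h) powr (q - 1))"
    and "q \<le> 1 \<Longrightarrow> x powr q + q * (h * (x + h) powr (q - 1)) \<le> (x + h) powr q"
proof -
  have "(q \<ge> 1 \<longrightarrow> (x + h) powr q \<le> x powr q + q * (h * (x + h) powr (q - 1))) \<and>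
        (q \<le> 1 \<longrightarrow> x powr q + q * (h * (x + h) powr (q - 1)) \<le> (x + h) powr q)"
  proof (cases "x = 0 \<or> h = 0")
    case True
    have "q * (h * h powr (q - 1)) = q * h powr q"
      using assms by (cases "h = 0") (auto simp: powr_mult_base)
    moreover have "q \<ge> 1 \<Longrightarrow> h powr q \<le> q * h powr q" "q \<le> 1 \<Longrightarrow> q * h powr q \<le> h powr q"
      using mult_right_mono[of 1 q "h powr q"] mult_right_mono[of q 1 "h powr q"] by auto
    ultimately show ?thesis using True assms by auto
  next
    case False
    then have xh: "x > 0" "h > 0" using assms by auto
    have "\<exists>z. x < z \<and> z < x + h \<and> (x + h) powr q - x powr q = (x + h - x) * (q * z powr (q - 1))"
      using xh by (intro MVT2) (auto intro!: derivative_eq_intros simp: powr_diff field_simps)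
    then obtain z where z: "x < z" "z < x + h" "(x + h) powr q - x powr q = h * (q * z powr (q - 1))" by auto
    have "q \<ge> 1 \<Longrightarrow> z powr (q - 1) \<le> (x + h) powr (q - 1)"
      using z xh by (intro powr_mono2) auto
    moreover have "q \<le> 1 \<Longrightarrow> (x + h) powr (q - 1) \<le> z powr (q - 1)"
      using z xh by (intro powr_mono2') auto
    ultimately have "q \<ge> 1 \<Longrightarrow> h * (q * z powr (q - 1)) \<le> h * (q * (x + h) powr (q - 1))"
      "q \<le> 1 \<Longrightarrow> h * (q * (x + h) powr (q - 1)) \<le> h * (q * z powr (q - 1))"
      using xh assms by (auto intro!: mult_left_mono)
    then show ?thesis using z(3) by (auto simp: mult_ac)
  qed
  then show "q \<ge> 1 \<Longrightarrow> (x + h) powr q \<le> x powr q + q * (h * (x + h) powr (q - 1))"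
    and "q \<le> 1 \<Longrightarrow> x powr q + q * (h * (x + h) powr (q - 1)) \<le> (x + h) powr q" by auto
qed

text \<open>A discrete form of \<open>d(S^q) = q * S^(q - 1) * dS\<close>: the terms are added in the order of their
  level, and each is paired with the sum of all terms of no larger level. In the application the
  levels are generations, and the partial sums belong to coarser cubes, which hardly vary on the
  cube at hand.\<close>

lemma powr_sum_le_level_sum:
  fixes a :: "'i \<Rightarrow> real" and lev :: "'i \<Rightarrow> int"
  assumes "finite J" "\<And>i. a i \<ge> 0" "q \<ge> 1"
  shows "(\<Sum>i\<in>J. a i) powr q \<le> q * (\<Sum>i\<in>J. a i * (\<Sum>j | j \<in> J \<and> lev j \<le> lev i. a j) powr (q - 1))"
  using assms(1)
proof (induction rule: finite_ranking_induct[where f = lev])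
  case empty
  then show ?case by simp
next
  case (insert i S)
  show ?case
  proof (cases "i \<in> S")
    case True
    then show ?thesis using insert.IH by (simp add: insert_absorb)
  next
    case False
    have top: "{j. j \<in> insert i S \<and> lev j \<le> lev i} = insert i S" using insert.hyps by auto
    have "(\<Sum>j\<in>insert i S. a j) powr q = (sum a S + a i) powr q"
      using insert False by (simp add: add.commute)
    also have "\<dots> \<le> (sum a S) powr q + q * (a i * (sum a S + a i) powr (q - 1))"
      using assms by (intro powr_increment) (auto intro: sum_nonneg)
    also have "\<dots> \<le> q * (\<Sum>k\<in>S. a k * (\<Sum>j | j \<in> S \<and> lev j \<le> lev k. a j) powr (q - 1))
        + q * (a i * (sum a S + a i) powr (q - 1))"
      using insert.IH by simp
    also have "\<dots> \<le> q * (\<Sum>k\<in>S. a k * (\<Sum>j | j \<in> insert i S \<and> lev j \<le> lev k. a j) powr (q - 1))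
        + q * (a i * (sum a S + a i) powr (q - 1))"
      using assms insert.hyps
      by (intro add_mono mult_left_mono sum_mono powr_mono2 sum_mono2 sum_nonneg add_nonneg_nonneg) auto
    also have "\<dots> = q * (\<Sum>k\<in>insert i S. a k * (\<Sum>j | j \<in> insert i S \<and> lev j \<le> lev k. a j) powr (q - 1))"
      using insert.hyps False by (simp add: top add.commute distrib_left del: insert_iff)
    finally show ?thesis .
  qed
qed

text \<open>The same telescoping for \<open>q \<le> 1\<close>, where it gives the reverse inequality.\<close>

lemma level_sum_le_powr_sum:
  fixes a :: "'i \<Rightarrow> real" and lev :: "'i \<Rightarrow> int"
  assumes "finite J" "\<And>i. a i \<ge> 0" "0 < q" "q \<le> 1"
  shows "q * (\<Sum>i\<in>J. a i * (\<Sum>j | j \<in> J \<and> lev j \<le> lev i. a j) powr (q - 1)) \<le> (\<Sum>i\<in>J. a i) powr q"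
  using assms(1)
proof (induction rule: finite_ranking_induct[where f = lev])
  case empty
  then show ?case by simp
next
  case (insert i S)
  show ?case
  proof (cases "i \<in> S")
    case True
    then show ?thesis using insert.IH by (simp add: insert_absorb)
  next
    case False
    have top: "{j. j \<in> insert i S \<and> lev j \<le> lev i} = insert i S" using insert.hyps by auto
    have le: "a k * (\<Sum>j | j \<in> insert i S \<and> lev j \<le> lev k. a j) powr (q - 1)
        \<le> a k * (\<Sum>j | j \<in> S \<and> lev j \<le> lev k. a j) powr (q - 1)" if "k \<in> S" for k
    proof (cases "a k = 0")
      case False
      have "0 < a k" using False assms(2)[of k] by simp
      also have "a k \<le> (\<Sum>j | j \<in> S \<and> lev j \<le> lev k. a j)"
        using that insert.hyps assms by (intro member_le_sum) auto
      finally show ?thesis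
        using insert.hyps assms by (intro mult_left_mono powr_mono2' sum_mono2) auto
    qed simp
    have "q * (\<Sum>k\<in>insert i S. a k * (\<Sum>j | j \<in> insert i S \<and> lev j \<le> lev k. a j) powr (q - 1))
      = q * (\<Sum>k\<in>S. a k * (\<Sum>j | j \<in> insert i S \<and> lev j \<le> lev k. a j) powr (q - 1))
        + q * (a i * (sum a S + a i) powr (q - 1))"
      using insert.hyps False by (simp add: top add.commute distrib_left del: insert_iff)
    also have "\<dots> \<le> q * (\<Sum>k\<in>S. a k * (\<Sum>j | j \<in> S \<and> lev j \<le> lev k. a j) powr (q - 1))
        + q * (a i * (sum a S + a i) powr (q - 1))"
      using assms by (intro add_mono mult_left_mono[of _ _ q] sum_mono le) auto
    also have "\<dots> \<le> (sum a S) powr q + q * (a i * (sum a S + a i) powr (q - 1))"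
      using insert.IH by simp
    also have "\<dots> \<le> (sum a S + a i) powr q"
      using assms by (intro powr_increment) (auto intro: sum_nonneg)
    also have "\<dots> = (\<Sum>j\<in>insert i S. a j) powr q"
      using insert False by (simp add: add.commute)
    finally show ?thesis .
  qed
qed

text \<open>For \<open>q \<le> 1\<close> each partial sum may be replaced by the total, since \<open>t powr (q - 1)\<close> decreases.\<close>

lemma powr_sum_le_level_sum_concave:
  fixes a :: "'i \<Rightarrow> real" and lev :: "'i \<Rightarrow> int"
  assumes "finite J" "\<And>i. a i \<ge> 0" "0 < q" "q \<le> 1"
  shows "(\<Sum>i\<in>J. a i) powr q \<le> (\<Sum>i\<in>J. a i * (\<Sum>j | j \<in> J \<and> lev j \<le> lev i. a j) powr (q - 1))"
proof -
  let ?S = "\<Sum>i\<in>J. a i"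
  have "?S powr q = ?S * ?S powr (q - 1)"
    using assms by (cases "?S = 0") (auto simp: powr_mult_base sum_nonneg)
  also have "\<dots> = (\<Sum>i\<in>J. a i * ?S powr (q - 1))" by (simp add: sum_distrib_right)
  also have "\<dots> \<le> (\<Sum>i\<in>J. a i * (\<Sum>j | j \<in> J \<and> lev j \<le> lev i. a j) powr (q - 1))"
  proof (rule sum_mono)
    fix i assume "i \<in> J"
    show "a i * ?S powr (q - 1) \<le> a i * (\<Sum>j | j \<in> J \<and> lev j \<le> lev i. a j) powr (q - 1)"
    proof (cases "a i = 0")
      case False
      have "0 < a i" using False assms(2)[of i] by simp
      also have "a i \<le> (\<Sum>j | j \<in> J \<and> lev j \<le> lev i. a j)"
        using \<open>i \<in> J\<close> assms by (intro member_le_sum) auto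
      finally show ?thesis
        using assms by (intro mult_left_mono powr_mono2' sum_mono2) auto
    qed simp
  qed
  finally show ?thesis .
qed

text \<open>A Young inequality with a free small parameter: compare \<open>f\<close> with \<open>\<epsilon> * h\<close>. The first
  term is absorbed later.\<close>

lemma mult_powr_young:
  fixes f h \<epsilon> q :: real
  assumes "f \<ge> 0" "h \<ge> 0" "\<epsilon> > 0" "q \<ge> 1"
  shows "f * h powr (q - 1) \<le> \<epsilon> * h powr q + \<epsilon> powr (1 - q) * f powr q"
proof (cases "f \<le> \<epsilon> * h")
  case True
  then have "f * h powr (q - 1) \<le> \<epsilon> * h * h powr (q - 1)" by (intro mult_right_mono) auto
  also have "\<dots> = \<epsilon> * h powr q" using assms by (cases "h = 0") (auto simp: powr_mult_base)
  finally show ?thesis by (smt (verit) mult_nonneg_nonneg powr_ge_zero)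
next
  case False
  then have f: "f > 0" "h \<le> f / \<epsilon>" using assms by (auto simp: field_simps intro: le_less_trans[of 0 "\<epsilon> * h"])
  then have "f * h powr (q - 1) \<le> f * (f / \<epsilon>) powr (q - 1)" using assms by (intro mult_left_mono powr_mono2) auto
  also have "\<dots> = \<epsilon> powr (1 - q) * f powr q" using f assms by (simp add: powr_divide powr_diff field_simps)
  finally show ?thesis using assms by (smt (verit) mult_nonneg_nonneg powr_ge_zero)
qed

section \<open>From cubes to decaying weights in mixed norms\<close>

context doubling_cubes
begin

text \<open>A cube is addressed by generation and center together, because one point is the center of cubes of
  many generations.\<close>

definition pts :: "(int \<times> 'a) set" where "pts = (SIGMA k:UNIV. \<X> k)"

abbreviation cell :: "int \<times> 'a \<Rightarrow> 'a set" where "cell i \<equiv> Q (fst i) (snd i)"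

abbreviation wt :: "real \<Rightarrow> int \<times> 'a \<Rightarrow> 'a \<Rightarrow> real" where "wt L i x \<equiv> w L (scale (fst i)) x (snd i)"

definition bump_sum :: "(int \<times> 'a) set \<Rightarrow> (int \<times> 'a \<Rightarrow> real) \<Rightarrow> real \<Rightarrow> 'a \<Rightarrow> real" where
  "bump_sum J b L x = (\<Sum>i\<in>J. b i * wt L i x)"

definition cell_sum :: "(int \<times> 'a) set \<Rightarrow> (int \<times> 'a \<Rightarrow> real) \<Rightarrow> 'a \<Rightarrow> real" where
  "cell_sum J b x = (\<Sum>i\<in>J. b i * indicator (cell i) x)"

abbreviation bump_series :: "(int \<times> 'a \<Rightarrow> real) \<Rightarrow> real \<Rightarrow> 'a \<Rightarrow> ennreal" where
  "bump_series b L x \<equiv> nsum pts (\<lambda>i. ennreal (b i * wt L i x))"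

abbreviation cell_series :: "(int \<times> 'a \<Rightarrow> real) \<Rightarrow> 'a \<Rightarrow> ennreal" where
  "cell_series b x \<equiv> nsum pts (\<lambda>i. ennreal (b i) * indicator (cell i) x)"

lemma pts_iff: "i \<in> pts \<longleftrightarrow> snd i \<in> \<X> (fst i)"
  by (cases i) (auto simp: pts_def)

lemma nsum_pts: "nsum pts f = nsum UNIV (\<lambda>k. nsum (\<X> k) (\<lambda>\<alpha>. f (k, \<alpha>)))"
  unfolding pts_def by (rule nsum_Sigma) simp

lemma countable_pts: "countable pts"
  unfolding pts_def by (intro countable_SIGMA countable_points) auto

lemma sets_cell [measurable]: "i \<in> pts \<Longrightarrow> cell i \<in> sets M"
  by (auto simp: pts_iff cube_measurable)

lemma borel_measurable_bump_sum [measurable]: "bump_sum J b L \<in> borel_measurable M"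
  unfolding bump_sum_def by measurable

lemma borel_measurable_cell_sum: "J \<subseteq> pts \<Longrightarrow> cell_sum J b \<in> borel_measurable M"
  unfolding cell_sum_def by (intro borel_measurable_sum borel_measurable_times borel_measurable_indicator sets_cell) auto

lemma bump_sum_nonneg: "(\<And>i. b i \<ge> 0) \<Longrightarrow> 0 \<le> bump_sum J b L x"
  unfolding bump_sum_def by (intro sum_nonneg mult_nonneg_nonneg) auto

lemma cell_sum_nonneg: "(\<And>i. b i \<ge> 0) \<Longrightarrow> 0 \<le> cell_sum J b x"
  unfolding cell_sum_def by (intro sum_nonneg mult_nonneg_nonneg) auto

lemma measure_cell_pos: "i \<in> pts \<Longrightarrow> 0 < measure M (cell i)"
  by (auto simp: pts_iff cube_measure_pos)

lemma emeasure_cell: "i \<in> pts \<Longrightarrow> emeasure M (cell i) = ennreal (measure M (cell i))"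
  by (auto simp: pts_iff emeasure_cube)

text \<open>The constant that bounds the volume of a ball of radius \<open>scale k\<close> by that of the cube of
  generation \<open>k\<close> with the same center.\<close>

definition \<kappa> :: real where "\<kappa> = K * (3 * A\<^sub>0\<^sup>2) powr \<omega>"

lemma \<kappa>_pos [simp]: "0 < \<kappa>" "0 \<le> \<kappa>"
  unfolding \<kappa>_def by auto

lemma V_le_cell: "i \<in> pts \<Longrightarrow> V (scale (fst i)) (snd i) \<le> \<kappa> * measure M (cell i)"
  unfolding \<kappa>_def using measure_cube_ge[of "snd i" "fst i"] by (auto simp: pts_iff)

text \<open>If two cubes meet at \<open>y\<close> and \<open>j\<close> is the coarser one, then its center is, on its own scale, close
  to the center of \<open>i\<close>, and its weight decays more slowly.\<close>

lemma wt_le_coarser: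
  assumes "i \<in> pts" "j \<in> pts" "fst j \<le> fst i" "y \<in> cell i" "y \<in> cell j" "L \<ge> 0"
  shows "wt L i x \<le> (A\<^sub>0 * (1 + 4 * A\<^sub>0\<^sup>2)) powr (2 * L) * wt L j x"
proof -
  let ?D = "(A\<^sub>0 * (1 + 4 * A\<^sub>0\<^sup>2)) powr L"
  have "wt L i x \<le> ?D * w L (scale (fst i)) y x"
    using bump_shift[OF scale_pos assms(6) cube_near[of "snd i" "fst i" y], of x] assms
    by (simp add: pts_iff bump_commute[of _ _ x])
  also have "\<dots> \<le> ?D * w L (scale (fst j)) y x"
    using assms by (intro mult_left_mono bump_scale_mono scale_antimono) auto
  also have "\<dots> \<le> ?D * (?D * wt L j x)"
    using bump_shift[OF scale_pos assms(6), of y "snd j" "4 * A\<^sub>0\<^sup>2" "fst j" x] cube_near[of "snd j" "fst j" y] assms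
    by (intro mult_left_mono) (auto simp: pts_iff bump_commute[of _ _ x] dist_commute)
  also have "\<dots> = (A\<^sub>0 * (1 + 4 * A\<^sub>0\<^sup>2)) powr (2 * L) * wt L j x"
    by (simp only: mult_2 powr_add mult.assoc)
  finally show ?thesis .
qed

text \<open>For \<open>q \<le> 1\<close> split \<open>(bump_sum)^q\<close> by generation. At \<open>x\<close>, the partial sum over the cubes not finer
  than \<open>i\<close> is at least a multiple of \<open>wt L i x\<close> times the corresponding sum of indicators at any
  point \<open>y\<close> of cell \<open>i\<close>. Since the exponent \<open>q - 1\<close> is nonpositive this bounds the term of \<open>i\<close>
  by \<open>(wt L i x)^q\<close>, which is integrable because \<open>L * q \<ge> \<omega> + 1\<close>, times a quantity evaluated
  at \<open>y\<close>; averaging over the cell and telescoping back gives \<open>(cell_sum)^q\<close>.\<close>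

lemma finite_smoothing_concave:
  assumes q: "0 < q" "q \<le> 1" and L: "L \<ge> (\<omega> + 1) / q"
  shows "\<exists>C\<ge>0. \<forall>J b. finite J \<longrightarrow> J \<subseteq> pts \<longrightarrow> (\<forall>i. b i \<ge> 0) \<longrightarrow>
    (\<integral>\<^sup>+x. ennreal (bump_sum J b L x powr q) \<partial>M) \<le> ennreal C * (\<integral>\<^sup>+x. ennreal (cell_sum J b x powr q) \<partial>M)"
proof -
  define D where "D = (A\<^sub>0 * (1 + 4 * A\<^sub>0\<^sup>2)) powr (2 * L)"
  define C1 where "C1 = D powr (1 - q) * (2 powr (\<omega> + 2) * K) * \<kappa>"
  have Lq: "L * q \<ge> \<omega> + 1" using L q by (simp add: field_simps)
  have L0: "L \<ge> 0" using L q \<omega>_pos by (smt (verit) divide_nonneg_pos)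
  have D: "D > 0" unfolding D_def using A\<^sub>0_sq by auto
  have C1: "C1 > 0" unfolding C1_def using D by simp
  have "(\<integral>\<^sup>+x. ennreal (bump_sum J b L x powr q) \<partial>M) \<le> ennreal (C1 / q) * (\<integral>\<^sup>+x. ennreal (cell_sum J b x powr q) \<partial>M)"
    if J: "finite J" "J \<subseteq> pts" and b: "\<And>i. b i \<ge> 0" for J b
  proof -
    let ?in = "\<lambda>i x. \<Sum>j | j \<in> J \<and> fst j \<le> fst i. b j * wt L j x"
    let ?F = "\<lambda>i y. \<Sum>j | j \<in> J \<and> fst j \<le> fst i. b j * indicator (cell j) y"
    have F0: "0 \<le> ?F i y" for i y using b by (intro sum_nonneg mult_nonneg_nonneg) auto
    have [measurable]: "?F i \<in> borel_measurable M" for i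
      using J by (intro borel_measurable_sum borel_measurable_times borel_measurable_indicator sets_cell) auto
    have "(\<integral>\<^sup>+x. ennreal (bump_sum J b L x powr q) \<partial>M)
        \<le> (\<integral>\<^sup>+x. (\<Sum>i\<in>J. ennreal (b i * wt L i x * ?in i x powr (q - 1))) \<partial>M)"
      using J q b unfolding bump_sum_def
      by (intro nn_integral_mono) (simp add: sum_ennreal ennreal_leI powr_sum_le_level_sum_concave)
    also have "\<dots> = (\<Sum>i\<in>J. \<integral>\<^sup>+x. ennreal (b i * wt L i x * ?in i x powr (q - 1)) \<partial>M)"
      by (rule nn_integral_sum) measurable
    also have "\<dots> \<le> (\<Sum>i\<in>J. \<integral>\<^sup>+y. ennreal (C1 * b i * ?F i y powr (q - 1)) * indicator (cell i) y \<partial>M)"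
    proof (rule sum_mono)
      fix i assume iJ: "i \<in> J"
      then have i: "i \<in> pts" using J by auto
      show "(\<integral>\<^sup>+x. ennreal (b i * wt L i x * ?in i x powr (q - 1)) \<partial>M)
        \<le> (\<integral>\<^sup>+y. ennreal (C1 * b i * ?F i y powr (q - 1)) * indicator (cell i) y \<partial>M)"
      proof (cases "b i = 0")
        case False
        then have bi: "b i > 0" using b[of i] by simp
        show ?thesis
        proof (rule le_nn_integral_of_le_on)
          show "cell i \<in> sets M" "emeasure M (cell i) = ennreal (measure M (cell i))" "0 < measure M (cell i)"
            using i by (auto intro: sets_cell emeasure_cell measure_cell_pos simp del: zero_less_measure_iff)
          fix y assume y: "y \<in> cell i"
          have "b i = b i * indicator (cell i) y" using y by simp
          also have "\<dots> \<le> ?F i y"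
            using J iJ b by (intro member_le_sum[of i "{j. j \<in> J \<and> fst j \<le> fst i}" "\<lambda>j. b j * indicator (cell j) y"]) auto
          finally have Fpos: "?F i y > 0" using bi by linarith
          \<comment> \<open>the exponent \<open>q - 1\<close> reverses the lower bound for the partial sum\<close>
          have pw: "wt L i x * ?in i x powr (q - 1) \<le> D powr (1 - q) * ?F i y powr (q - 1) * wt (L * q) i x" for x
          proof -
            have wp: "wt L i x > 0" by (rule bump_pos) simp
            have "?F i y * wt L i x = (\<Sum>j | j \<in> J \<and> fst j \<le> fst i. b j * (indicator (cell j) y * wt L i x))"
              by (simp add: sum_distrib_right mult.assoc)
            also have "\<dots> \<le> (\<Sum>j | j \<in> J \<and> fst j \<le> fst i. b j * (D * wt L j x))"
            proof (intro sum_mono mult_left_mono b)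
              fix j assume "j \<in> {j. j \<in> J \<and> fst j \<le> fst i}"
              then show "indicator (cell j) y * wt L i x \<le> D * wt L j x"
                using wt_le_coarser[OF i _ _ y _ L0, of j x] J D by (auto simp: D_def split: split_indicator)
            qed
            also have "\<dots> = D * ?in i x" by (simp add: sum_distrib_left mult_ac)
            finally have "?F i y * wt L i x / D \<le> ?in i x" using D by (simp add: field_simps)
            then have "?in i x powr (q - 1) \<le> (?F i y * wt L i x / D) powr (q - 1)"
              using q D Fpos wp by (intro powr_mono2') auto
            also have "\<dots> = D powr (1 - q) * ?F i y powr (q - 1) * wt L i x powr (q - 1)"
              using D Fpos wp by (simp add: powr_mult powr_divide powr_diff field_simps)
            finally have "wt L i x * ?in i x powr (q - 1) \<le> wt L i x * (D powr (1 - q) * ?F i y powr (q - 1) * wt L i x powr (q - 1))"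
              using wp by (intro mult_left_mono) auto
            also have "\<dots> = D powr (1 - q) * ?F i y powr (q - 1) * (wt L i x * wt L i x powr (q - 1))"
              by (simp only: mult_ac)
            also have "wt L i x * wt L i x powr (q - 1) = wt (L * q) i x"
              by (simp add: bump_powr bump_mult algebra_simps)
            finally show ?thesis .
          qed
          have "(\<integral>\<^sup>+x. ennreal (b i * wt L i x * ?in i x powr (q - 1)) \<partial>M)
             \<le> (\<integral>\<^sup>+x. ennreal (b i * (D powr (1 - q) * ?F i y powr (q - 1))) * ennreal (wt (L * q) i x) \<partial>M)"
          proof (intro nn_integral_mono)
            fix x
            have "b i * wt L i x * ?in i x powr (q - 1) \<le> b i * (D powr (1 - q) * ?F i y powr (q - 1)) * wt (L * q) i x"
              using mult_left_mono[OF pw[of x] b[of i]] by (simp only: mult_ac)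
            then show "ennreal (b i * wt L i x * ?in i x powr (q - 1)) \<le> ennreal (b i * (D powr (1 - q) * ?F i y powr (q - 1))) * ennreal (wt (L * q) i x)"
              using b[of i] by (subst ennreal_mult[symmetric]) (auto intro!: ennreal_leI)
          qed
          also have "\<dots> = ennreal (b i * (D powr (1 - q) * ?F i y powr (q - 1))) * (\<integral>\<^sup>+x. ennreal (wt (L * q) i x) \<partial>M)"
            by (rule nn_integral_cmult) measurable
          also have "\<dots> \<le> ennreal (b i * (D powr (1 - q) * ?F i y powr (q - 1))) * ennreal (2 powr (\<omega> + 2) * K * V (scale (fst i)) (snd i))"
            using nn_integral_bump[OF scale_pos Lq, of "fst i" "snd i"]
            by (intro mult_left_mono) (auto simp: bump_commute[of _ _ "snd i"])
          also have "\<dots> \<le> ennreal (measure M (cell i)) * ennreal (C1 * b i * ?F i y powr (q - 1))"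
          proof -
            have "b i * (D powr (1 - q) * ?F i y powr (q - 1)) * (2 powr (\<omega> + 2) * K * V (scale (fst i)) (snd i))
              \<le> b i * (D powr (1 - q) * ?F i y powr (q - 1)) * (2 powr (\<omega> + 2) * K * (\<kappa> * measure M (cell i)))"
              using b[of i] V_le_cell[OF i] by (intro mult_left_mono) auto
            also have "\<dots> = measure M (cell i) * (C1 * b i * ?F i y powr (q - 1))"
              by (simp only: C1_def mult_ac)
            finally show ?thesis
              using b[of i] C1 by (subst (1 2) ennreal_mult[symmetric]) (auto intro!: ennreal_leI)
          qed
          finally show "(\<integral>\<^sup>+x. ennreal (b i * wt L i x * ?in i x powr (q - 1)) \<partial>M)
             \<le> ennreal (measure M (cell i)) * ennreal (C1 * b i * ?F i y powr (q - 1))" .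
        qed
      qed simp
    qed
    also have "\<dots> = (\<integral>\<^sup>+y. (\<Sum>i\<in>J. ennreal (C1 * b i * ?F i y powr (q - 1)) * indicator (cell i) y) \<partial>M)"
    proof (rule nn_integral_sum[symmetric])
      fix i assume "i \<in> J"
      then have [measurable]: "cell i \<in> sets M" using J sets_cell by auto
      show "(\<lambda>y. ennreal (C1 * b i * ?F i y powr (q - 1)) * indicator (cell i) y) \<in> borel_measurable M"
        by measurable
    qed
    also have "\<dots> \<le> (\<integral>\<^sup>+y. ennreal (C1 / q) * ennreal (cell_sum J b y powr q) \<partial>M)"
    proof (intro nn_integral_mono)
      fix y
      have "(\<Sum>i\<in>J. ennreal (C1 * b i * ?F i y powr (q - 1)) * indicator (cell i) y)
         = (\<Sum>i\<in>J. ennreal (C1 * (b i * indicator (cell i) y * ?F i y powr (q - 1))))"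
        by (intro sum.cong refl) (auto split: split_indicator simp: mult_ac)
      also have "\<dots> = ennreal (C1 * (\<Sum>i\<in>J. b i * indicator (cell i) y * ?F i y powr (q - 1)))"
        using b C1 by (subst sum_ennreal) (auto simp: sum_distrib_left)
      also have "\<dots> \<le> ennreal (C1 * (cell_sum J b y powr q / q))"
        using level_sum_le_powr_sum[OF J(1) _ q, of "\<lambda>i. b i * indicator (cell i) y" fst] b C1 q
        by (intro ennreal_leI mult_left_mono) (auto simp: cell_sum_def field_simps)
      finally show "(\<Sum>i\<in>J. ennreal (C1 * b i * ?F i y powr (q - 1)) * indicator (cell i) y)
         \<le> ennreal (C1 / q) * ennreal (cell_sum J b y powr q)"
        using C1 q by (subst ennreal_mult[symmetric]) auto
    qed
    also have "\<dots> = ennreal (C1 / q) * (\<integral>\<^sup>+y. ennreal (cell_sum J b y powr q) \<partial>M)"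
      using borel_measurable_cell_sum[OF J(2), of b] by (intro nn_integral_cmult) auto
    finally show ?thesis .
  qed
  moreover have "C1 / q \<ge> 0" using C1 q by simp
  ultimately show ?thesis by blast
qed

definition dilated_sum :: "nat \<Rightarrow> (int \<times> 'a) set \<Rightarrow> (int \<times> 'a \<Rightarrow> real) \<Rightarrow> 'a \<Rightarrow> real" where
  "dilated_sum m J b x = (\<Sum>i\<in>J. b i * indicator (qball d (snd i) (2 ^ m * scale (fst i))) x)"

lemma borel_measurable_dilated_sum [measurable]: "dilated_sum m J b \<in> borel_measurable M"
  unfolding dilated_sum_def
  by (intro borel_measurable_sum borel_measurable_times borel_measurable_indicator qball_measurable) auto

lemma dilated_sum_nonneg: "(\<And>i. b i \<ge> 0) \<Longrightarrow> 0 \<le> dilated_sum m J b x"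
  unfolding dilated_sum_def by (intro sum_nonneg mult_nonneg_nonneg) auto

text \<open>The weights are dominated by \<open>\<Sum>m. 2^(- m * L)\<close> times indicators of balls of radius \<open>2^m\<close> times the
  scale. Writing \<open>2^(- m * L) = 2^(- m) * 2^(- m * (L - 1))\<close>, the convergent factor \<open>2^(- m)\<close> allows the
  sum over \<open>m\<close> to be replaced by a single term.\<close>

lemma bump_sum_le_dilated_sum:
  assumes J: "finite J" and b: "\<And>i. b i \<ge> 0" and L: "L \<ge> 0"
  shows "\<exists>m. bump_sum J b L x \<le> 4 * (2 powr L * (1/2) powr (real m * (L - 1)) * dilated_sum m J b x)"
proof (rule ccontr)
  assume contra: "\<not> ?thesis"
  define y where "y m = 2 powr L * (1/2) powr (real m * (L - 1)) * dilated_sum m J b x" for m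
  have S0: "0 \<le> bump_sum J b L x" using b by (rule bump_sum_nonneg)
  have y: "4 * y m < bump_sum J b L x" for m using contra by (auto simp: y_def not_le mult_ac)
  have "\<exists>n. d x (snd i) < 2 ^ n * scale (fst i) \<and> wt L i x \<le> 2 powr L * (1/2) powr (real n * L)" for i
    using bump_shell[OF scale_pos L, of x "snd i" "fst i"] by blast
  then obtain n where n: "\<And>i. d x (snd i) < 2 ^ n i * scale (fst i)" "\<And>i. wt L i x \<le> 2 powr L * (1/2) powr (real (n i) * L)"
    by metis
  define N where "N = Max (insert 0 (n ` J))"
  have N: "n i \<le> N" if "i \<in> J" for i using that J by (auto simp: N_def)
  have le: "wt L i x \<le> (\<Sum>m\<le>N. 2 powr L * (1/2) powr (real m * L) * indicator (qball d (snd i) (2 ^ m * scale (fst i))) x)"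
    if i: "i \<in> J" for i
  proof -
    have "wt L i x \<le> 2 powr L * (1/2) powr (real (n i) * L) * indicator (qball d (snd i) (2 ^ n i * scale (fst i))) x"
      using n[of i] by (simp add: qball_def dist_commute)
    also have "\<dots> \<le> (\<Sum>m\<le>N. 2 powr L * (1/2) powr (real m * L) * indicator (qball d (snd i) (2 ^ m * scale (fst i))) x)"
      using N[OF i] by (intro member_le_sum[of "n i" "{..N}" "\<lambda>m. 2 powr L * (1/2) powr (real m * L) * indicator (qball d (snd i) (2 ^ m * scale (fst i))) x"]) auto
    finally show ?thesis .
  qed
  have "bump_sum J b L x \<le> (\<Sum>i\<in>J. b i * (\<Sum>m\<le>N. 2 powr L * (1/2) powr (real m * L) * indicator (qball d (snd i) (2 ^ m * scale (fst i))) x))"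
    unfolding bump_sum_def using le b by (intro sum_mono mult_left_mono) auto
  also have "\<dots> = (\<Sum>m\<le>N. 2 powr L * (1/2) powr (real m * L) * dilated_sum m J b x)"
    unfolding dilated_sum_def sum_distrib_left by (subst sum.swap) (simp add: mult_ac)
  also have "\<dots> = (\<Sum>m\<le>N. (1/2) ^ m * y m)"
  proof (intro sum.cong refl)
    fix m
    have "(1/2 :: real) powr (real m * L) = (1/2) ^ m * (1/2) powr (real m * (L - 1))"
      by (simp add: powr_realpow[symmetric] powr_add[symmetric] algebra_simps)
    then show "2 powr L * (1/2) powr (real m * L) * dilated_sum m J b x = (1/2) ^ m * y m"
      by (simp add: y_def mult_ac)
  qed
  also have "\<dots> \<le> (\<Sum>m\<le>N. (1/2) ^ m * (bump_sum J b L x / 4))"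
    using y by (intro sum_mono mult_left_mono) (auto simp: less_imp_le field_simps)
  also have "\<dots> = (\<Sum>m\<le>N. (1/2) ^ m) * (bump_sum J b L x / 4)" by (simp add: sum_distrib_right)
  also have "(\<Sum>m\<le>N. (1/2 :: real) ^ m) = 2 - (1/2) ^ N"
    by (induction N) auto
  also have "(2 - (1/2) ^ N) * (bump_sum J b L x / 4) \<le> 2 * (bump_sum J b L x / 4)"
    using S0 by (intro mult_right_mono) auto
  finally show False
    using y[of 0] mult_nonneg_nonneg[OF powr_ge_zero[of 2 L] dilated_sum_nonneg[of b 0 J x]] b S0
    by (auto simp: y_def)
qed

text \<open>If \<open>x\<close> lies in the dilated balls of both \<open>i\<close> and the coarser \<open>j\<close>, then any point \<open>y\<close> of cell \<open>i\<close> is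
  within a multiple of \<open>2^m\<close> of the center of \<open>j\<close>, in units of the scale of \<open>j\<close>; there the weight of
  \<open>j\<close> is at least of order \<open>2^(- m * L)\<close>.\<close>

lemma dilated_sum_le_bump_sum:
  assumes J: "J \<subseteq> pts" "finite J" and b: "\<And>i. b i \<ge> 0" and L: "L \<ge> 0"
    and i: "i \<in> pts" and x: "x \<in> qball d (snd i) (2 ^ m * scale (fst i))" and y: "y \<in> cell i"
  shows "(\<Sum>j | j \<in> J \<and> fst j \<le> fst i. b j * indicator (qball d (snd j) (2 ^ m * scale (fst j))) x)
    \<le> (1 + A\<^sub>0\<^sup>2 * (4 * A\<^sub>0\<^sup>2 + 1) + A\<^sub>0) powr L * 2 powr (real m * L) * bump_sum J b L y"
proof -
  let ?E = "1 + A\<^sub>0\<^sup>2 * (4 * A\<^sub>0\<^sup>2 + 1) + A\<^sub>0"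
  have E: "?E > 0" by (intro add_pos_pos add_pos_nonneg) auto
  have one: "indicator (qball d (snd j) (2 ^ m * scale (fst j))) x \<le> ?E powr L * 2 powr (real m * L) * wt L j y"
    if j: "fst j \<le> fst i" for j
  proof (cases "x \<in> qball d (snd j) (2 ^ m * scale (fst j))")
    case True
    let ?r = "scale (fst j)"
    have ge1: "(1::real) \<le> 2 ^ m" by simp
    have rr: "scale (fst i) \<le> ?r" using j by (rule scale_antimono)
    have "d y x \<le> A\<^sub>0 * (d y (snd i) + d (snd i) x)" by (rule quasi_triangle)
    also have "\<dots> \<le> A\<^sub>0 * (4 * A\<^sub>0\<^sup>2 * scale (fst i) + 2 ^ m * scale (fst i))"
      using cube_near[of "snd i" "fst i" y] i x y
      by (intro mult_left_mono add_mono) (auto simp: pts_iff qball_def dist_commute)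
    also have "\<dots> = A\<^sub>0 * (4 * A\<^sub>0\<^sup>2 * 1 + 2 ^ m) * scale (fst i)" by (simp add: algebra_simps)
    also have "\<dots> \<le> A\<^sub>0 * (4 * A\<^sub>0\<^sup>2 * 2 ^ m + 2 ^ m) * ?r"
      using rr ge1 by (intro mult_mono add_mono mult_nonneg_nonneg add_nonneg_nonneg) auto
    finally have dyx: "d y x \<le> A\<^sub>0 * (4 * A\<^sub>0\<^sup>2 * 2 ^ m + 2 ^ m) * ?r" .
    have "d y (snd j) \<le> A\<^sub>0 * (d y x + d x (snd j))" by (rule quasi_triangle)
    also have "\<dots> \<le> A\<^sub>0 * (A\<^sub>0 * (4 * A\<^sub>0\<^sup>2 * 2 ^ m + 2 ^ m) * ?r + 2 ^ m * ?r)"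
      using dyx True by (intro mult_left_mono add_mono) (auto simp: qball_def dist_commute)
    also have "\<dots> = (A\<^sub>0\<^sup>2 * (4 * A\<^sub>0\<^sup>2 + 1) + A\<^sub>0) * 2 ^ m * ?r" by (simp add: algebra_simps power2_eq_square)
    finally have "(1 + (A\<^sub>0\<^sup>2 * (4 * A\<^sub>0\<^sup>2 + 1) + A\<^sub>0) * 2 ^ m) powr (- L) \<le> wt L j y"
      using L by (intro bump_ge_of_near) auto
    moreover have "(?E * 2 ^ m) powr (- L) \<le> (1 + (A\<^sub>0\<^sup>2 * (4 * A\<^sub>0\<^sup>2 + 1) + A\<^sub>0) * 2 ^ m) powr (- L)"
      using L ge1 by (intro powr_mono2') (auto intro!: add_pos_nonneg mult_nonneg_nonneg simp: algebra_simps)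
    ultimately have "(?E * 2 ^ m) powr (- L) \<le> wt L j y" by linarith
    moreover have "1 \<le> T powr L * v" if "T > 0" "T powr (- L) \<le> v" for T v :: real
      using that by (simp add: powr_minus field_simps)
    ultimately have "1 \<le> (?E * 2 ^ m) powr L * wt L j y"
      using E by simp
    moreover have "(2 ^ m :: real) powr L = 2 powr (real m * L)"
      by (simp add: powr_realpow[symmetric] powr_powr)
    ultimately show ?thesis using True by (simp only: powr_mult indicator_simps)
  qed simp
  have "(\<Sum>j | j \<in> J \<and> fst j \<le> fst i. b j * indicator (qball d (snd j) (2 ^ m * scale (fst j))) x)
    \<le> (\<Sum>j | j \<in> J \<and> fst j \<le> fst i. b j * (?E powr L * 2 powr (real m * L) * wt L j y))"
    using one b by (intro sum_mono mult_left_mono) auto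
  also have "\<dots> \<le> (\<Sum>j\<in>J. b j * (?E powr L * 2 powr (real m * L) * wt L j y))"
    using J b by (intro sum_mono2) auto
  also have "\<dots> = ?E powr L * 2 powr (real m * L) * bump_sum J b L y"
    unfolding bump_sum_def sum_distrib_left by (intro sum.cong refl) (simp only: mult_ac)
  finally show ?thesis .
qed

text \<open>Finiteness is what makes the absorption below legitimate; it holds because the sum is finite and
  the bumps are bounded and integrable.\<close>

lemma bump_sum_powr_finite:
  assumes J: "finite J" and b: "\<And>i. b i \<ge> 0" and q: "q \<ge> 1" and L: "L \<ge> \<omega> + 1"
  shows "(\<integral>\<^sup>+x. ennreal (bump_sum J b L x powr q) \<partial>M) < \<infinity>"
proof -
  let ?B = "(\<Sum>i\<in>J. b i) powr (q - 1)"
  have "(\<integral>\<^sup>+x. ennreal (bump_sum J b L x powr q) \<partial>M) \<le> (\<integral>\<^sup>+x. (\<Sum>i\<in>J. ennreal (?B * b i) * ennreal (wt L i x)) \<partial>M)"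
  proof (intro nn_integral_mono)
    fix x
    have S0: "0 \<le> bump_sum J b L x" using b by (rule bump_sum_nonneg)
    have "bump_sum J b L x \<le> (\<Sum>i\<in>J. b i * 1)"
      unfolding bump_sum_def using L \<omega>_pos by (intro sum_mono mult_left_mono bump_le_1 b) auto
    then have "bump_sum J b L x powr (q - 1) \<le> ?B"
      using S0 q by (intro powr_mono2) auto
    then have "bump_sum J b L x * bump_sum J b L x powr (q - 1) \<le> bump_sum J b L x * ?B"
      using S0 by (intro mult_left_mono) auto
    also have "bump_sum J b L x * bump_sum J b L x powr (q - 1) = bump_sum J b L x powr q"
      using S0 q by (cases "bump_sum J b L x = 0") (auto simp: powr_mult_base)
    also have "bump_sum J b L x * ?B = (\<Sum>i\<in>J. ?B * b i * wt L i x)"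
      by (simp add: bump_sum_def sum_distrib_left mult_ac)
    finally have "ennreal (bump_sum J b L x powr q) \<le> ennreal (\<Sum>i\<in>J. ?B * b i * wt L i x)" by (rule ennreal_leI)
    also have "\<dots> = (\<Sum>i\<in>J. ennreal (?B * b i) * ennreal (wt L i x))"
      using b by (subst sum_ennreal[symmetric]) (auto simp: ennreal_mult intro!: sum.cong)
    finally show "ennreal (bump_sum J b L x powr q) \<le> (\<Sum>i\<in>J. ennreal (?B * b i) * ennreal (wt L i x))" .
  qed
  also have "\<dots> = (\<Sum>i\<in>J. ennreal (?B * b i) * (\<integral>\<^sup>+x. ennreal (wt L i x) \<partial>M))"
    by (subst nn_integral_sum) (auto simp: nn_integral_cmult)
  also have "\<dots> \<le> (\<Sum>i\<in>J. ennreal (?B * b i) * ennreal (2 powr (\<omega> + 2) * K * V (scale (fst i)) (snd i)))"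
    using nn_integral_bump[OF scale_pos L]
    by (intro sum_mono mult_left_mono) (auto simp: bump_commute[of _ _ "snd _"] bump_commute)
  also have "\<dots> < \<infinity>"
    using J by (simp add: ennreal_mult_less_top)
  finally show ?thesis .
qed

text \<open>The counterpart of \<open>finite_smoothing_concave\<close> for \<open>q \<ge> 1\<close>: after splitting by generation, the partial
  sums on the dilated ball of \<open>i\<close> are bounded by \<open>bump_sum\<close> at any point of cell \<open>i\<close>, and the
  volume of the ball by that of the cell.\<close>

lemma nn_integral_dilated_sum:
  assumes q: "1 \<le> q" and L: "L \<ge> 0"
  shows "\<exists>C\<ge>0. \<forall>m J b. finite J \<longrightarrow> J \<subseteq> pts \<longrightarrow> (\<forall>i. b i \<ge> 0) \<longrightarrow>
    (\<integral>\<^sup>+x. ennreal (dilated_sum m J b x powr q) \<partial>M)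
      \<le> ennreal (C * 2 powr (real m * (\<omega> + L * (q - 1)))) *
        (\<integral>\<^sup>+y. ennreal (cell_sum J b y * bump_sum J b L y powr (q - 1)) \<partial>M)"
proof -
  define E where "E = (1 + A\<^sub>0\<^sup>2 * (4 * A\<^sub>0\<^sup>2 + 1) + A\<^sub>0) powr L"
  define C where "C = q * (K * \<kappa>) * E powr (q - 1)"
  have C0: "C \<ge> 0" unfolding C_def using q by simp
  have "(\<integral>\<^sup>+x. ennreal (dilated_sum m J b x powr q) \<partial>M)
      \<le> ennreal (C * 2 powr (real m * (\<omega> + L * (q - 1)))) *
        (\<integral>\<^sup>+y. ennreal (cell_sum J b y * bump_sum J b L y powr (q - 1)) \<partial>M)"
    if J: "finite J" "J \<subseteq> pts" and b: "\<And>i. b i \<ge> 0" for m J b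
  proof -
    let ?B = "\<lambda>i. qball d (snd i) (2 ^ m * scale (fst i))"
    let ?in = "\<lambda>i x. \<Sum>j | j \<in> J \<and> fst j \<le> fst i. b j * indicator (?B j) x"
    let ?c = "C * 2 powr (real m * (\<omega> + L * (q - 1)))"
    let ?H = "\<lambda>y. bump_sum J b L y powr (q - 1)"
    have [measurable]: "?B i \<in> sets M" for i by (rule qball_measurable)
    have [measurable]: "?in i \<in> borel_measurable M" for i by measurable
    have "(\<integral>\<^sup>+x. ennreal (dilated_sum m J b x powr q) \<partial>M)
        \<le> (\<integral>\<^sup>+x. (\<Sum>i\<in>J. ennreal (q * b i * indicator (?B i) x * ?in i x powr (q - 1))) \<partial>M)"
    proof (intro nn_integral_mono)
      fix x
      have "dilated_sum m J b x powr q \<le> q * (\<Sum>i\<in>J. b i * indicator (?B i) x * ?in i x powr (q - 1))"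
        unfolding dilated_sum_def using J b q by (intro powr_sum_le_level_sum) auto
      also have "\<dots> = (\<Sum>i\<in>J. q * b i * indicator (?B i) x * ?in i x powr (q - 1))"
        by (simp add: sum_distrib_left mult_ac)
      finally show "ennreal (dilated_sum m J b x powr q) \<le> (\<Sum>i\<in>J. ennreal (q * b i * indicator (?B i) x * ?in i x powr (q - 1)))"
        using b q by (subst sum_ennreal) (auto intro!: ennreal_leI)
    qed
    also have "\<dots> = (\<Sum>i\<in>J. \<integral>\<^sup>+x. ennreal (q * b i * indicator (?B i) x * ?in i x powr (q - 1)) \<partial>M)"
      by (rule nn_integral_sum) measurable
    also have "\<dots> \<le> (\<Sum>i\<in>J. \<integral>\<^sup>+y. ennreal (?c * b i * ?H y) * indicator (cell i) y \<partial>M)"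
    proof (rule sum_mono)
      fix i assume iJ: "i \<in> J"
      then have i: "i \<in> pts" using J by auto
      show "(\<integral>\<^sup>+x. ennreal (q * b i * indicator (?B i) x * ?in i x powr (q - 1)) \<partial>M)
        \<le> (\<integral>\<^sup>+y. ennreal (?c * b i * ?H y) * indicator (cell i) y \<partial>M)"
      proof (rule le_nn_integral_of_le_on)
        show "cell i \<in> sets M" "emeasure M (cell i) = ennreal (measure M (cell i))" "0 < measure M (cell i)"
          using i by (auto intro: sets_cell emeasure_cell measure_cell_pos simp del: zero_less_measure_iff)
        fix y assume y: "y \<in> cell i"
        let ?a = "q * b i * (E powr (q - 1) * 2 powr (real m * L * (q - 1)) * ?H y)"
        have a0: "?a \<ge> 0" using b[of i] q by simp
        have "(\<integral>\<^sup>+x. ennreal (q * b i * indicator (?B i) x * ?in i x powr (q - 1)) \<partial>M)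
           \<le> (\<integral>\<^sup>+x. ennreal ?a * indicator (?B i) x \<partial>M)"
        proof (intro nn_integral_mono)
          fix x
          have "?in i x powr (q - 1) \<le> (E * 2 powr (real m * L) * bump_sum J b L y) powr (q - 1)" if "x \<in> ?B i"
            using dilated_sum_le_bump_sum[OF J(2,1) b L i that y] q b
            by (intro powr_mono2) (auto simp: E_def intro!: sum_nonneg)
          also have "(E * 2 powr (real m * L) * bump_sum J b L y) powr (q - 1) = E powr (q - 1) * 2 powr (real m * L * (q - 1)) * ?H y"
            by (simp add: powr_mult powr_powr)
          finally have "q * b i * ?in i x powr (q - 1) \<le> ?a" if "x \<in> ?B i"
            using that q b[of i] by (intro mult_left_mono) auto
          then show "ennreal (q * b i * indicator (?B i) x * ?in i x powr (q - 1)) \<le> ennreal ?a * indicator (?B i) x"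
            by (auto split: split_indicator intro!: ennreal_leI)
        qed
        also have "\<dots> = ennreal ?a * emeasure M (?B i)" by (rule nn_integral_cmult_indicator) measurable
        also have "emeasure M (?B i) = ennreal (V (2 ^ m * scale (fst i)) (snd i))"
          by (rule emeasure_qball) simp
        also have "\<dots> \<le> ennreal (K * 2 powr (real m * \<omega>) * (\<kappa> * measure M (cell i)))"
        proof (rule ennreal_leI)
          have "V (2 ^ m * scale (fst i)) (snd i) \<le> K * (2 ^ m) powr \<omega> * V (scale (fst i)) (snd i)"
            by (rule growth) auto
          also have "\<dots> \<le> K * (2 ^ m) powr \<omega> * (\<kappa> * measure M (cell i))"
            using V_le_cell[OF i] by (intro mult_left_mono) auto
          finally show "V (2 ^ m * scale (fst i)) (snd i) \<le> K * 2 powr (real m * \<omega>) * (\<kappa> * measure M (cell i))"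
            by (simp add: powr_realpow[symmetric] powr_powr)
        qed
        also have "ennreal ?a * ennreal (K * 2 powr (real m * \<omega>) * (\<kappa> * measure M (cell i)))
            = ennreal (?a * (K * 2 powr (real m * \<omega>) * (\<kappa> * measure M (cell i))))"
          using a0 by (subst ennreal_mult) auto
        also have "?a * (K * 2 powr (real m * \<omega>) * (\<kappa> * measure M (cell i))) = measure M (cell i) * (?c * b i * ?H y)"
          by (simp add: C_def distrib_left powr_add mult_ac)
        also have "ennreal \<dots> = ennreal (measure M (cell i)) * ennreal (?c * b i * ?H y)"
          using b[of i] C0 by (intro ennreal_mult) auto
        finally show "(\<integral>\<^sup>+x. ennreal (q * b i * indicator (?B i) x * ?in i x powr (q - 1)) \<partial>M)
           \<le> ennreal (measure M (cell i)) * ennreal (?c * b i * ?H y)" by (simp add: mult_left_mono)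
      qed
    qed
    also have "\<dots> = (\<integral>\<^sup>+y. (\<Sum>i\<in>J. ennreal (?c * b i * ?H y) * indicator (cell i) y) \<partial>M)"
    proof (rule nn_integral_sum[symmetric])
      fix i assume "i \<in> J"
      then have [measurable]: "cell i \<in> sets M" using J sets_cell by auto
      show "(\<lambda>y. ennreal (?c * b i * ?H y) * indicator (cell i) y) \<in> borel_measurable M"
        by measurable
    qed
    also have "\<dots> = (\<integral>\<^sup>+y. ennreal ?c * ennreal (cell_sum J b y * ?H y) \<partial>M)"
    proof (intro nn_integral_cong)
      fix y
      have "(\<Sum>i\<in>J. ennreal (?c * b i * ?H y) * indicator (cell i) y) = (\<Sum>i\<in>J. ennreal (?c * (b i * indicator (cell i) y * ?H y)))"
        by (intro sum.cong refl) (auto split: split_indicator simp: mult_ac)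
      also have "\<dots> = ennreal (?c * (cell_sum J b y * ?H y))"
        using b C0 by (subst sum_ennreal) (auto simp: sum_distrib_left sum_distrib_right cell_sum_def)
      also have "\<dots> = ennreal ?c * ennreal (cell_sum J b y * ?H y)"
        using b C0 by (intro ennreal_mult) (auto intro!: mult_nonneg_nonneg cell_sum_nonneg)
      finally show "(\<Sum>i\<in>J. ennreal (?c * b i * ?H y) * indicator (cell i) y) = ennreal ?c * ennreal (cell_sum J b y * ?H y)" .
    qed
    also have "\<dots> = ennreal ?c * (\<integral>\<^sup>+y. ennreal (cell_sum J b y * ?H y) \<partial>M)"
      using borel_measurable_cell_sum[OF J(2), of b] by (intro nn_integral_cmult) auto
    finally show ?thesis .
  qed
  then show ?thesis using C0 by blast
qed

text \<open>Summing the bounds for the dilated sums over \<open>m\<close> gives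
  \<open>\<integral> W^q \<le> C * \<integral> F * W^(q - 1)\<close> for \<open>W = bump_sum\<close> and \<open>F = cell_sum\<close>: the loss
  \<open>2^(m * (\<omega> + L * (q - 1)))\<close> is beaten by the gain \<open>2^(- m * (L - 1) * q)\<close> as soon as
  \<open>L > q + \<omega>\<close>. Young's inequality and absorption finish the proof.\<close>

lemma finite_smoothing_convex:
  assumes q: "1 \<le> q" and L: "L \<ge> q + \<omega> + 1"
  shows "\<exists>C\<ge>0. \<forall>J b. finite J \<longrightarrow> J \<subseteq> pts \<longrightarrow> (\<forall>i. b i \<ge> 0) \<longrightarrow>
    (\<integral>\<^sup>+x. ennreal (bump_sum J b L x powr q) \<partial>M) \<le> ennreal C * (\<integral>\<^sup>+x. ennreal (cell_sum J b x powr q) \<partial>M)"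
proof -
  have L1: "L \<ge> 0" "L \<ge> \<omega> + 1" using q L \<omega>_pos by auto
  obtain C where C: "C \<ge> 0" "\<And>m J b. finite J \<Longrightarrow> J \<subseteq> pts \<Longrightarrow> (\<And>i. b i \<ge> 0) \<Longrightarrow>
    (\<integral>\<^sup>+x. ennreal (dilated_sum m J b x powr q) \<partial>M)
      \<le> ennreal (C * 2 powr (real m * (\<omega> + L * (q - 1)))) *
        (\<integral>\<^sup>+y. ennreal (cell_sum J b y * bump_sum J b L y powr (q - 1)) \<partial>M)"
    using nn_integral_dilated_sum[OF q L1(1)] by meson
  define c where "c = (4 * 2 powr L) powr q"
  \<comment> \<open>the summand \<open>1\<close> only keeps \<open>C2\<close> away from \<open>0\<close>, so that \<open>\<epsilon>\<close> is well defined\<close>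
  define C2 where "C2 = c * C * 2 + 1"
  define \<epsilon> where "\<epsilon> = 1 / (2 * C2)"
  have c: "c > 0" unfolding c_def by simp
  have C2: "C2 \<ge> 1" using c C(1) unfolding C2_def by simp
  have \<epsilon>: "\<epsilon> > 0" using C2 unfolding \<epsilon>_def by simp
  have "(\<integral>\<^sup>+x. ennreal (bump_sum J b L x powr q) \<partial>M) \<le> ennreal (2 * (C2 * \<epsilon> powr (1 - q))) * (\<integral>\<^sup>+x. ennreal (cell_sum J b x powr q) \<partial>M)"
    if J: "finite J" "J \<subseteq> pts" and b: "\<And>i. b i \<ge> 0" for J b
  proof -
    let ?W = "bump_sum J b L" and ?F = "cell_sum J b"
    let ?I = "\<integral>\<^sup>+x. ennreal (?W x powr q) \<partial>M"
    let ?X = "\<integral>\<^sup>+y. ennreal (?F y * ?W y powr (q - 1)) \<partial>M"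
    have [measurable]: "?F \<in> borel_measurable M" by (rule borel_measurable_cell_sum[OF J(2)])
    have W0: "0 \<le> ?W x" and F0: "0 \<le> ?F x" for x
      using b by (auto intro: bump_sum_nonneg cell_sum_nonneg)
    define g where "g m x = c * (1/2) powr (real m * (L - 1) * q) * dilated_sum m J b x powr q" for m x
    have le: "ennreal (?W x powr q) \<le> (\<Sum>m. ennreal (g m x))" for x
    proof -
      obtain m where "?W x \<le> 4 * (2 powr L * (1/2) powr (real m * (L - 1)) * dilated_sum m J b x)"
        using bump_sum_le_dilated_sum[OF J(1) _ L1(1), of b x] b by blast
      then have "?W x powr q \<le> (4 * (2 powr L * (1/2) powr (real m * (L - 1)) * dilated_sum m J b x)) powr q"
        using W0 q by (intro powr_mono2) auto
      also have "\<dots> = g m x"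
        by (simp only: g_def c_def powr_mult powr_powr mult_ac)
      finally have "ennreal (?W x powr q) \<le> ennreal (g m x)" by (rule ennreal_leI)
      also have "\<dots> \<le> (\<Sum>m. ennreal (g m x))"
        by (rule sum_le_suminf[of _ "{m}", simplified]) auto
      finally show ?thesis .
    qed
    have "?I \<le> (\<integral>\<^sup>+x. (\<Sum>m. ennreal (g m x)) \<partial>M)" by (intro nn_integral_mono le)
    also have "\<dots> = (\<Sum>m. \<integral>\<^sup>+x. ennreal (g m x) \<partial>M)"
      unfolding g_def by (rule nn_integral_suminf) measurable
    also have "\<dots> \<le> (\<Sum>m. ennreal (c * C * (1/2) ^ m) * ?X)"
    proof (intro suminf_le)
      fix m
      let ?e = "c * (1/2) powr (real m * (L - 1) * q)"
      have "(\<integral>\<^sup>+x. ennreal (g m x) \<partial>M) = ennreal ?e * (\<integral>\<^sup>+x. ennreal (dilated_sum m J b x powr q) \<partial>M)"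
        using c unfolding g_def by (subst nn_integral_cmult[symmetric]) (auto simp: ennreal_mult)
      also have "\<dots> \<le> ennreal ?e * (ennreal (C * 2 powr (real m * (\<omega> + L * (q - 1)))) * ?X)"
        by (intro mult_left_mono C(2) J b) auto
      also have "\<dots> = ennreal (?e * (C * 2 powr (real m * (\<omega> + L * (q - 1))))) * ?X"
        using c C(1) by (subst (3) ennreal_mult) (auto simp: mult.assoc)
      also have "\<dots> \<le> ennreal (c * C * (1/2) ^ m) * ?X"
      proof (intro mult_right_mono ennreal_leI)
        have "?e * (C * 2 powr (real m * (\<omega> + L * (q - 1)))) = c * C * 2 powr (real m * (\<omega> + L * (q - 1)) - real m * (L - 1) * q)"
          by (simp add: powr_divide powr_diff)
        also have "\<dots> \<le> c * C * 2 powr (- real m)"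
        proof (intro mult_left_mono powr_mono)
          have "real m * (q + \<omega> + 1 - L) \<le> 0" using L by (intro mult_nonneg_nonpos) auto
          then show "real m * (\<omega> + L * (q - 1)) - real m * (L - 1) * q \<le> - real m" by (simp add: algebra_simps)
        qed (use c C(1) in auto)
        also have "\<dots> = c * C * (1/2) ^ m"
          by (simp add: powr_minus powr_realpow power_one_over inverse_eq_divide)
        finally show "?e * (C * 2 powr (real m * (\<omega> + L * (q - 1)))) \<le> c * C * (1/2) ^ m" .
      qed auto
      finally show "(\<integral>\<^sup>+x. ennreal (g m x) \<partial>M) \<le> ennreal (c * C * (1/2) ^ m) * ?X" .
    qed auto
    also have "\<dots> = ennreal (\<Sum>m. c * C * (1/2) ^ m) * ?X"
      using c C(1) by (subst ennreal_suminf_multc, subst suminf_ennreal2) auto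
    also have "(\<Sum>m. c * C * (1/2) ^ m) = c * C * 2"
      by (subst suminf_mult) (auto simp: suminf_geometric)
    also have "ennreal (c * C * 2) * ?X \<le> ennreal C2 * ?X"
      by (intro mult_right_mono ennreal_leI) (auto simp: C2_def)
    also have "?X \<le> (\<integral>\<^sup>+y. ennreal \<epsilon> * ennreal (?W y powr q) + ennreal (\<epsilon> powr (1 - q)) * ennreal (?F y powr q) \<partial>M)"
    proof (intro nn_integral_mono)
      fix y
      have "ennreal (?F y * ?W y powr (q - 1)) \<le> ennreal (\<epsilon> * ?W y powr q + \<epsilon> powr (1 - q) * ?F y powr q)"
        by (intro ennreal_leI mult_powr_young F0 W0 \<epsilon> q)
      also have "\<dots> = ennreal \<epsilon> * ennreal (?W y powr q) + ennreal (\<epsilon> powr (1 - q)) * ennreal (?F y powr q)"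
        using \<epsilon> by (simp add: ennreal_mult ennreal_plus)
      finally show "ennreal (?F y * ?W y powr (q - 1)) \<le> \<dots>" .
    qed
    also have "\<dots> = ennreal \<epsilon> * ?I + ennreal (\<epsilon> powr (1 - q)) * (\<integral>\<^sup>+x. ennreal (?F x powr q) \<partial>M)"
      by (subst nn_integral_add) (auto simp: nn_integral_cmult)
    finally have "?I \<le> ennreal C2 * (ennreal \<epsilon> * ?I + ennreal (\<epsilon> powr (1 - q)) * (\<integral>\<^sup>+x. ennreal (?F x powr q) \<partial>M))"
      by (simp add: mult_left_mono)
    also have "\<dots> = ennreal (C2 * \<epsilon>) * ?I + ennreal (C2 * \<epsilon> powr (1 - q)) * (\<integral>\<^sup>+x. ennreal (?F x powr q) \<partial>M)"
      using C2 \<epsilon> by (simp add: distrib_left mult.assoc ennreal_mult)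
    also have "C2 * \<epsilon> = 1/2" using C2 by (simp add: \<epsilon>_def)
    finally have "?I \<le> 2 * (ennreal (C2 * \<epsilon> powr (1 - q)) * (\<integral>\<^sup>+x. ennreal (?F x powr q) \<partial>M))"
      using bump_sum_powr_finite[OF J(1) b q L1(2)] by (intro ennreal_absorb_half) auto
    also have "\<dots> = ennreal (2 * (C2 * \<epsilon> powr (1 - q))) * (\<integral>\<^sup>+x. ennreal (?F x powr q) \<partial>M)"
      using C2 by (subst (2) ennreal_mult) (auto simp: mult.assoc)
    finally show ?thesis .
  qed
  moreover have "2 * (C2 * \<epsilon> powr (1 - q)) \<ge> 0" using C2 by simp
  ultimately show ?thesis by blast
qed

lemma finite_smoothing:
  assumes q: "q > 0"
  shows "\<exists>L0\<ge>0. \<forall>L\<ge>L0. \<exists>C\<ge>0. \<forall>J b. finite J \<longrightarrow> J \<subseteq> pts \<longrightarrow> (\<forall>i. b i \<ge> 0) \<longrightarrow>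
    (\<integral>\<^sup>+x. ennreal (bump_sum J b L x powr q) \<partial>M) \<le> ennreal C * (\<integral>\<^sup>+x. ennreal (cell_sum J b x powr q) \<partial>M)"
proof (cases "q \<le> 1")
  case True
  then show ?thesis
    using finite_smoothing_concave[OF q True] q \<omega>_pos by (intro exI[of _ "(\<omega> + 1) / q"]) auto
next
  case False
  then show ?thesis
    using finite_smoothing_convex[of q] q \<omega>_pos by (intro exI[of _ "q + \<omega> + 1"]) auto
qed

text \<open>The passage from finite sums to all of \<open>pts\<close> by monotone convergence. This inequality plays the
  role of the vector-valued maximal inequality: it permits cubes to be replaced by bumps inside
  any square function.\<close>

lemma smoothing:
  assumes q: "q > 0"
  shows "\<exists>L0\<ge>0. \<forall>L\<ge>L0. \<exists>C>0. \<forall>b. (\<forall>i. b i \<ge> 0) \<longrightarrow>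
    (\<integral>\<^sup>+x. ennreal_powr (bump_series b L x) q \<partial>M)
      \<le> ennreal C * (\<integral>\<^sup>+x. ennreal_powr (cell_series b x) q \<partial>M)"
proof -
  obtain L0 where L0: "L0 \<ge> 0" "\<And>L. L \<ge> L0 \<Longrightarrow> \<exists>C\<ge>0. \<forall>J b. finite J \<longrightarrow> J \<subseteq> pts \<longrightarrow> (\<forall>i. b i \<ge> 0) \<longrightarrow>
    (\<integral>\<^sup>+x. ennreal (bump_sum J b L x powr q) \<partial>M) \<le> ennreal C * (\<integral>\<^sup>+x. ennreal (cell_sum J b x powr q) \<partial>M)"
    using finite_smoothing[OF q] by blast
  have "\<exists>C>0. \<forall>b. (\<forall>i. b i \<ge> 0) \<longrightarrow>
    (\<integral>\<^sup>+x. ennreal_powr (bump_series b L x) q \<partial>M)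
      \<le> ennreal C * (\<integral>\<^sup>+x. ennreal_powr (cell_series b x) q \<partial>M)"
    if L: "L \<ge> L0" for L
  proof -
    obtain C where C: "C \<ge> 0" "\<And>J b. finite J \<Longrightarrow> J \<subseteq> pts \<Longrightarrow> (\<forall>i. b i \<ge> 0) \<Longrightarrow>
      (\<integral>\<^sup>+x. ennreal (bump_sum J b L x powr q) \<partial>M) \<le> ennreal C * (\<integral>\<^sup>+x. ennreal (cell_sum J b x powr q) \<partial>M)"
      using L0(2)[OF L] by blast
    have "(\<integral>\<^sup>+x. ennreal_powr (bump_series b L x) q \<partial>M)
      \<le> ennreal (C + 1) * (\<integral>\<^sup>+x. ennreal_powr (cell_series b x) q \<partial>M)"
      if b: "\<forall>i. b i \<ge> 0" for b
    proof -
      obtain J :: "nat \<Rightarrow> (int \<times> 'a) set" where J: "incseq J" "\<And>n. finite (J n)" "\<And>n. J n \<subseteq> pts"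
        "\<And>f. nsum pts f = (SUP n. sum f (J n))"
        by (rule exhausting_finite_sets[OF countable_pts]) blast
      have W0: "0 \<le> bump_sum (J n) b L x" for n x using b by (intro bump_sum_nonneg) auto
      have F0: "0 \<le> cell_sum (J n) b x" for n x using b by (intro cell_sum_nonneg) auto
      have W: "(\<Sum>i\<in>J n. ennreal (b i * wt L i x)) = ennreal (bump_sum (J n) b L x)" for n x
        unfolding bump_sum_def using b by (intro sum_ennreal mult_nonneg_nonneg) auto
      have F: "(\<Sum>i\<in>J n. ennreal (b i) * indicator (cell i) x) = ennreal (cell_sum (J n) b x)" for n x
        using b unfolding cell_sum_def by (subst sum_ennreal[symmetric]) (auto intro!: sum.cong split: split_indicator)
      have mono: "incseq (\<lambda>n x. ennreal (bump_sum (J n) b L x powr q))"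
      proof (intro incseq_SucI le_funI ennreal_leI powr_mono2 W0)
        fix n x
        show "bump_sum (J n) b L x \<le> bump_sum (J (Suc n)) b L x"
          unfolding bump_sum_def using b J incseq_SucD[OF J(1)] by (intro sum_mono2) auto
      qed (use q in auto)
      have "(\<integral>\<^sup>+x. ennreal_powr (bump_series b L x) q \<partial>M)
          = (\<integral>\<^sup>+x. (SUP n. ennreal (bump_sum (J n) b L x powr q)) \<partial>M)"
        unfolding J(4) W using q W0 by (simp add: ennreal_powr_SUP ennreal_powr_ennreal)
      also have "\<dots> = (SUP n. \<integral>\<^sup>+x. ennreal (bump_sum (J n) b L x powr q) \<partial>M)"
        using mono by (intro nn_integral_monotone_convergence_SUP) auto
      also have "\<dots> \<le> ennreal (C + 1) * (\<integral>\<^sup>+x. ennreal_powr (cell_series b x) q \<partial>M)"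
      proof (rule SUP_least)
        fix n
        have "(\<integral>\<^sup>+x. ennreal (bump_sum (J n) b L x powr q) \<partial>M) \<le> ennreal C * (\<integral>\<^sup>+x. ennreal (cell_sum (J n) b x powr q) \<partial>M)"
          by (intro C(2) J b)
        also have "\<dots> \<le> ennreal (C + 1) * (\<integral>\<^sup>+x. ennreal_powr (cell_series b x) q \<partial>M)"
        proof (intro mult_mono nn_integral_mono ennreal_leI)
          fix x
          have "ennreal (cell_sum (J n) b x powr q) = ennreal_powr (sum (\<lambda>i. ennreal (b i) * indicator (cell i) x) (J n)) q"
            using F0 by (simp add: F ennreal_powr_ennreal)
          also have "\<dots> \<le> ennreal_powr (cell_series b x) q"
            using J q by (intro ennreal_powr_mono sum_le_nsum) auto
          finally show "ennreal (cell_sum (J n) b x powr q) \<le> \<dots>" .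
        qed auto
        finally show "(\<integral>\<^sup>+x. ennreal (bump_sum (J n) b L x powr q) \<partial>M) \<le> ennreal (C + 1) * (\<integral>\<^sup>+x. ennreal_powr (cell_series b x) q \<partial>M)" .
      qed
      finally show ?thesis .
    qed
    then show ?thesis using C(1) by (intro exI[of _ "C + 1"]) auto
  qed
  then show ?thesis using L0(1) by blast
qed

text \<open>Smoothing in the form in which square functions use it, with the square root and the
  \<open>p\<close>-th root taken.\<close>

lemma Lp_norm_le_of_le_bump_series:
  assumes p: "p > 0"
  shows "\<exists>L0\<ge>0. \<forall>L\<ge>L0. \<forall>C>0. \<exists>C'>0. \<forall>F b. (\<forall>i. b i \<ge> 0) \<longrightarrow> (\<forall>x. F x \<le> ennreal C * bump_series b L x) \<longrightarrow>
    Lp_norm M p (\<lambda>x. ennreal_powr (F x) (1/2)) \<le> ennreal C' * Lp_norm M p (\<lambda>x. ennreal_powr (cell_series b x) (1/2))"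
proof -
  let ?I = "\<lambda>F. \<integral>\<^sup>+x. ennreal_powr (F x) (p / 2) \<partial>M"
  obtain L0 where L0: "L0 \<ge> 0" "\<And>L. L \<ge> L0 \<Longrightarrow> \<exists>C>0. \<forall>b. (\<forall>i. b i \<ge> 0) \<longrightarrow> ?I (bump_series b L) \<le> ennreal C * ?I (cell_series b)"
    using smoothing[of "p / 2"] p by auto
  have "\<exists>C'>0. \<forall>F b. (\<forall>i. b i \<ge> 0) \<longrightarrow> (\<forall>x. F x \<le> ennreal C * bump_series b L x) \<longrightarrow>
    Lp_norm M p (\<lambda>x. ennreal_powr (F x) (1/2)) \<le> ennreal C' * Lp_norm M p (\<lambda>x. ennreal_powr (cell_series b x) (1/2))"
    if L: "L \<ge> L0" and C: "C > 0" for L C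
  proof -
    obtain C1 where C1: "C1 > 0" "\<And>b. (\<And>i. b i \<ge> 0) \<Longrightarrow> ?I (bump_series b L) \<le> ennreal C1 * ?I (cell_series b)"
      using L0(2)[OF L] by blast
    have "Lp_norm M p (\<lambda>x. ennreal_powr (F x) (1/2))
        \<le> ennreal ((C powr (p / 2) * C1) powr (1 / p)) * Lp_norm M p (\<lambda>x. ennreal_powr (cell_series b x) (1/2))"
      if b: "\<forall>i. b i \<ge> 0" and F: "\<forall>x. F x \<le> ennreal C * bump_series b L x" for F b
    proof (rule Lp_norm_le_of_powr_integral_le)
      have "?I F \<le> ?I (\<lambda>x. ennreal C * bump_series b L x)"
        using p F by (intro nn_integral_mono ennreal_powr_mono) auto
      also have "\<dots> = ennreal (C powr (p / 2)) * ?I (bump_series b L)"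
        unfolding ennreal_powr_cmult[OF C]
        by (rule nn_integral_cmult) (intro borel_measurable_ennreal_powr borel_measurable_nsum countable_pts; measurable)
      also have "\<dots> \<le> ennreal (C powr (p / 2)) * (ennreal C1 * ?I (cell_series b))"
        using b by (intro mult_left_mono C1) auto
      also have "\<dots> = ennreal (C powr (p / 2) * C1) * ?I (cell_series b)"
        using C1(1) by (simp add: ennreal_mult mult.assoc)
      finally show "?I F \<le> ennreal (C powr (p / 2) * C1) * ?I (cell_series b)" .
    qed (use p C C1 in auto)
    moreover have "(C powr (p / 2) * C1) powr (1 / p) > 0" using C C1(1) by simp
    ultimately show ?thesis by blast
  qed
  then show ?thesis using L0(1) by blast
qed

end

section \<open>Wavelets and the square function with suprema\<close>

lemma exp_powr_decay:
  fixes \<nu> a L :: real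
  assumes "\<nu> > 0" "a > 0" "L \<ge> 0"
  shows "\<exists>C>0. \<forall>t\<ge>0. exp (- \<nu> * t powr a) \<le> C * (1 + t) powr (- L)"
proof -
  define P where "P = (L + 1) / a"
  have P: "P > 0" using assms by (simp add: P_def)
  define C where "C = 2 powr L * (1 + (P / \<nu>) powr P)"
  have C: "C > 0" unfolding C_def by (intro mult_pos_pos add_pos_nonneg) auto
  have "exp (- \<nu> * t powr a) * (1 + t) powr L \<le> C" if t: "t \<ge> 0" for t
  proof (cases "t \<le> 1")
    case True
    have "exp (- \<nu> * t powr a) * (1 + t) powr L \<le> 1 * 2 powr L"
      using assms t True by (intro mult_mono powr_mono2) auto
    also have "\<dots> \<le> C" unfolding C_def using mult_left_mono[of 1 "1 + (P / \<nu>) powr P" "2 powr L"] by simp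
    finally show ?thesis .
  next
    case False
    then have t1: "t > 1" by simp
    \<comment> \<open>raise \<open>y \<le> exp y\<close> to the power \<open>P\<close>, chosen so that \<open>t powr a\<close> becomes \<open>t powr (L + 1)\<close>\<close>
    have "((\<nu> / P) * t powr a) powr P \<le> exp ((\<nu> / P) * t powr a) powr P"
      using assms P by (intro powr_mono2 order_trans[OF _ exp_ge_add_one_self]) auto
    also have "\<dots> = exp (\<nu> * t powr a)"
      using P by (simp add: exp_powr_real)
    also have "((\<nu> / P) * t powr a) powr P = (\<nu> / P) powr P * t powr (a * P)"
      by (simp only: powr_mult powr_powr)
    also have "a * P = L + 1" using assms by (simp add: P_def)
    finally have "(\<nu> / P) powr P * t powr (L + 1) \<le> exp (\<nu> * t powr a)" .
    then have "t powr (L + 1) * exp (- (\<nu> * t powr a)) \<le> 1 / (\<nu> / P) powr P"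
      using assms P by (simp add: exp_minus field_simps)
    then have *: "t powr (L + 1) * exp (- \<nu> * t powr a) \<le> (P / \<nu>) powr P"
      using assms P by (simp add: powr_divide)
    have "(1 + t) powr L \<le> (2 * t) powr L" using assms t1 by (intro powr_mono2) auto
    also have "\<dots> = 2 powr L * t powr L" by (simp add: powr_mult)
    also have "\<dots> \<le> 2 powr L * t powr (L + 1)" using t1 by (intro mult_left_mono powr_mono) auto
    finally have "exp (- \<nu> * t powr a) * (1 + t) powr L \<le> exp (- \<nu> * t powr a) * (2 powr L * t powr (L + 1))"
      by (intro mult_left_mono) auto
    also have "\<dots> = 2 powr L * (t powr (L + 1) * exp (- \<nu> * t powr a))" by (simp only: mult_ac)
    also have "\<dots> \<le> 2 powr L * (1 + (P / \<nu>) powr P)"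
      using * by (intro mult_left_mono) auto
    finally show ?thesis by (simp add: C_def)
  qed
  then have "exp (- \<nu> * t powr a) \<le> C * (1 + t) powr (- L)" if "t \<ge> 0" for t
  proof -
    have "exp (- \<nu> * t powr a) \<le> C / (1 + t) powr L"
      using \<open>\<And>t. t \<ge> 0 \<Longrightarrow> exp (- \<nu> * t powr a) * (1 + t) powr L \<le> C\<close>[OF that] that
      by (subst pos_le_divide_eq) auto
    then show ?thesis by (simp add: powr_minus divide_inverse)
  qed
  then show ?thesis using C by blast
qed

locale doubling_wavelets =
  doubling_cubes M d A\<^sub>0 \<delta> \<X> Q \<omega> K + wavelet_basis M d A\<^sub>0 \<delta> \<X> Q \<eta> \<psi>
  for M :: "'a measure" and d :: "'a \<Rightarrow> 'a \<Rightarrow> real" and A\<^sub>0 \<delta> :: real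
    and \<X> :: "int \<Rightarrow> 'a set" and Q :: "int \<Rightarrow> 'a \<Rightarrow> 'a set" and \<omega> K \<eta> :: real
    and \<psi> :: "int \<Rightarrow> 'a \<Rightarrow> 'a \<Rightarrow> real"
begin

abbreviation Y :: "int \<Rightarrow> 'a set" where "Y \<equiv> new_points \<X>"

lemma new_points_subset: "Y k \<subseteq> \<X> (k + 1)"
  by (auto simp: new_points_def)

lemma wavelet_bump_bounds:
  assumes "L \<ge> 0"
  shows "\<exists>C>0. \<forall>k. \<forall>\<alpha>\<in>Y k.
    (\<forall>x. \<bar>\<psi> k \<alpha> x\<bar> \<le> C / sqrt (V (scale k) \<alpha>) * w L (scale k) \<alpha> x) \<and>
    (\<forall>x y. d x y \<le> scale k \<longrightarrow> \<bar>\<psi> k \<alpha> x - \<psi> k \<alpha> y\<bar> \<le>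
       C / sqrt (V (scale k) \<alpha>) * (d x y / scale k) powr \<eta> * w L (scale k) \<alpha> x)"
proof -
  let ?a = "1 / (1 + 2 * log 2 A\<^sub>0)"
  have a: "?a > 0" using A\<^sub>0_ge_1 by (intro divide_pos_pos add_pos_nonneg) (auto simp: zero_le_log_cancel_iff)
  obtain C \<nu> where \<nu>: "\<nu> > 0" and C: "\<forall>k. \<forall>\<alpha>\<in>Y k.
          (\<forall>x. \<bar>\<psi> k \<alpha> x\<bar> \<le> C / sqrt (V (scale k) \<alpha>) * exp (- \<nu> * (d \<alpha> x / scale k) powr ?a)) \<and>
          (\<forall>x y. d x y \<le> scale k \<longrightarrow>
             \<bar>\<psi> k \<alpha> x - \<psi> k \<alpha> y\<bar> \<le> C / sqrt (V (scale k) \<alpha>) *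
                 (d x y / scale k) powr \<eta> * exp (- \<nu> * (d \<alpha> x / scale k) powr ?a))"
    using estimates by blast
  obtain D where D: "D > 0" "\<And>t. t \<ge> 0 \<Longrightarrow> exp (- \<nu> * t powr ?a) \<le> D * (1 + t) powr (- L)"
    using exp_powr_decay[OF \<nu> a assms] by blast
  have le: "C / sqrt (V (scale k) \<alpha>) * h * exp (- \<nu> * (d \<alpha> x / scale k) powr ?a)
      \<le> (\<bar>C\<bar> + 1) * D / sqrt (V (scale k) \<alpha>) * h * w L (scale k) \<alpha> x" if "h \<ge> 0" for k \<alpha> x h
  proof -
    have "C / sqrt (V (scale k) \<alpha>) * h \<le> (\<bar>C\<bar> + 1) / sqrt (V (scale k) \<alpha>) * h"
      using that by (intro mult_right_mono divide_right_mono) auto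
    then have "C / sqrt (V (scale k) \<alpha>) * h * exp (- \<nu> * (d \<alpha> x / scale k) powr ?a)
      \<le> (\<bar>C\<bar> + 1) / sqrt (V (scale k) \<alpha>) * h * exp (- \<nu> * (d \<alpha> x / scale k) powr ?a)"
      by (rule mult_right_mono) auto
    also have "\<dots> \<le> (\<bar>C\<bar> + 1) / sqrt (V (scale k) \<alpha>) * h * (D * (1 + d \<alpha> x / scale k) powr (- L))"
      using dist_nonneg[of \<alpha> x] that by (intro mult_left_mono D mult_nonneg_nonneg divide_nonneg_nonneg) auto
    finally show ?thesis by (simp add: bump_def mult_ac)
  qed
  show ?thesis
  proof (intro exI[of _ "(\<bar>C\<bar> + 1) * D"] conjI allI ballI impI)
    show "(\<bar>C\<bar> + 1) * D > 0" using D(1) by (intro mult_pos_pos) auto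
  next
    fix k \<alpha> x assume "\<alpha> \<in> Y k"
    then show "\<bar>\<psi> k \<alpha> x\<bar> \<le> (\<bar>C\<bar> + 1) * D / sqrt (V (scale k) \<alpha>) * w L (scale k) \<alpha> x"
      using C[rule_format, THEN conjunct1, rule_format, of \<alpha> k x] le[of 1 \<alpha> k x] by simp
  next
    fix k \<alpha> x y assume "\<alpha> \<in> Y k" "d x y \<le> scale k"
    then show "\<bar>\<psi> k \<alpha> x - \<psi> k \<alpha> y\<bar> \<le> (\<bar>C\<bar> + 1) * D / sqrt (V (scale k) \<alpha>) * (d x y / scale k) powr \<eta> * w L (scale k) \<alpha> x"
      using C le[of "(d x y / scale k) powr \<eta>" \<alpha> k x] powr_ge_zero by (meson order_trans)
  qed
qed

lemma bump_rescale_Suc: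
  assumes "L \<ge> 0"
  shows "w L (scale k) x y \<le> (1 / \<delta>) powr L * w L (scale (k + 1)) x y"
  using bump_rescale[of "scale (k + 1)" "scale k" L x y] scale_antimono[of k "k + 1"] assms
  by (simp add: scale_Suc)

lemma nsum_new_points_bump:
  assumes L: "L \<ge> 2 * \<omega> + 1"
  shows "\<exists>C>0. \<forall>k x. nsum (Y k) (\<lambda>\<alpha>. ennreal (w L (scale k) x \<alpha>)) \<le> ennreal C"
proof -
  have L0: "L \<ge> 0" using L \<omega>_pos by simp
  obtain C where C: "C \<ge> 1" "\<And>k x. nsum (\<X> k) (\<lambda>\<alpha>. ennreal (w L (scale k) x \<alpha>)) \<le> ennreal C"
    using bump_sum_bound L by meson
  let ?R = "(1 / \<delta>) powr L"
  have "nsum (Y k) (\<lambda>\<alpha>. ennreal (w L (scale k) x \<alpha>)) \<le> ennreal (?R * C)" for k x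
  proof -
    have "nsum (Y k) (\<lambda>\<alpha>. ennreal (w L (scale k) x \<alpha>)) \<le> nsum (\<X> (k + 1)) (\<lambda>\<alpha>. ennreal ?R * ennreal (w L (scale (k + 1)) x \<alpha>))"
      by (intro nsum_subset_mono new_points_subset) (auto simp: ennreal_mult[symmetric] intro!: ennreal_leI bump_rescale_Suc L0)
    also have "\<dots> = ennreal ?R * nsum (\<X> (k + 1)) (\<lambda>\<alpha>. ennreal (w L (scale (k + 1)) x \<alpha>))"
      by (rule nn_integral_cmult) simp
    also have "\<dots> \<le> ennreal ?R * ennreal C" by (intro mult_left_mono C) auto
    also have "\<dots> = ennreal (?R * C)" using C by (simp add: ennreal_mult)
    finally show ?thesis .
  qed
  moreover have "?R * C > 0" using C by simp
  ultimately show ?thesis by blast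
qed

lemma measure_new_cube_le:
  assumes "\<alpha> \<in> Y k"
  shows "measure M (Q (k + 1) \<alpha>) \<le> K * (4 * A\<^sub>0\<^sup>2) powr \<omega> * V (scale k) \<alpha>"
proof -
  have "measure M (Q (k + 1) \<alpha>) \<le> K * (4 * A\<^sub>0\<^sup>2) powr \<omega> * V (scale (k + 1)) \<alpha>"
    using assms new_points_subset by (intro measure_cube_le) auto
  also have "\<dots> \<le> K * (4 * A\<^sub>0\<^sup>2) powr \<omega> * V (scale k) \<alpha>"
    using scale_antimono[of k "k + 1"]
    by (intro mult_left_mono measure_mono_in_ball qball_measurable) (auto simp: qball_def)
  finally show ?thesis .
qed

text \<open>Cauchy--Schwarz with respect to the weights, whose sum is bounded. The coefficients enter only
  through the squares that the wavelet square function is made of.\<close>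

lemma wavelet_sum_bound:
  assumes L: "L \<ge> 2 * \<omega> + 1"
  shows "\<exists>C>0. \<forall>(c :: 'a \<Rightarrow> 'b::{real_normed_field, banach}) k z.
    ennreal ((norm (\<Sum>\<^sub>\<infinity>\<alpha>\<in>Y k. c \<alpha> * of_real (\<psi> k \<alpha> z)))\<^sup>2)
      \<le> ennreal C * nsum (Y k) (\<lambda>\<alpha>. ennreal ((norm (c \<alpha>))\<^sup>2 / measure M (Q (k + 1) \<alpha>) * w L (scale (k + 1)) z \<alpha>))"
proof -
  have L0: "L \<ge> 0" using L \<omega>_pos by simp
  obtain C0 where C0: "C0 > 0" "\<And>k \<alpha> x. \<alpha> \<in> Y k \<Longrightarrow> \<bar>\<psi> k \<alpha> x\<bar> \<le> C0 / sqrt (V (scale k) \<alpha>) * w L (scale k) \<alpha> x"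
    using wavelet_bump_bounds[OF L0] by blast
  obtain Cp where Cp: "Cp > 0" "\<And>k x. nsum (Y k) (\<lambda>\<alpha>. ennreal (w L (scale k) x \<alpha>)) \<le> ennreal Cp"
    using nsum_new_points_bump[OF L] by blast
  define R where "R = (1 / \<delta>) powr L"
  have R: "R > 0" by (simp add: R_def)
  have rs: "w L (scale k) x y \<le> R * w L (scale (k + 1)) x y" for k x y
    unfolding R_def by (rule bump_rescale_Suc[OF L0])
  define Kq where "Kq = K * (4 * A\<^sub>0\<^sup>2) powr \<omega>"
  have Kq: "Kq > 0" by (simp add: Kq_def)
  define C where "C = Cp * (C0\<^sup>2 * Kq * R)"
  have Cpos: "C > 0" using R Cp(1) C0(1) Kq by (simp add: C_def)
  have "ennreal ((norm (\<Sum>\<^sub>\<infinity>\<alpha>\<in>Y k. c \<alpha> * of_real (\<psi> k \<alpha> z)))\<^sup>2)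
      \<le> ennreal C * nsum (Y k) (\<lambda>\<alpha>. ennreal ((norm (c \<alpha>))\<^sup>2 / measure M (Q (k + 1) \<alpha>) * w L (scale (k + 1)) z \<alpha>))"
    for c :: "'a \<Rightarrow> 'b" and k z
  proof -
    let ?a = "\<lambda>\<alpha>. norm (c \<alpha>) * C0 / sqrt (V (scale k) \<alpha>)" and ?u = "\<lambda>\<alpha>. w L (scale k) z \<alpha>"
    have "ennreal (norm (\<Sum>\<^sub>\<infinity>\<alpha>\<in>Y k. c \<alpha> * of_real (\<psi> k \<alpha> z))) \<le> nsum (Y k) (\<lambda>\<alpha>. ennreal (norm (c \<alpha> * of_real (\<psi> k \<alpha> z))))"
      by (rule norm_infsum_le_nsum)
    also have "\<dots> \<le> nsum (Y k) (\<lambda>\<alpha>. ennreal (?a \<alpha> * ?u \<alpha>))"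
    proof (intro nn_integral_mono ennreal_leI)
      fix \<alpha> assume "\<alpha> \<in> space (count_space (Y k))"
      then have "\<bar>\<psi> k \<alpha> z\<bar> \<le> C0 / sqrt (V (scale k) \<alpha>) * w L (scale k) \<alpha> z" using C0(2) by simp
      then have "norm (c \<alpha>) * \<bar>\<psi> k \<alpha> z\<bar> \<le> norm (c \<alpha>) * (C0 / sqrt (V (scale k) \<alpha>) * w L (scale k) \<alpha> z)"
        by (rule mult_left_mono) simp
      then show "norm (c \<alpha> * of_real (\<psi> k \<alpha> z)) \<le> ?a \<alpha> * ?u \<alpha>"
        by (simp add: norm_mult bump_commute[of _ _ z])
    qed
    finally have "(ennreal (norm (\<Sum>\<^sub>\<infinity>\<alpha>\<in>Y k. c \<alpha> * of_real (\<psi> k \<alpha> z))))\<^sup>2 \<le> (nsum (Y k) (\<lambda>\<alpha>. ennreal (?a \<alpha> * ?u \<alpha>)))\<^sup>2"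
      by (rule power_mono) simp
    also have "\<dots> \<le> nsum (Y k) (\<lambda>\<alpha>. ennreal (?u \<alpha>)) * nsum (Y k) (\<lambda>\<alpha>. ennreal ((?a \<alpha>)\<^sup>2 * ?u \<alpha>))"
      using C0(1) by (intro nsum_Cauchy_Schwarz countable_new_points) auto
    also have "\<dots> \<le> ennreal Cp * (ennreal (C0\<^sup>2 * Kq * R) * nsum (Y k) (\<lambda>\<alpha>. ennreal ((norm (c \<alpha>))\<^sup>2 / measure M (Q (k + 1) \<alpha>) * w L (scale (k + 1)) z \<alpha>)))"
    proof (intro mult_mono Cp)
      have "nsum (Y k) (\<lambda>\<alpha>. ennreal ((?a \<alpha>)\<^sup>2 * ?u \<alpha>))
         \<le> nsum (Y k) (\<lambda>\<alpha>. ennreal (C0\<^sup>2 * Kq * R) * ennreal ((norm (c \<alpha>))\<^sup>2 / measure M (Q (k + 1) \<alpha>) * w L (scale (k + 1)) z \<alpha>))"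
      proof (intro nn_integral_mono)
        fix \<alpha> assume "\<alpha> \<in> space (count_space (Y k))"
        then have \<alpha>: "\<alpha> \<in> Y k" by simp
        let ?m = "measure M (Q (k + 1) \<alpha>)"
        have m: "?m > 0" using \<alpha> new_points_subset by (intro cube_measure_pos) auto
        have Vp: "V (scale k) \<alpha> > 0" by (rule V_pos) simp
        have "1 / V (scale k) \<alpha> \<le> Kq / ?m"
          using measure_new_cube_le[OF \<alpha>] m Vp by (simp add: Kq_def field_simps)
        then have "(norm (c \<alpha>) * C0)\<^sup>2 * (1 / V (scale k) \<alpha>) * ?u \<alpha> \<le> (norm (c \<alpha>) * C0)\<^sup>2 * (Kq / ?m) * (R * w L (scale (k + 1)) z \<alpha>)"
          using rs[of k z \<alpha>] Kq m by (intro mult_mono mult_left_mono mult_nonneg_nonneg) auto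
        also have "\<dots> = (C0\<^sup>2 * Kq * R) * ((norm (c \<alpha>))\<^sup>2 / ?m * w L (scale (k + 1)) z \<alpha>)"
          by (simp add: power_mult_distrib mult_ac)
        finally have "(?a \<alpha>)\<^sup>2 * ?u \<alpha> \<le> (C0\<^sup>2 * Kq * R) * ((norm (c \<alpha>))\<^sup>2 / ?m * w L (scale (k + 1)) z \<alpha>)"
          using Vp by (simp add: power_divide)
        then show "ennreal ((?a \<alpha>)\<^sup>2 * ?u \<alpha>) \<le> ennreal (C0\<^sup>2 * Kq * R) * ennreal ((norm (c \<alpha>))\<^sup>2 / ?m * w L (scale (k + 1)) z \<alpha>)"
          using Kq R m by (subst ennreal_mult[symmetric]) (auto intro!: ennreal_leI)
      qed
      also have "\<dots> = ennreal (C0\<^sup>2 * Kq * R) * nsum (Y k) (\<lambda>\<alpha>. ennreal ((norm (c \<alpha>))\<^sup>2 / measure M (Q (k + 1) \<alpha>) * w L (scale (k + 1)) z \<alpha>))"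
        by (rule nn_integral_cmult) simp
      finally show "nsum (Y k) (\<lambda>\<alpha>. ennreal ((?a \<alpha>)\<^sup>2 * ?u \<alpha>)) \<le> \<dots>" .
    qed auto
    also have "\<dots> = ennreal C * nsum (Y k) (\<lambda>\<alpha>. ennreal ((norm (c \<alpha>))\<^sup>2 / measure M (Q (k + 1) \<alpha>) * w L (scale (k + 1)) z \<alpha>))"
      using R Cp(1) C0(1) Kq by (simp add: C_def ennreal_mult mult.assoc)
    finally show ?thesis by (simp add: ennreal_power)
  qed
  then show ?thesis using Cpos by blast
qed

text \<open>The generation is shifted by one because the cube that carries a wavelet of level \<open>k\<close> has
  generation \<open>k + 1\<close>; centers that carry no wavelet get weight \<open>0\<close>.\<close>

definition coeff_weight :: "(int \<Rightarrow> 'a \<Rightarrow> 'b::real_normed_vector) \<Rightarrow> int \<times> 'a \<Rightarrow> real" where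
  "coeff_weight c i = (if snd i \<in> Y (fst i - 1) then (norm (c (fst i - 1) (snd i)))\<^sup>2 / measure M (cell i) else 0)"

lemma coeff_weight_nonneg: "0 \<le> coeff_weight c i"
  by (simp add: coeff_weight_def)

lemma nsum_coeff_weight:
  "nsum pts (\<lambda>i. ennreal (coeff_weight c i) * g i)
    = nsum UNIV (\<lambda>k. nsum (Y k) (\<lambda>\<alpha>. ennreal ((norm (c k \<alpha>))\<^sup>2 / measure M (Q (k + 1) \<alpha>)) * g (k + 1, \<alpha>)))"
proof -
  have "nsum pts (\<lambda>i. ennreal (coeff_weight c i) * g i)
     = nsum UNIV (\<lambda>k. nsum (\<X> (k + 1)) (\<lambda>\<alpha>. ennreal (coeff_weight c (k + 1, \<alpha>)) * g (k + 1, \<alpha>)))"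
    unfolding nsum_pts by (rule nsum_int_shift[symmetric])
  also have "\<dots> = nsum UNIV (\<lambda>k. nsum (Y k) (\<lambda>\<alpha>. ennreal (coeff_weight c (k + 1, \<alpha>)) * g (k + 1, \<alpha>)))"
    using new_points_subset by (intro nn_integral_cong nn_integral_count_space_eq) (auto simp: coeff_weight_def)
  also have "\<dots> = nsum UNIV (\<lambda>k. nsum (Y k) (\<lambda>\<alpha>. ennreal ((norm (c k \<alpha>))\<^sup>2 / measure M (Q (k + 1) \<alpha>)) * g (k + 1, \<alpha>)))"
    by (intro nn_integral_cong) (auto simp: coeff_weight_def)
  finally show ?thesis .
qed

lemma wavelet_square_function_eq:
  "wavelet_square_function M \<X> Q \<psi> f x =
     ennreal_powr (cell_series (coeff_weight (wavelet_coeff \<psi> f)) x) (1/2)"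
proof -
  have "(\<Sum>\<^sub>\<infinity>k. \<Sum>\<^sub>\<infinity>\<alpha>\<in>Y k. ennreal ((norm (wavelet_coeff \<psi> f k \<alpha>) * normalized_indicator M (Q (k + 1) \<alpha>) x)\<^sup>2))
     = nsum UNIV (\<lambda>k. nsum (Y k) (\<lambda>\<alpha>. ennreal ((norm (wavelet_coeff \<psi> f k \<alpha>) * normalized_indicator M (Q (k + 1) \<alpha>) x)\<^sup>2)))"
    by (simp add: infsum_ennreal_eq_nsum countable_new_points)
  also have "\<dots> = cell_series (coeff_weight (wavelet_coeff \<psi> f)) x"
    by (subst nsum_coeff_weight)
      (auto intro!: nn_integral_cong simp: normalized_indicator_def power_divide split: split_indicator)
  finally show ?thesis by (simp add: wavelet_square_function_def)
qed

text \<open>On a cube of generation \<open>k + N\<close> the weights of level \<open>k\<close> are essentially constant, so the supremum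
  costs a constant and the square function is at most a bump sum of \<open>coeff_weight\<close>; smoothing applies.\<close>

lemma sup_square_function_le:
  assumes p: "p > 0"
  shows "\<exists>C>0. \<forall>f :: ('a \<Rightarrow> 'b) \<Rightarrow> 'b::{real_normed_field, banach}.
    Lp_norm M p (sup_square_function \<X> Q \<psi> N f) \<le> ennreal C * Lp_norm M p (wavelet_square_function M \<X> Q \<psi> f)"
proof -
  obtain L0 where L0: "\<And>L C. L \<ge> L0 \<Longrightarrow> C > 0 \<Longrightarrow> \<exists>C'>0. \<forall>F b. (\<forall>i. b i \<ge> 0) \<longrightarrow> (\<forall>x. F x \<le> ennreal C * bump_series b L x) \<longrightarrow>
    Lp_norm M p (\<lambda>x. ennreal_powr (F x) (1/2)) \<le> ennreal C' * Lp_norm M p (\<lambda>x. ennreal_powr (cell_series b x) (1/2))"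
    using Lp_norm_le_of_le_bump_series[OF p] by blast
  define L where "L = max L0 (2 * \<omega> + 1)"
  have L: "L \<ge> L0" "L \<ge> 2 * \<omega> + 1" "L \<ge> 0" using \<omega>_pos by (auto simp: L_def)
  obtain C2 where C2: "C2 > 0" "\<And>(c :: 'a \<Rightarrow> 'b) k z.
    ennreal ((norm (\<Sum>\<^sub>\<infinity>\<alpha>\<in>Y k. c \<alpha> * of_real (\<psi> k \<alpha> z)))\<^sup>2)
      \<le> ennreal C2 * nsum (Y k) (\<lambda>\<alpha>. ennreal ((norm (c \<alpha>))\<^sup>2 / measure M (Q (k + 1) \<alpha>) * w L (scale (k + 1)) z \<alpha>))"
    using wavelet_sum_bound[OF L(2), where 'b = 'b] by blast
  define R where "R = (A\<^sub>0 * (1 + 8 * A\<^sub>0 ^ 3 / \<delta>)) powr L"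
  have R: "R > 0" unfolding R_def by (simp add: add_pos_nonneg less_imp_neq[symmetric])
  define C3 where "C3 = C2 * R"
  have C3: "C3 > 0" using C2 R by (simp add: C3_def)
  obtain C1 where C1: "C1 > 0" "\<And>F b. (\<And>i. b i \<ge> 0) \<Longrightarrow> (\<And>x. F x \<le> ennreal C3 * bump_series b L x) \<Longrightarrow>
    Lp_norm M p (\<lambda>x. ennreal_powr (F x) (1/2)) \<le> ennreal C1 * Lp_norm M p (\<lambda>x. ennreal_powr (cell_series b x) (1/2))"
    using L0[OF L(1) C3] by blast
  have "Lp_norm M p (sup_square_function \<X> Q \<psi> N f)
      \<le> ennreal C1 * Lp_norm M p (wavelet_square_function M \<X> Q \<psi> f)"
    for f :: "('a \<Rightarrow> 'b) \<Rightarrow> 'b"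
  proof -
    let ?c = "wavelet_coeff \<psi> f"
    let ?b = "coeff_weight ?c"
    let ?S = "\<lambda>x. nsum UNIV (\<lambda>k. nsum (\<X> (k + int N)) (\<lambda>\<alpha>.
        (SUP z\<in>Q (k + int N) \<alpha>. ennreal ((norm (wavelet_operator \<X> \<psi> k f z))\<^sup>2)) * indicator (Q (k + int N) \<alpha>) x))"
    have S: "sup_square_function \<X> Q \<psi> N f = (\<lambda>x. ennreal_powr (?S x) (1/2))"
      by (rule ext) (simp add: sup_square_function_def infsum_ennreal_eq_nsum countable_points)
    have W: "wavelet_square_function M \<X> Q \<psi> f = (\<lambda>x. ennreal_powr (cell_series ?b x) (1/2))"
      by (rule ext) (rule wavelet_square_function_eq)
    have Sle: "?S x \<le> ennreal C3 * bump_series ?b L x" for x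
    proof -
      let ?T = "\<lambda>k. nsum (Y k) (\<lambda>\<alpha>. ennreal ((norm (?c k \<alpha>))\<^sup>2 / measure M (Q (k + 1) \<alpha>)) * ennreal (wt L (k + 1, \<alpha>) x))"
      have "nsum (\<X> (k + int N)) (\<lambda>\<alpha>. (SUP z\<in>Q (k + int N) \<alpha>. ennreal ((norm (wavelet_operator \<X> \<psi> k f z))\<^sup>2)) * indicator (Q (k + int N) \<alpha>) x)
          \<le> ennreal C3 * ?T k" for k
      proof (intro nsum_cells_le SUP_least)
        fix \<alpha>' z assume *: "\<alpha>' \<in> \<X> (k + int N)" "x \<in> Q (k + int N) \<alpha>'" "z \<in> Q (k + int N) \<alpha>'"
        have "d z x \<le> 8 * A\<^sub>0 ^ 3 * scale (k + int N)" by (rule cube_diameter[OF *(1,3,2)])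
        also have "\<dots> \<le> 8 * A\<^sub>0 ^ 3 * scale k" by (intro mult_left_mono scale_antimono) auto
        also have "\<dots> = 8 * A\<^sub>0 ^ 3 / \<delta> * scale (k + 1)" by (simp add: scale_Suc)
        finally have dzx: "d z x \<le> 8 * A\<^sub>0 ^ 3 / \<delta> * scale (k + 1)" .
        have "ennreal ((norm (wavelet_operator \<X> \<psi> k f z))\<^sup>2)
            \<le> ennreal C2 * nsum (Y k) (\<lambda>\<alpha>. ennreal ((norm (?c k \<alpha>))\<^sup>2 / measure M (Q (k + 1) \<alpha>) * w L (scale (k + 1)) z \<alpha>))"
          unfolding wavelet_operator_def by (rule C2)
        also have "\<dots> \<le> ennreal C2 * nsum (Y k) (\<lambda>\<alpha>. ennreal R * (ennreal ((norm (?c k \<alpha>))\<^sup>2 / measure M (Q (k + 1) \<alpha>)) * ennreal (wt L (k + 1, \<alpha>) x)))"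
        proof (intro mult_left_mono nn_integral_mono)
          fix \<alpha>
          have "w L (scale (k + 1)) z \<alpha> \<le> R * w L (scale (k + 1)) x \<alpha>"
            unfolding R_def by (rule bump_shift[OF scale_pos L(3) dzx])
          then have "(norm (?c k \<alpha>))\<^sup>2 / measure M (Q (k + 1) \<alpha>) * w L (scale (k + 1)) z \<alpha>
            \<le> (norm (?c k \<alpha>))\<^sup>2 / measure M (Q (k + 1) \<alpha>) * (R * w L (scale (k + 1)) x \<alpha>)"
            by (intro mult_left_mono) auto
          also have "\<dots> = R * ((norm (?c k \<alpha>))\<^sup>2 / measure M (Q (k + 1) \<alpha>) * w L (scale (k + 1)) x \<alpha>)" by (simp only: mult_ac)
          finally have "ennreal ((norm (?c k \<alpha>))\<^sup>2 / measure M (Q (k + 1) \<alpha>) * w L (scale (k + 1)) z \<alpha>) \<le>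
             ennreal (R * ((norm (?c k \<alpha>))\<^sup>2 / measure M (Q (k + 1) \<alpha>) * w L (scale (k + 1)) x \<alpha>))" by (rule ennreal_leI)
          also have "\<dots> = ennreal R * (ennreal ((norm (?c k \<alpha>))\<^sup>2 / measure M (Q (k + 1) \<alpha>)) * ennreal (wt L (k + 1, \<alpha>) x))"
          proof -
            have *: "ennreal (R * (u * v)) = ennreal R * (ennreal u * ennreal v)" if "u \<ge> 0" "v \<ge> 0" for u v
              using R that by (simp add: ennreal_mult)
            show ?thesis unfolding fst_conv snd_conv by (rule *) auto
          qed
          finally show "ennreal ((norm (?c k \<alpha>))\<^sup>2 / measure M (Q (k + 1) \<alpha>) * w L (scale (k + 1)) z \<alpha>) \<le> \<dots>" .
        qed auto
        also have "\<dots> = ennreal C3 * ?T k"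
          using C2(1) R by (subst nn_integral_cmult) (auto simp: C3_def ennreal_mult mult.assoc)
        finally show "ennreal ((norm (wavelet_operator \<X> \<psi> k f z))\<^sup>2) \<le> ennreal C3 * ?T k" .
      qed
      then have "?S x \<le> nsum UNIV (\<lambda>k. ennreal C3 * ?T k)" by (intro nn_integral_mono) auto
      also have "\<dots> = ennreal C3 * nsum UNIV ?T" by (rule nn_integral_cmult) simp
      also have "nsum UNIV ?T = nsum pts (\<lambda>i. ennreal (?b i) * ennreal (wt L i x))"
        by (rule nsum_coeff_weight[symmetric])
      also have "\<dots> = bump_series ?b L x"
        by (simp add: ennreal_mult coeff_weight_nonneg)
      finally show ?thesis .
    qed
    show ?thesis unfolding S W by (intro C1(2) coeff_weight_nonneg Sle)
  qed
  then show ?thesis using C1(1) by blast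
qed

section \<open>Recovering the coefficients from the minima of the wavelet series\<close>

text \<open>The weights of one level reproduce themselves under composition with the same exponent, which is
  what the absorption argument for the coefficients needs.\<close>

lemma nsum_bump_bump:
  assumes L: "L \<ge> 2 * \<omega> + 1"
  shows "\<exists>C>0. \<forall>k x y. nsum (Y k) (\<lambda>\<alpha>. ennreal (w L (scale k) x \<alpha> * w L (scale k) \<alpha> y)) \<le> ennreal (C * w L (scale k) x y)"
proof -
  have L0: "L \<ge> 0" using L \<omega>_pos by simp
  obtain Cp where Cp: "Cp > 0" "\<And>k x. nsum (Y k) (\<lambda>\<alpha>. ennreal (w L (scale k) x \<alpha>)) \<le> ennreal Cp"
    using nsum_new_points_bump[OF L] by blast
  define C where "C = (2 * A\<^sub>0) powr L * (2 * Cp)"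
  have "nsum (Y k) (\<lambda>\<alpha>. ennreal (w L (scale k) x \<alpha> * w L (scale k) \<alpha> y)) \<le> ennreal (C * w L (scale k) x y)" for k x y
  proof -
    let ?w = "w L (scale k)"
    have "nsum (Y k) (\<lambda>\<alpha>. ennreal (?w x \<alpha> * ?w \<alpha> y))
      \<le> nsum (Y k) (\<lambda>\<alpha>. ennreal ((2 * A\<^sub>0) powr L * ?w x y) * (ennreal (?w x \<alpha>) + ennreal (?w y \<alpha>)))"
    proof (intro nn_integral_mono)
      fix \<alpha>
      have "?w x \<alpha> * ?w \<alpha> y \<le> (2 * A\<^sub>0) powr L * (?w x y * (?w x \<alpha> + ?w \<alpha> y))"
        by (intro bump_mult_le L0) simp
      also have "\<dots> = ((2 * A\<^sub>0) powr L * ?w x y) * (?w x \<alpha> + ?w y \<alpha>)" by (simp add: bump_commute[of _ _ \<alpha> y])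
      finally have "ennreal (?w x \<alpha> * ?w \<alpha> y) \<le> ennreal (((2 * A\<^sub>0) powr L * ?w x y) * (?w x \<alpha> + ?w y \<alpha>))"
        by (rule ennreal_leI)
      also have "\<dots> = ennreal ((2 * A\<^sub>0) powr L * ?w x y) * (ennreal (?w x \<alpha>) + ennreal (?w y \<alpha>))"
        by (subst ennreal_mult) auto
      finally show "ennreal (?w x \<alpha> * ?w \<alpha> y) \<le> \<dots>" .
    qed
    also have "\<dots> = ennreal ((2 * A\<^sub>0) powr L * ?w x y) * (nsum (Y k) (\<lambda>\<alpha>. ennreal (?w x \<alpha>)) + nsum (Y k) (\<lambda>\<alpha>. ennreal (?w y \<alpha>)))"
      by (subst nn_integral_cmult, simp, subst nn_integral_add) auto
    also have "\<dots> \<le> ennreal ((2 * A\<^sub>0) powr L * ?w x y) * (ennreal Cp + ennreal Cp)"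
      by (intro mult_left_mono add_mono Cp) auto
    also have "\<dots> = ennreal ((2 * A\<^sub>0) powr L * ?w x y) * ennreal (Cp + Cp)"
      using Cp by (subst ennreal_plus) auto
    also have "\<dots> = ennreal (C * ?w x y)"
      using Cp by (subst ennreal_mult[symmetric]) (auto simp: C_def algebra_simps)
    finally show ?thesis .
  qed
  moreover have "C > 0" using Cp by (auto simp: C_def)
  ultimately show ?thesis by blast
qed

lemma wavelet_L2:
  assumes "\<alpha> \<in> Y k"
  shows "\<psi> k \<alpha> \<in> borel_measurable M" "integrable M (\<lambda>x. (\<psi> k \<alpha> x)\<^sup>2)"
proof -
  have "(k, \<alpha>) \<in> (SIGMA k:UNIV. Y k)" using assms by simp
  then have "(\<lambda>(k, \<alpha>). \<psi> k \<alpha>) (k, \<alpha>) \<in> L2_functions M"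
    using basis unfolding orthonormal_basis_L2_def by blast
  then show "\<psi> k \<alpha> \<in> borel_measurable M" "integrable M (\<lambda>x. (\<psi> k \<alpha> x)\<^sup>2)"
    by (auto simp: L2_functions_def)
qed

lemma wavelet_orthonormal:
  assumes "\<alpha> \<in> Y k" "\<beta> \<in> Y k"
  shows "has_bochner_integral M (\<lambda>x. \<psi> k \<alpha> x * \<psi> k \<beta> x) (if \<alpha> = \<beta> then 1 else 0)"
proof -
  have [measurable]: "\<psi> k \<alpha> \<in> borel_measurable M" "\<psi> k \<beta> \<in> borel_measurable M"
    using assms wavelet_L2 by auto
  have "integrable M (\<lambda>x. \<psi> k \<alpha> x * \<psi> k \<beta> x)"
  proof (rule Bochner_Integration.integrable_bound)
    show "integrable M (\<lambda>x. (\<psi> k \<alpha> x)\<^sup>2 + (\<psi> k \<beta> x)\<^sup>2)"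
      using assms wavelet_L2 by (intro Bochner_Integration.integrable_add) auto
    have "\<bar>a * b\<bar> \<le> a\<^sup>2 + b\<^sup>2" for a b :: real
      using sum_squares_bound[of "\<bar>a\<bar>" "\<bar>b\<bar>"] mult_nonneg_nonneg[OF abs_ge_zero[of a] abs_ge_zero[of b]]
      unfolding abs_mult power2_abs by linarith
    then show "AE x in M. norm (\<psi> k \<alpha> x * \<psi> k \<beta> x) \<le> norm ((\<psi> k \<alpha> x)\<^sup>2 + (\<psi> k \<beta> x)\<^sup>2)" by simp
  qed measurable
  moreover have "(\<integral>x. \<psi> k \<alpha> x * \<psi> k \<beta> x \<partial>M) = (if \<alpha> = \<beta> then 1 else 0)"
  proof -
    have "(k, \<alpha>) \<in> (SIGMA k:UNIV. Y k)" "(k, \<beta>) \<in> (SIGMA k:UNIV. Y k)" using assms by auto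
    then have "(\<integral>x. (\<lambda>(k, \<alpha>). \<psi> k \<alpha>) (k, \<alpha>) x * (\<lambda>(k, \<alpha>). \<psi> k \<alpha>) (k, \<beta>) x \<partial>M) = (if (k, \<alpha>) = (k, \<beta>) then 1 else 0)"
      using basis unfolding orthonormal_basis_L2_def by blast
    then show ?thesis by simp
  qed
  ultimately show ?thesis unfolding has_bochner_integral_iff by (rule conjI)
qed

text \<open>Orthonormality recovers a coefficient from a finite partial sum of the wavelet series of its
  level. Using partial sums keeps the interchange of sum and integral trivial; the rest of the
  series is estimated separately.\<close>

lemma norm_coeff_le_integral:
  fixes c :: "'a \<Rightarrow> 'b::{real_normed_field, banach, second_countable_topology}"
  assumes J: "finite J" "J \<subseteq> Y k" "\<alpha> \<in> J"
  shows "ennreal (norm (c \<alpha>)) \<le> (\<integral>\<^sup>+z. ennreal \<bar>\<psi> k \<alpha> z\<bar> * ennreal (norm (\<Sum>\<beta>\<in>J. c \<beta> * of_real (\<psi> k \<beta> z))) \<partial>M)"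
proof -
  let ?g = "\<lambda>z. \<Sum>\<beta>\<in>J. (\<psi> k \<alpha> z * \<psi> k \<beta> z) *\<^sub>R c \<beta>"
  have "has_bochner_integral M ?g (\<Sum>\<beta>\<in>J. (if \<alpha> = \<beta> then 1 else 0) *\<^sub>R c \<beta>)"
    using J by (intro has_bochner_integral_sum has_bochner_integral_scaleR_left wavelet_orthonormal) auto
  moreover have "(\<Sum>\<beta>\<in>J. (if \<alpha> = \<beta> then 1 else 0) *\<^sub>R c \<beta>) = c \<alpha>"
    using J by (subst sum.remove[of _ \<alpha>]) (auto intro!: sum.neutral split: if_splits)
  ultimately have g: "has_bochner_integral M ?g (c \<alpha>)" by simp
  have "ennreal (norm (c \<alpha>)) = ennreal (norm (\<integral>z. ?g z \<partial>M))" using g by (simp add: has_bochner_integral_integral_eq)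
  also have "\<dots> \<le> (\<integral>\<^sup>+z. ennreal (norm (?g z)) \<partial>M)"
    using g by (intro integral_norm_bound_ennreal) (simp add: has_bochner_integral_iff)
  also have "\<dots> = (\<integral>\<^sup>+z. ennreal \<bar>\<psi> k \<alpha> z\<bar> * ennreal (norm (\<Sum>\<beta>\<in>J. c \<beta> * of_real (\<psi> k \<beta> z))) \<partial>M)"
  proof (intro nn_integral_cong)
    fix z
    have "?g z = \<psi> k \<alpha> z *\<^sub>R (\<Sum>\<beta>\<in>J. c \<beta> * of_real (\<psi> k \<beta> z))"
      unfolding scaleR_sum_right by (intro sum.cong refl) (simp add: scaleR_conv_of_real mult_ac)
    then show "ennreal (norm (?g z)) = ennreal \<bar>\<psi> k \<alpha> z\<bar> * ennreal (norm (\<Sum>\<beta>\<in>J. c \<beta> * of_real (\<psi> k \<beta> z)))"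
      by (simp add: ennreal_mult)
  qed
  finally show ?thesis .
qed

definition synthesis :: "int \<Rightarrow> ('a \<Rightarrow> 'b::{real_normed_field, banach}) \<Rightarrow> 'a \<Rightarrow> 'b" where
  "synthesis k c z = (\<Sum>\<^sub>\<infinity>\<alpha>\<in>Y k. c \<alpha> * of_real (\<psi> k \<alpha> z))"

text \<open>The infimum over the cube is taken of squared norms, as in the square function, and then turned into a
  real number, so that it can enter linear estimates for the coefficients.\<close>

definition cell_min :: "int \<Rightarrow> nat \<Rightarrow> ('a \<Rightarrow> 'b::{real_normed_field, banach}) \<Rightarrow> 'a \<Rightarrow> real" where
  "cell_min k N c \<alpha> = sqrt (enn2real (INF z\<in>Q (k + int N) \<alpha>. ennreal ((norm (synthesis k c z))\<^sup>2)))"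

text \<open>Coefficients normalized so that \<open>amplitude * w L\<close> bounds the corresponding term of the wavelet series
  up to a constant.\<close>

definition amplitude :: "int \<Rightarrow> ('a \<Rightarrow> 'b::real_normed_vector) \<Rightarrow> 'a \<Rightarrow> real" where
  "amplitude k c \<alpha> = norm (c \<alpha>) / sqrt (V (scale k) \<alpha>)"

abbreviation amplitude_sum :: "real \<Rightarrow> int \<Rightarrow> ('a \<Rightarrow> 'b::real_normed_vector) \<Rightarrow> 'a set \<Rightarrow> 'a \<Rightarrow> ennreal" where
  "amplitude_sum L k c I x \<equiv> nsum I (\<lambda>\<alpha>. ennreal (amplitude k c \<alpha> * w L (scale k) x \<alpha>))"

abbreviation cell_min_sum :: "real \<Rightarrow> int \<Rightarrow> nat \<Rightarrow> ('a \<Rightarrow> 'b::{real_normed_field, banach}) \<Rightarrow> 'a \<Rightarrow> ennreal" where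
  "cell_min_sum L k N c x \<equiv> nsum (\<X> (k + int N)) (\<lambda>\<alpha>. ennreal (cell_min k N c \<alpha> * w L (scale k) x \<alpha>))"

lemma amplitude_nonneg [simp]: "0 \<le> amplitude k c \<alpha>"
  by (simp add: amplitude_def)

lemma cell_min_nonneg [simp]: "0 \<le> cell_min k N c \<alpha>"
  by (simp add: cell_min_def)

lemma INF_eq_cell_min:
  assumes "\<alpha> \<in> \<X> (k + int N)"
  shows "(INF z\<in>Q (k + int N) \<alpha>. ennreal ((norm (synthesis k c z))\<^sup>2)) = ennreal ((cell_min k N c \<alpha>)\<^sup>2)"
proof -
  have "Q (k + int N) \<alpha> \<noteq> {}" using cube_measure_pos[OF assms] by auto
  then show ?thesis unfolding cell_min_def by (intro ennreal_sqrt_INF_bound(1)) auto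
qed

text \<open>This makes the wavelet series of level \<open>k\<close> absolutely convergent everywhere. Coefficients of
  polynomial growth have the property for large \<open>L\<close>.\<close>

definition dominated_coeffs :: "real \<Rightarrow> int \<Rightarrow> ('a \<Rightarrow> 'b::real_normed_vector) \<Rightarrow> bool" where
  "dominated_coeffs L k c \<longleftrightarrow> (\<forall>x. amplitude_sum L k c (Y k) x < \<infinity>)"

lemma nsum_norm_terms_le:
  assumes C0: "C0 > 0" and I: "I \<subseteq> Y k"
    and size: "\<And>\<alpha>. \<alpha> \<in> Y k \<Longrightarrow> \<bar>\<psi> k \<alpha> z\<bar> \<le> C0 / sqrt (V (scale k) \<alpha>) * w L (scale k) \<alpha> z"
  shows "nsum I (\<lambda>\<alpha>. ennreal (norm (c \<alpha> * of_real (\<psi> k \<alpha> z) :: 'b::{real_normed_field, banach}))) \<le> ennreal C0 * amplitude_sum L k c I z"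
proof -
  have "nsum I (\<lambda>\<alpha>. ennreal (norm (c \<alpha> * of_real (\<psi> k \<alpha> z)))) \<le> nsum I (\<lambda>\<alpha>. ennreal C0 * ennreal (amplitude k c \<alpha> * w L (scale k) z \<alpha>))"
  proof (intro nn_integral_mono)
    fix \<alpha> assume "\<alpha> \<in> space (count_space I)"
    then have "\<alpha> \<in> Y k" using I by auto
    then have "norm (c \<alpha>) * \<bar>\<psi> k \<alpha> z\<bar> \<le> norm (c \<alpha>) * (C0 / sqrt (V (scale k) \<alpha>) * w L (scale k) \<alpha> z)"
      by (intro mult_left_mono size) auto
    then have "norm (c \<alpha> * of_real (\<psi> k \<alpha> z)) \<le> C0 * (amplitude k c \<alpha> * w L (scale k) z \<alpha>)"
      by (simp add: norm_mult amplitude_def bump_commute[of _ _ z] mult_ac)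
    then have "ennreal (norm (c \<alpha> * of_real (\<psi> k \<alpha> z))) \<le> ennreal (C0 * (amplitude k c \<alpha> * w L (scale k) z \<alpha>))" by (rule ennreal_leI)
    then show "ennreal (norm (c \<alpha> * of_real (\<psi> k \<alpha> z))) \<le> ennreal C0 * ennreal (amplitude k c \<alpha> * w L (scale k) z \<alpha>)"
      using C0 by (simp add: ennreal_mult del: ennreal_mult')
  qed
  also have "\<dots> = ennreal C0 * amplitude_sum L k c I z" by (rule nn_integral_cmult) simp
  finally show ?thesis .
qed

lemma summable_synthesis:
  fixes c :: "'a \<Rightarrow> 'b::{real_normed_field, banach}"
  assumes C0: "C0 > 0" and dom: "dominated_coeffs L k c"
    and size: "\<And>\<alpha>. \<alpha> \<in> Y k \<Longrightarrow> \<bar>\<psi> k \<alpha> z\<bar> \<le> C0 / sqrt (V (scale k) \<alpha>) * w L (scale k) \<alpha> z"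
  shows "(\<lambda>\<alpha>. c \<alpha> * of_real (\<psi> k \<alpha> z)) summable_on Y k"
proof (rule abs_summable_summable[OF norm_summable_of_nsum_finite])
  have "ennreal C0 * amplitude_sum L k c (Y k) z < \<infinity>"
    using dom by (auto simp: dominated_coeffs_def ennreal_mult_less_top)
  then show "nsum (Y k) (\<lambda>\<alpha>. ennreal (norm (c \<alpha> * of_real (\<psi> k \<alpha> z)))) < \<infinity>"
    by (rule le_less_trans[rotated]) (intro nsum_norm_terms_le C0 order_refl size)
qed

text \<open>By the Hoelder estimate for the wavelets, two values of the series on a cube of generation
  \<open>k + N\<close> differ by at most a multiple of \<open>(8 * A\<^sub>0^3 * \<delta>^N) powr \<eta>\<close> times a sum of
  amplitudes with decaying weights; this factor comes from the diameter of the cube.\<close>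

lemma synthesis_le_cell_min:
  assumes C0: "C0 > 0" and reg: "\<And>\<alpha> x y. \<alpha> \<in> Y k \<Longrightarrow> d x y \<le> scale k \<Longrightarrow> \<bar>\<psi> k \<alpha> x - \<psi> k \<alpha> y\<bar> \<le>
       C0 / sqrt (V (scale k) \<alpha>) * (d x y / scale k) powr \<eta> * w L (scale k) \<alpha> x"
    and size: "\<And>\<alpha> x. \<alpha> \<in> Y k \<Longrightarrow> \<bar>\<psi> k \<alpha> x\<bar> \<le> C0 / sqrt (V (scale k) \<alpha>) * w L (scale k) \<alpha> x"
    and N: "8 * A\<^sub>0 ^ 3 * \<delta> ^ N \<le> 1"
    and dom: "dominated_coeffs L k c"
    and z: "z \<in> Q (k + int N) \<alpha>'" "\<alpha>' \<in> \<X> (k + int N)"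
  shows "ennreal (norm (synthesis k c z)) \<le> ennreal (cell_min k N c \<alpha>')
    + ennreal (C0 * (8 * A\<^sub>0 ^ 3 * \<delta> ^ N) powr \<eta>) * amplitude_sum L k c (Y k) z"
proof -
  let ?\<epsilon> = "(8 * A\<^sub>0 ^ 3 * \<delta> ^ N) powr \<eta>"
  let ?h = "\<lambda>z. amplitude_sum L k c (Y k) z"
  define h where "h = enn2real (?h z)"
  have h: "?h z = ennreal h" "h \<ge> 0" using dom by (auto simp: h_def dominated_coeffs_def)
  note summ = summable_synthesis[OF C0 dom size]
  have osc: "norm (synthesis k c z) \<le> norm (synthesis k c z') + C0 * ?\<epsilon> * h" if z': "z' \<in> Q (k + int N) \<alpha>'" for z'
  proof -
    have dz: "d z z' \<le> 8 * A\<^sub>0 ^ 3 * \<delta> ^ N * scale k"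
      using cube_diameter[OF z(2,1) z'] by (simp add: scale_add mult_ac)
    then have dz1: "d z z' \<le> scale k"
      using mult_right_mono[OF N less_imp_le[OF scale_pos[of k]]] by linarith
    have "synthesis k c z - synthesis k c z' = (\<Sum>\<^sub>\<infinity>\<alpha>\<in>Y k. c \<alpha> * of_real (\<psi> k \<alpha> z) - c \<alpha> * of_real (\<psi> k \<alpha> z'))"
      unfolding synthesis_def
      using infsum_add[OF summ[of z] summable_on_uminus[THEN iffD2, OF summ[of z']]] by (simp add: infsum_uminus)
    also have "\<dots> = (\<Sum>\<^sub>\<infinity>\<alpha>\<in>Y k. c \<alpha> * of_real (\<psi> k \<alpha> z - \<psi> k \<alpha> z'))"
      by (simp add: right_diff_distrib)
    finally have "ennreal (norm (synthesis k c z - synthesis k c z')) \<le> nsum (Y k) (\<lambda>\<alpha>. ennreal (norm (c \<alpha> * of_real (\<psi> k \<alpha> z - \<psi> k \<alpha> z'))))"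
      by (simp only: norm_infsum_le_nsum)
    also have "\<dots> \<le> nsum (Y k) (\<lambda>\<alpha>. ennreal (C0 * ?\<epsilon>) * ennreal (amplitude k c \<alpha> * w L (scale k) z \<alpha>))"
    proof (intro nn_integral_mono)
      fix \<alpha> assume "\<alpha> \<in> space (count_space (Y k))"
      then have \<alpha>: "\<alpha> \<in> Y k" by simp
      have "d z z' / scale k \<le> 8 * A\<^sub>0 ^ 3 * \<delta> ^ N" using dz by (simp add: pos_divide_le_eq)
      then have p: "(d z z' / scale k) powr \<eta> \<le> ?\<epsilon>" using \<eta>_pos dist_nonneg by (intro powr_mono2) auto
      have "\<bar>\<psi> k \<alpha> z - \<psi> k \<alpha> z'\<bar> \<le> C0 / sqrt (V (scale k) \<alpha>) * (d z z' / scale k) powr \<eta> * w L (scale k) \<alpha> z"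
        by (rule reg[OF \<alpha> dz1])
      also have "\<dots> \<le> C0 / sqrt (V (scale k) \<alpha>) * ?\<epsilon> * w L (scale k) \<alpha> z"
        using p C0 by (intro mult_right_mono mult_left_mono) auto
      finally have "norm (c \<alpha>) * \<bar>\<psi> k \<alpha> z - \<psi> k \<alpha> z'\<bar> \<le> norm (c \<alpha>) * (C0 / sqrt (V (scale k) \<alpha>) * ?\<epsilon> * w L (scale k) \<alpha> z)"
        by (rule mult_left_mono) simp
      moreover have "norm (c \<alpha> * of_real (\<psi> k \<alpha> z - \<psi> k \<alpha> z')) = norm (c \<alpha>) * \<bar>\<psi> k \<alpha> z - \<psi> k \<alpha> z'\<bar>"
        by (simp only: norm_mult norm_of_real)
      ultimately have "norm (c \<alpha> * of_real (\<psi> k \<alpha> z - \<psi> k \<alpha> z')) \<le> (C0 * ?\<epsilon>) * (amplitude k c \<alpha> * w L (scale k) z \<alpha>)"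
        by (simp add: amplitude_def bump_commute[of _ _ z] mult_ac)
      then have "ennreal (norm (c \<alpha> * of_real (\<psi> k \<alpha> z - \<psi> k \<alpha> z'))) \<le> ennreal ((C0 * ?\<epsilon>) * (amplitude k c \<alpha> * w L (scale k) z \<alpha>))"
        by (rule ennreal_leI)
      also have "\<dots> = ennreal (C0 * ?\<epsilon>) * ennreal (amplitude k c \<alpha> * w L (scale k) z \<alpha>)"
        using C0 by (intro ennreal_mult) auto
      finally show "ennreal (norm (c \<alpha> * of_real (\<psi> k \<alpha> z - \<psi> k \<alpha> z'))) \<le> \<dots>" .
    qed
    also have "\<dots> = ennreal (C0 * ?\<epsilon>) * ?h z" by (rule nn_integral_cmult) simp
    also have "\<dots> = ennreal (C0 * ?\<epsilon> * h)" using h C0 by (simp add: ennreal_mult)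
    finally have "norm (synthesis k c z - synthesis k c z') \<le> C0 * ?\<epsilon> * h"
      using C0 h(2) by (subst (asm) ennreal_le_iff) auto
    then show ?thesis using norm_triangle_sub[of "synthesis k c z" "synthesis k c z'"] by linarith
  qed
  have "norm (synthesis k c z) \<le> cell_min k N c \<alpha>' + C0 * ?\<epsilon> * h"
    unfolding cell_min_def using z(1) osc by (intro ennreal_sqrt_INF_bound(2)) auto
  then have "ennreal (norm (synthesis k c z)) \<le> ennreal (cell_min k N c \<alpha>' + C0 * ?\<epsilon> * h)" by (rule ennreal_leI)
  also have "\<dots> = ennreal (cell_min k N c \<alpha>') + ennreal (C0 * ?\<epsilon> * h)"
    using C0 h(2) by (intro ennreal_plus) auto
  also have "ennreal (C0 * ?\<epsilon> * h) = ennreal (C0 * ?\<epsilon>) * ?h z"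
    unfolding h(1) using C0 h(2) by (intro ennreal_mult) auto
  finally show ?thesis .
qed

lemma partial_synthesis_le:
  assumes J: "finite J" "J \<subseteq> Y k" and C0: "C0 > 0"
    and size: "\<And>\<alpha> x. \<alpha> \<in> Y k \<Longrightarrow> \<bar>\<psi> k \<alpha> x\<bar> \<le> C0 / sqrt (V (scale k) \<alpha>) * w L (scale k) \<alpha> x"
    and dom: "dominated_coeffs L k c"
  shows "ennreal (norm (\<Sum>\<alpha>\<in>J. c \<alpha> * of_real (\<psi> k \<alpha> z))) \<le> ennreal (norm (synthesis k c z))
    + ennreal C0 * amplitude_sum L k c (Y k - J) z"
proof -
  let ?g = "\<lambda>\<alpha>. c \<alpha> * of_real (\<psi> k \<alpha> z)"
  have summ: "?g summable_on Y k" by (rule summable_synthesis[OF C0 dom size])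
  have "synthesis k c z = sum ?g J + infsum ?g (Y k - J)"
    using J summ unfolding synthesis_def
    by (subst infsum_Diff) auto
  then have "norm (sum ?g J) \<le> norm (synthesis k c z) + norm (infsum ?g (Y k - J))"
    by (metis add_diff_cancel_right' norm_triangle_ineq4)
  then have "ennreal (norm (sum ?g J)) \<le> ennreal (norm (synthesis k c z) + norm (infsum ?g (Y k - J)))"
    by (rule ennreal_leI)
  also have "\<dots> = ennreal (norm (synthesis k c z)) + ennreal (norm (infsum ?g (Y k - J)))"
    by (rule ennreal_plus) auto
  also have "ennreal (norm (infsum ?g (Y k - J))) \<le> nsum (Y k - J) (\<lambda>\<alpha>. ennreal (norm (?g \<alpha>)))"
    by (rule norm_infsum_le_nsum)
  also have "\<dots> \<le> ennreal C0 * amplitude_sum L k c (Y k - J) z"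
    by (intro nsum_norm_terms_le C0 size) auto
  finally show ?thesis by (simp add: add_left_mono)
qed

text \<open>Reproduction at one level: insert into \<open>norm_coeff_le_integral\<close> the bound of the series by its cell
  minima, up to the oscillation and the tail of the series. The wavelet at \<open>\<alpha>\<close> is estimated with
  exponent \<open>2 * L\<close> and all other weights with \<open>L\<close>, so that the oscillation term comes back with
  exactly the weights of \<open>dominated_coeffs\<close>; the tail is made smaller than any \<open>e\<close>. Neither
  constant depends on \<open>N\<close>.\<close>

lemma amplitude_le_cell_min:
  assumes L: "L \<ge> 2 * \<omega> + 1"
  shows "\<exists>Ca>0. \<exists>Cb>0. \<forall>k N (c :: 'a \<Rightarrow> 'b::{real_normed_field, banach, second_countable_topology}) \<alpha>.
    8 * A\<^sub>0 ^ 3 * \<delta> ^ N \<le> 1 \<longrightarrow> dominated_coeffs L k c \<longrightarrow> \<alpha> \<in> Y k \<longrightarrow>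
    ennreal (amplitude k c \<alpha>)
      \<le> ennreal Ca * cell_min_sum L k N c \<alpha>
      + ennreal (Cb * (8 * A\<^sub>0 ^ 3 * \<delta> ^ N) powr \<eta>) * amplitude_sum L k c (Y k) \<alpha>"
proof -
  have L0: "L \<ge> 0" "2 * L \<ge> 0" "L \<ge> \<omega> + 1" "L \<ge> \<omega>" using L \<omega>_pos by auto
  obtain C0 where C0: "C0 > 0"
    and size2: "\<And>k \<alpha> x. \<alpha> \<in> Y k \<Longrightarrow> \<bar>\<psi> k \<alpha> x\<bar> \<le> C0 / sqrt (V (scale k) \<alpha>) * w (2 * L) (scale k) \<alpha> x"
    and reg2: "\<And>k \<alpha> x y. \<alpha> \<in> Y k \<Longrightarrow> d x y \<le> scale k \<Longrightarrow> \<bar>\<psi> k \<alpha> x - \<psi> k \<alpha> y\<bar> \<le>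
       C0 / sqrt (V (scale k) \<alpha>) * (d x y / scale k) powr \<eta> * w (2 * L) (scale k) \<alpha> x"
    using wavelet_bump_bounds[OF L0(2)] by blast
  have dec: "w (2 * L) (scale k) x y \<le> w L (scale k) x y" for k x y
    using L0 by (intro bump_antimono) auto
  have size: "\<bar>\<psi> k \<alpha> x\<bar> \<le> C0 / sqrt (V (scale k) \<alpha>) * w L (scale k) \<alpha> x" if "\<alpha> \<in> Y k" for k \<alpha> x
    using C0 by (intro order_trans[OF size2[OF that] mult_left_mono] dec) auto
  have reg: "\<bar>\<psi> k \<alpha> x - \<psi> k \<alpha> y\<bar> \<le> C0 / sqrt (V (scale k) \<alpha>) * (d x y / scale k) powr \<eta> * w L (scale k) \<alpha> x"
    if "\<alpha> \<in> Y k" "d x y \<le> scale k" for k \<alpha> x y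
    using C0 by (intro order_trans[OF reg2[OF that] mult_left_mono] dec) auto
  define C1 where "C1 = (A\<^sub>0 * (1 + 4 * A\<^sub>0\<^sup>2)) powr (2 * L) * (K * (4 * A\<^sub>0\<^sup>2) powr \<omega>) * (K * A\<^sub>0 powr \<omega>)"
  define C2 where "C2 = A\<^sub>0 powr L * (2 powr (\<omega> + 2) * K)"
  have C1: "C1 > 0" unfolding C1_def using A\<^sub>0_sq by auto
  have C2: "C2 > 0" unfolding C2_def by auto
  have "ennreal (amplitude k c \<alpha>)
      \<le> ennreal (C0 * C1) * cell_min_sum L k N c \<alpha>
      + ennreal (C0 * C0 * C2 * (8 * A\<^sub>0 ^ 3 * \<delta> ^ N) powr \<eta>) * amplitude_sum L k c (Y k) \<alpha>"
    (is "_ \<le> ?rhs")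
    if N: "8 * A\<^sub>0 ^ 3 * \<delta> ^ N \<le> 1" and dom: "dominated_coeffs L k c" and \<alpha>: "\<alpha> \<in> Y k"
    for k N \<alpha> and c :: "'a \<Rightarrow> 'b"
  proof (rule ennreal_le_of_all_real_eps)
    show "0 \<le> C0 * C0 * C2" using C0 C2 by simp
    fix e :: real assume e: "e > 0"
    let ?r = "scale k" and ?\<epsilon> = "(8 * A\<^sub>0 ^ 3 * \<delta> ^ N) powr \<eta>"
    let ?h = "\<lambda>I x. amplitude_sum L k c I x"
    let ?A = "cell_min_sum L k N c \<alpha>"
    let ?G = "\<lambda>z. nsum (\<X> (k + int N)) (\<lambda>\<alpha>'. ennreal (cell_min k N c \<alpha>') * indicator (Q (k + int N) \<alpha>') z)"
    define s where "s = sqrt (V ?r \<alpha>)"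
    have s: "s > 0" "V ?r \<alpha> = s * s" using V_pos[of ?r \<alpha>] by (auto simp: s_def)
    have "?h (Y k) \<alpha> < \<infinity>" using dom by (simp add: dominated_coeffs_def)
    then obtain J where J: "finite J" "J \<subseteq> Y k" "\<alpha> \<in> J" "?h (Y k - J) \<alpha> \<le> ennreal e"
      using nsum_small_tail[OF countable_new_points _ \<alpha> e] by blast
    let ?W = "\<lambda>z. ennreal (w (2 * L) ?r \<alpha> z)"
    have hm [measurable]: "(\<lambda>z. ?h I z) \<in> borel_measurable M" if "I \<subseteq> Y k" for I
      using countable_subset[OF that countable_new_points]
      by (intro borel_measurable_nsum) (measurable)
    have [measurable]: "?G \<in> borel_measurable M"
      by (intro borel_measurable_nsum countable_points borel_measurable_times_ennreal borel_measurable_const borel_measurable_indicator cube_measurable)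
    have hI: "(\<integral>\<^sup>+z. ?W z * ?h I z \<partial>M) \<le> ennreal (C2 * (s * s)) * ?h I \<alpha>" if I: "I \<subseteq> Y k" for I
    proof -
      have "(\<integral>\<^sup>+z. ?W z * ?h I z \<partial>M) = (\<integral>\<^sup>+z. nsum I (\<lambda>\<beta>. ?W z * ennreal (amplitude k c \<beta> * w L ?r z \<beta>)) \<partial>M)"
        by (intro nn_integral_cong nn_integral_cmult[symmetric]) simp
      also have "\<dots> = nsum I (\<lambda>\<beta>. \<integral>\<^sup>+z. ?W z * ennreal (amplitude k c \<beta> * w L ?r z \<beta>) \<partial>M)"
      proof (intro nn_integral_count_space_nn_integral)
        show "countable I" by (rule countable_subset[OF I countable_new_points])
        show "(\<lambda>z. ?W z * ennreal (amplitude k c \<beta> * w L ?r z \<beta>)) \<in> borel_measurable M" for \<beta>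
          by measurable
      qed
      also have "\<dots> \<le> nsum I (\<lambda>\<beta>. ennreal (C2 * (s * s)) * ennreal (amplitude k c \<beta> * w L ?r \<alpha> \<beta>))"
      proof (intro nn_integral_mono)
        fix \<beta>
        have "(\<integral>\<^sup>+z. ?W z * ennreal (amplitude k c \<beta> * w L ?r z \<beta>) \<partial>M)
            = (\<integral>\<^sup>+z. ennreal (amplitude k c \<beta>) * ennreal (w (2 * L) ?r \<alpha> z * w L ?r \<beta> z) \<partial>M)"
          by (intro nn_integral_cong) (simp add: ennreal_mult bump_commute[of _ _ _ \<beta>] mult_ac)
        also have "\<dots> = ennreal (amplitude k c \<beta>) * (\<integral>\<^sup>+z. ennreal (w (2 * L) ?r \<alpha> z * w L ?r \<beta> z) \<partial>M)"
          by (rule nn_integral_cmult) measurable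
        also have "\<dots> \<le> ennreal (amplitude k c \<beta>) * ennreal (C2 * V ?r \<alpha> * w L ?r \<alpha> \<beta>)"
          unfolding C2_def by (intro mult_left_mono nn_integral_bump_bump L0) auto
        also have "\<dots> = ennreal (C2 * (s * s)) * ennreal (amplitude k c \<beta> * w L ?r \<alpha> \<beta>)"
          using C2 s by (subst (1 2) ennreal_mult[symmetric]) (auto simp: mult_ac)
        finally show "(\<integral>\<^sup>+z. ?W z * ennreal (amplitude k c \<beta> * w L ?r z \<beta>) \<partial>M) \<le> \<dots>" .
      qed
      also have "\<dots> = ennreal (C2 * (s * s)) * ?h I \<alpha>" by (rule nn_integral_cmult) simp
      finally show ?thesis .
    qed
    have GI: "(\<integral>\<^sup>+z. ?W z * ?G z \<partial>M) \<le> ennreal (C1 * (s * s)) * ?A"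
    proof -
      have "(\<integral>\<^sup>+z. ?W z * ?G z \<partial>M) = (\<integral>\<^sup>+z. nsum (\<X> (k + int N)) (\<lambda>\<alpha>'. ?W z * (ennreal (cell_min k N c \<alpha>') * indicator (Q (k + int N) \<alpha>') z)) \<partial>M)"
        by (intro nn_integral_cong nn_integral_cmult[symmetric]) simp
      also have "\<dots> = nsum (\<X> (k + int N)) (\<lambda>\<alpha>'. \<integral>\<^sup>+z. ?W z * (ennreal (cell_min k N c \<alpha>') * indicator (Q (k + int N) \<alpha>') z) \<partial>M)"
      proof (intro nn_integral_count_space_nn_integral countable_points)
        fix \<alpha>' assume "\<alpha>' \<in> \<X> (k + int N)"
        then have [measurable]: "Q (k + int N) \<alpha>' \<in> sets M" by (rule cube_measurable)
        show "(\<lambda>z. ?W z * (ennreal (cell_min k N c \<alpha>') * indicator (Q (k + int N) \<alpha>') z)) \<in> borel_measurable M" by measurable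
      qed
      also have "\<dots> \<le> nsum (\<X> (k + int N)) (\<lambda>\<alpha>'. ennreal (C1 * (s * s)) * ennreal (cell_min k N c \<alpha>' * w L ?r \<alpha> \<alpha>'))"
      proof (intro nn_integral_mono)
        fix \<alpha>' assume "\<alpha>' \<in> space (count_space (\<X> (k + int N)))"
        then have a: "\<alpha>' \<in> \<X> (k + int N)" by simp
        then have [measurable]: "Q (k + int N) \<alpha>' \<in> sets M" by (rule cube_measurable)
        have "(\<integral>\<^sup>+z. ?W z * (ennreal (cell_min k N c \<alpha>') * indicator (Q (k + int N) \<alpha>') z) \<partial>M)
            = (\<integral>\<^sup>+z. ennreal (cell_min k N c \<alpha>') * (?W z * indicator (Q (k + int N) \<alpha>') z) \<partial>M)"
          by (intro nn_integral_cong) (simp add: mult_ac)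
        also have "\<dots> = ennreal (cell_min k N c \<alpha>') * (\<integral>\<^sup>+z. ?W z * indicator (Q (k + int N) \<alpha>') z \<partial>M)"
          by (rule nn_integral_cmult) measurable
        also have "\<dots> \<le> ennreal (cell_min k N c \<alpha>') * ennreal (C1 * V ?r \<alpha> * w L ?r \<alpha> \<alpha>')"
          unfolding C1_def by (intro mult_left_mono nn_integral_bump_cube L0 a) auto
        also have "\<dots> = ennreal (C1 * (s * s)) * ennreal (cell_min k N c \<alpha>' * w L ?r \<alpha> \<alpha>')"
          using C1 s by (subst (1 2) ennreal_mult[symmetric]) (auto simp: mult_ac)
        finally show "(\<integral>\<^sup>+z. ?W z * (ennreal (cell_min k N c \<alpha>') * indicator (Q (k + int N) \<alpha>') z) \<partial>M) \<le> \<dots>" .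
      qed
      also have "\<dots> = ennreal (C1 * (s * s)) * ?A" by (rule nn_integral_cmult) simp
      finally show ?thesis .
    qed
    have "ennreal (norm (c \<alpha>)) \<le> (\<integral>\<^sup>+z. ennreal \<bar>\<psi> k \<alpha> z\<bar> * ennreal (norm (\<Sum>\<beta>\<in>J. c \<beta> * of_real (\<psi> k \<beta> z))) \<partial>M)"
      by (rule norm_coeff_le_integral[OF J(1,2,3)])
    also have "\<dots> \<le> (\<integral>\<^sup>+z. ennreal (C0 / s) * (?W z * ?G z + ennreal (C0 * ?\<epsilon>) * (?W z * ?h (Y k) z) + ennreal C0 * (?W z * ?h (Y k - J) z)) \<partial>M)"
    proof (intro nn_integral_mono)
      fix z
      obtain \<alpha>' where a: "\<alpha>' \<in> \<X> (k + int N)" "z \<in> Q (k + int N) \<alpha>'" using cube_cover[of "k + int N"] by blast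
      have a1: "ennreal (norm (\<Sum>\<beta>\<in>J. c \<beta> * of_real (\<psi> k \<beta> z))) \<le> ennreal (norm (synthesis k c z)) + ennreal C0 * ?h (Y k - J) z"
        by (rule partial_synthesis_le[OF J(1,2) C0 size dom])
      have a2: "ennreal (norm (synthesis k c z)) \<le> ennreal (cell_min k N c \<alpha>') + ennreal (C0 * ?\<epsilon>) * ?h (Y k) z"
        by (rule synthesis_le_cell_min[OF C0 reg size N dom a(2,1)])
      have a3: "ennreal (cell_min k N c \<alpha>') \<le> ?G z"
        by (rule nsum_cells_ge[OF a])
      have "ennreal (norm (\<Sum>\<beta>\<in>J. c \<beta> * of_real (\<psi> k \<beta> z))) \<le> ?G z + ennreal (C0 * ?\<epsilon>) * ?h (Y k) z + ennreal C0 * ?h (Y k - J) z"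
        by (rule order_trans[OF a1 add_right_mono[OF order_trans[OF a2 add_right_mono[OF a3]]]])
      moreover have "ennreal \<bar>\<psi> k \<alpha> z\<bar> \<le> ennreal (C0 / s) * ?W z"
        using size2[OF \<alpha>, of z] C0 s(1) unfolding s_def
        by (subst ennreal_mult[symmetric]) (auto intro!: ennreal_leI)
      ultimately have "ennreal \<bar>\<psi> k \<alpha> z\<bar> * ennreal (norm (\<Sum>\<beta>\<in>J. c \<beta> * of_real (\<psi> k \<beta> z)))
          \<le> (ennreal (C0 / s) * ?W z) * (?G z + ennreal (C0 * ?\<epsilon>) * ?h (Y k) z + ennreal C0 * ?h (Y k - J) z)"
        by (intro mult_mono) auto
      also have "\<dots> = ennreal (C0 / s) * (?W z * ?G z + ennreal (C0 * ?\<epsilon>) * (?W z * ?h (Y k) z) + ennreal C0 * (?W z * ?h (Y k - J) z))"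
        by (simp only: distrib_left mult_ac)
      finally show "ennreal \<bar>\<psi> k \<alpha> z\<bar> * ennreal (norm (\<Sum>\<beta>\<in>J. c \<beta> * of_real (\<psi> k \<beta> z))) \<le> \<dots>" .
    qed
    also have "\<dots> = ennreal (C0 / s) * ((\<integral>\<^sup>+z. ?W z * ?G z \<partial>M) + ennreal (C0 * ?\<epsilon>) * (\<integral>\<^sup>+z. ?W z * ?h (Y k) z \<partial>M)
        + ennreal C0 * (\<integral>\<^sup>+z. ?W z * ?h (Y k - J) z \<partial>M))"
    proof -
      have [measurable]: "?h (Y k) \<in> borel_measurable M" "?h (Y k - J) \<in> borel_measurable M"
        by (intro hm; blast)+
      show ?thesis
        by (subst nn_integral_cmult, measurable, subst nn_integral_add, measurable, subst nn_integral_add, measurable)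
          (simp add: nn_integral_cmult)
    qed
    also have "\<dots> \<le> ennreal (C0 / s) * (ennreal (C1 * (s * s)) * ?A + ennreal (C0 * ?\<epsilon>) * (ennreal (C2 * (s * s)) * ?h (Y k) \<alpha>)
        + ennreal C0 * (ennreal (C2 * (s * s)) * ennreal e))"
      by (intro mult_left_mono add_mono GI order_trans[OF hI mult_left_mono[OF J(4)]] hI) auto
    finally have "ennreal (1 / s) * ennreal (norm (c \<alpha>)) \<le> ennreal (1 / s) * (ennreal (C0 / s) * (ennreal (C1 * (s * s)) * ?A + ennreal (C0 * ?\<epsilon>) * (ennreal (C2 * (s * s)) * ?h (Y k) \<alpha>)
        + ennreal C0 * (ennreal (C2 * (s * s)) * ennreal e)))"
      by (intro mult_left_mono) auto
    also have "ennreal (1 / s) * ennreal (norm (c \<alpha>)) = ennreal (amplitude k c \<alpha>)"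
      using s(1) unfolding amplitude_def s_def by (subst ennreal_mult[symmetric]) auto
    also have "ennreal (1 / s) * (ennreal (C0 / s) * (ennreal (C1 * (s * s)) * ?A + ennreal (C0 * ?\<epsilon>) * (ennreal (C2 * (s * s)) * ?h (Y k) \<alpha>)
        + ennreal C0 * (ennreal (C2 * (s * s)) * ennreal e)))
      = ennreal (1 / s * (C0 / s) * (C1 * (s * s))) * ?A + ennreal (1 / s * (C0 / s) * (C0 * ?\<epsilon>) * (C2 * (s * s))) * ?h (Y k) \<alpha>
        + ennreal (1 / s * (C0 / s) * C0 * (C2 * (s * s))) * ennreal e"
    proof -
      have m3: "ennreal a * (ennreal b * (ennreal u * T)) = ennreal (a * b * u) * T" if "a \<ge> 0" "b \<ge> 0" "u \<ge> 0" for a b u T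
        using that by (simp add: ennreal_mult mult.assoc)
      have m4: "ennreal a * (ennreal b * (ennreal u * (ennreal v * T))) = ennreal (a * b * u * v) * T"
        if "a \<ge> 0" "b \<ge> 0" "u \<ge> 0" "v \<ge> 0" for a b u v T
        using that by (simp add: ennreal_mult mult.assoc)
      have nn: "1 / s \<ge> 0" "C0 / s \<ge> 0" "C1 * (s * s) \<ge> 0" "C0 * ?\<epsilon> \<ge> 0" "C2 * (s * s) \<ge> 0" "C0 \<ge> 0"
        using C0 C1 C2 s(1) by auto
      show ?thesis
        unfolding distrib_left m3[OF nn(1-3)] m4[OF nn(1,2,4,5)] m4[OF nn(1,2,6,5)] ..
    qed
    also have "\<dots> = ?rhs + ennreal (C0 * C0 * C2) * ennreal e"
    proof -
      have "1 / s * (C0 / s) * (C1 * (s * s)) = C0 * C1" "1 / s * (C0 / s) * (C0 * ?\<epsilon>) * (C2 * (s * s)) = C0 * C0 * C2 * ?\<epsilon>"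
        "1 / s * (C0 / s) * C0 * (C2 * (s * s)) = C0 * C0 * C2" using s(1) by auto
      then show ?thesis by (simp only:)
    qed
    finally show "ennreal (amplitude k c \<alpha>) \<le> ?rhs + ennreal (C0 * C0 * C2) * ennreal e" .
  qed
  moreover have "C0 * C1 > 0" "C0 * C0 * C2 > 0" using C0 C1 C2 by auto
  ultimately show ?thesis by blast
qed

lemma nsum_bump_superposition:
  assumes I: "countable I" and u: "\<And>q. u q \<ge> 0" and C: "C > 0"
    and conv: "\<And>y. nsum (Y k) (\<lambda>\<alpha>. ennreal (w L (scale k) x \<alpha> * w L (scale k) \<alpha> y)) \<le> ennreal (C * w L (scale k) x y)"
  shows "nsum (Y k) (\<lambda>\<alpha>. ennreal (w L (scale k) x \<alpha>) * nsum I (\<lambda>q. ennreal (u q * w L (scale k) \<alpha> q)))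
    \<le> ennreal C * nsum I (\<lambda>q. ennreal (u q * w L (scale k) x q))"
proof -
  let ?w = "w L (scale k)"
  have "nsum (Y k) (\<lambda>\<alpha>. ennreal (?w x \<alpha>) * nsum I (\<lambda>q. ennreal (u q * ?w \<alpha> q)))
      = nsum (Y k) (\<lambda>\<alpha>. nsum I (\<lambda>q. ennreal (u q) * ennreal (?w x \<alpha> * ?w \<alpha> q)))"
    using u by (intro nn_integral_cong) (simp add: nn_integral_cmult[symmetric] ennreal_mult mult_ac)
  also have "\<dots> = nsum I (\<lambda>q. nsum (Y k) (\<lambda>\<alpha>. ennreal (u q) * ennreal (?w x \<alpha> * ?w \<alpha> q)))"
    by (intro nn_integral_count_space_nn_integral I) simp
  also have "\<dots> \<le> nsum I (\<lambda>q. ennreal C * ennreal (u q * ?w x q))"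
  proof (intro nn_integral_mono)
    fix q
    have "nsum (Y k) (\<lambda>\<alpha>. ennreal (u q) * ennreal (?w x \<alpha> * ?w \<alpha> q)) = ennreal (u q) * nsum (Y k) (\<lambda>\<alpha>. ennreal (?w x \<alpha> * ?w \<alpha> q))"
      by (rule nn_integral_cmult) simp
    also have "\<dots> \<le> ennreal (u q) * ennreal (C * ?w x q)" by (intro mult_left_mono conv) auto
    also have "\<dots> = ennreal C * ennreal (u q * ?w x q)"
      using u C by (subst (1 2) ennreal_mult[symmetric]) (auto simp: mult_ac)
    finally show "nsum (Y k) (\<lambda>\<alpha>. ennreal (u q) * ennreal (?w x \<alpha> * ?w \<alpha> q)) \<le> \<dots>" .
  qed
  also have "\<dots> = ennreal C * nsum I (\<lambda>q. ennreal (u q * ?w x q))" by (rule nn_integral_cmult) simp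
  finally show ?thesis .
qed

text \<open>Let \<open>h x\<close> be the weighted sum of all amplitudes of the level. Summing the previous lemma against
  the weights gives \<open>h \<le> Cc * Ca * A + Cb * Cc * \<epsilon> * h\<close>, where \<open>A\<close> is the weighted sum
  of cell minima. Since \<open>h\<close> is finite, the last term is absorbed when \<open>N\<close> is large. Working at a fixed
  level and point makes the absorption possible without knowing that any norm of \<open>f\<close> is
  finite.\<close>

lemma amplitude_le_cell_min_sum:
  assumes L: "L \<ge> 2 * \<omega> + 1"
  shows "\<exists>N0. \<exists>C>0. \<forall>N\<ge>N0. \<forall>k (c :: 'a \<Rightarrow> 'b::{real_normed_field, banach, second_countable_topology}) \<alpha>.
    dominated_coeffs L k c \<longrightarrow> \<alpha> \<in> Y k \<longrightarrow>
    ennreal (amplitude k c \<alpha>)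
      \<le> ennreal C * cell_min_sum L k N c \<alpha>"
proof -
  obtain Ca Cb where C: "Ca > 0" "Cb > 0" and main: "\<And>k N (c :: 'a \<Rightarrow> 'b) \<alpha>.
    8 * A\<^sub>0 ^ 3 * \<delta> ^ N \<le> 1 \<Longrightarrow> dominated_coeffs L k c \<Longrightarrow> \<alpha> \<in> Y k \<Longrightarrow>
    ennreal (amplitude k c \<alpha>)
      \<le> ennreal Ca * cell_min_sum L k N c \<alpha>
      + ennreal (Cb * (8 * A\<^sub>0 ^ 3 * \<delta> ^ N) powr \<eta>) * amplitude_sum L k c (Y k) \<alpha>"
    using amplitude_le_cell_min[OF L, where 'b = 'b] by blast
  obtain Cc where Cc: "Cc > 0" "\<And>k x y. nsum (Y k) (\<lambda>\<alpha>. ennreal (w L (scale k) x \<alpha> * w L (scale k) \<alpha> y)) \<le> ennreal (Cc * w L (scale k) x y)"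
    using nsum_bump_bump[OF L] by blast
  \<comment> \<open>chosen so that \<open>8 * A\<^sub>0^3 * \<delta>^N \<le> \<tau>\<close> makes the absorbed coefficient at most \<open>1/2\<close>\<close>
  define \<tau> where "\<tau> = min 1 ((1 / (2 * Cb * Cc)) powr (1 / \<eta>))"
  have \<tau>: "\<tau> > 0" "\<tau> \<le> 1" using C Cc(1) by (auto simp: \<tau>_def)
  have \<tau>\<eta>: "Cb * Cc * \<tau> powr \<eta> \<le> 1/2"
  proof -
    have "\<tau> powr \<eta> \<le> ((1 / (2 * Cb * Cc)) powr (1 / \<eta>)) powr \<eta>"
      using \<tau> \<eta>_pos by (intro powr_mono2) (auto simp: \<tau>_def)
    also have "\<dots> = 1 / (2 * Cb * Cc)" using C Cc(1) \<eta>_pos by (simp add: powr_powr)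
    finally have "Cb * Cc * \<tau> powr \<eta> \<le> Cb * Cc * (1 / (2 * Cb * Cc))"
      using C Cc(1) by (intro mult_left_mono) auto
    then show ?thesis using C Cc(1) by simp
  qed
  obtain N0 where N0: "\<delta> ^ N0 < \<tau> / (8 * A\<^sub>0 ^ 3)"
    using real_arch_pow_inv[of "\<tau> / (8 * A\<^sub>0 ^ 3)" \<delta>] \<tau> \<delta>_less_1 by auto
  have "ennreal (amplitude k c \<alpha>)
      \<le> ennreal (2 * (Cc * Ca)) * cell_min_sum L k N c \<alpha>"
    if N: "N \<ge> N0" and dom: "dominated_coeffs L k c" and \<alpha>: "\<alpha> \<in> Y k" for N k and c :: "'a \<Rightarrow> 'b" and \<alpha>
  proof -
    let ?w = "w L (scale k)"
    let ?\<epsilon> = "8 * A\<^sub>0 ^ 3 * \<delta> ^ N"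
    let ?h = "\<lambda>x. nsum (Y k) (\<lambda>\<beta>. ennreal (amplitude k c \<beta> * ?w x \<beta>))"
    let ?A = "\<lambda>x. cell_min_sum L k N c x"
    have "\<delta> ^ N \<le> \<delta> ^ N0" using \<delta>_less_1 N by (intro power_decreasing) auto
    then have "?\<epsilon> \<le> 8 * A\<^sub>0 ^ 3 * \<delta> ^ N0" by (intro mult_left_mono) auto
    also have "\<dots> \<le> \<tau>" using N0 by (simp add: field_simps)
    finally have \<epsilon>: "?\<epsilon> \<le> \<tau>" .
    have "?\<epsilon> powr \<eta> \<le> \<tau> powr \<eta>" using \<epsilon> \<eta>_pos by (intro powr_mono2) auto
    then have "Cb * Cc * ?\<epsilon> powr \<eta> \<le> Cb * Cc * \<tau> powr \<eta>" using C Cc(1) by (intro mult_left_mono) auto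
    then have half: "Cb * ?\<epsilon> powr \<eta> * Cc \<le> 1/2" using \<tau>\<eta> by (simp add: mult_ac)
    have "?h \<alpha> \<le> nsum (Y k) (\<lambda>\<beta>. ennreal Ca * (ennreal (?w \<alpha> \<beta>) * ?A \<beta>) + ennreal (Cb * ?\<epsilon> powr \<eta>) * (ennreal (?w \<alpha> \<beta>) * ?h \<beta>))"
    proof (intro nn_integral_mono)
      fix \<beta> assume "\<beta> \<in> space (count_space (Y k))"
      then have \<beta>: "\<beta> \<in> Y k" by simp
      have "ennreal (amplitude k c \<beta> * ?w \<alpha> \<beta>) = ennreal (?w \<alpha> \<beta>) * ennreal (amplitude k c \<beta>)"
        by (simp add: ennreal_mult mult.commute)
      also have "\<dots> \<le> ennreal (?w \<alpha> \<beta>) * (ennreal Ca * ?A \<beta> + ennreal (Cb * ?\<epsilon> powr \<eta>) * ?h \<beta>)"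
        using \<epsilon> \<tau> by (intro mult_left_mono main \<beta> dom) auto
      also have "\<dots> = ennreal Ca * (ennreal (?w \<alpha> \<beta>) * ?A \<beta>) + ennreal (Cb * ?\<epsilon> powr \<eta>) * (ennreal (?w \<alpha> \<beta>) * ?h \<beta>)"
        by (simp only: distrib_left mult.left_commute)
      finally show "ennreal (amplitude k c \<beta> * ?w \<alpha> \<beta>) \<le> \<dots>" .
    qed
    also have "\<dots> = ennreal Ca * nsum (Y k) (\<lambda>\<beta>. ennreal (?w \<alpha> \<beta>) * ?A \<beta>) + ennreal (Cb * ?\<epsilon> powr \<eta>) * nsum (Y k) (\<lambda>\<beta>. ennreal (?w \<alpha> \<beta>) * ?h \<beta>)"
      by (subst nn_integral_add, simp, simp) (simp only: nn_integral_cmult borel_measurable_count_space)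
    also have "\<dots> \<le> ennreal Ca * (ennreal Cc * ?A \<alpha>) + ennreal (Cb * ?\<epsilon> powr \<eta>) * (ennreal Cc * ?h \<alpha>)"
      by (intro add_mono mult_left_mono nsum_bump_superposition Cc countable_points countable_new_points) auto
    also have "\<dots> = ennreal (Cb * ?\<epsilon> powr \<eta> * Cc) * ?h \<alpha> + ennreal (Cc * Ca) * ?A \<alpha>"
      using C Cc(1) by (simp add: ennreal_mult mult_ac add_ac)
    also have "\<dots> \<le> ennreal (1/2) * ?h \<alpha> + ennreal (Cc * Ca) * ?A \<alpha>"
      by (intro add_right_mono mult_right_mono ennreal_leI half) auto
    finally have "?h \<alpha> \<le> 2 * (ennreal (Cc * Ca) * ?A \<alpha>)"
      using dom by (intro ennreal_absorb_half) (auto simp: dominated_coeffs_def)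
    also have "\<dots> = ennreal (2 * (Cc * Ca)) * ?A \<alpha>"
      using C Cc(1) by (subst (2) ennreal_mult) (auto simp: mult.assoc)
    finally have "?h \<alpha> \<le> ennreal (2 * (Cc * Ca)) * ?A \<alpha>" .
    moreover have "ennreal (amplitude k c \<alpha>) \<le> ?h \<alpha>"
      using sum_le_nsum[of "{\<alpha>}" "Y k" "\<lambda>\<beta>. ennreal (amplitude k c \<beta> * ?w \<alpha> \<beta>)"] \<alpha> by simp
    ultimately show ?thesis by (rule order_trans[rotated])
  qed
  moreover have "2 * (Cc * Ca) > 0" using C Cc(1) by simp
  ultimately show ?thesis by blast
qed

lemma V_le_new_cube:
  assumes "\<alpha> \<in> Y k"
  shows "V (scale k) \<alpha> \<le> K * (1 / \<delta>) powr \<omega> * \<kappa> * measure M (Q (k + 1) \<alpha>)"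
proof -
  have "V (scale k) \<alpha> = V (1 / \<delta> * scale (k + 1)) \<alpha>" by (simp add: scale_Suc)
  also have "\<dots> \<le> K * (1 / \<delta>) powr \<omega> * V (scale (k + 1)) \<alpha>"
    using \<delta>_less_1 by (intro growth) auto
  also have "\<dots> \<le> K * (1 / \<delta>) powr \<omega> * (\<kappa> * measure M (Q (k + 1) \<alpha>))"
    using assms new_points_subset measure_cube_ge[of \<alpha> "k + 1"] by (intro mult_left_mono) (auto simp: \<kappa>_def)
  finally show ?thesis by (simp add: mult.assoc)
qed

lemma inf_square_function_eq:
  fixes f :: "('a \<Rightarrow> 'b) \<Rightarrow> 'b::{real_normed_field, banach}"
  shows "inf_square_function \<X> Q \<psi> N f x = ennreal_powr (nsum pts (\<lambda>i.
    ennreal ((cell_min (fst i - int N) N (wavelet_coeff \<psi> f (fst i - int N)) (snd i))\<^sup>2) * indicator (cell i) x)) (1/2)"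
proof -
  let ?b = "\<lambda>k \<alpha>. ennreal ((cell_min (k - int N) N (wavelet_coeff \<psi> f (k - int N)) \<alpha>)\<^sup>2) * indicator (Q k \<alpha>) x"
  have "(\<Sum>\<^sub>\<infinity>k. \<Sum>\<^sub>\<infinity>\<alpha>\<in>\<X> (k + int N).
        (INF z\<in>Q (k + int N) \<alpha>. ennreal ((norm (wavelet_operator \<X> \<psi> k f z))\<^sup>2)) * indicator (Q (k + int N) \<alpha>) x)
    = nsum UNIV (\<lambda>k. nsum (\<X> (k + int N)) (\<lambda>\<alpha>.
        (INF z\<in>Q (k + int N) \<alpha>. ennreal ((norm (wavelet_operator \<X> \<psi> k f z))\<^sup>2)) * indicator (Q (k + int N) \<alpha>) x))"
    by (simp add: infsum_ennreal_eq_nsum countable_points)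
  also have "\<dots> = nsum UNIV (\<lambda>k. nsum (\<X> (k + int N)) (?b (k + int N)))"
  proof (intro nn_integral_cong arg_cong2[where f = times] refl)
    fix k \<alpha> assume "\<alpha> \<in> space (count_space (\<X> (k + int N)))"
    then have "\<alpha> \<in> \<X> (k + int N)" by simp
    from INF_eq_cell_min[OF this, of "wavelet_coeff \<psi> f k"]
    show "(INF z\<in>Q (k + int N) \<alpha>. ennreal ((norm (wavelet_operator \<X> \<psi> k f z))\<^sup>2))
      = ennreal ((cell_min (k + int N - int N) N (wavelet_coeff \<psi> f (k + int N - int N)) \<alpha>)\<^sup>2)"
      by (simp add: wavelet_operator_def synthesis_def)
  qed
  also have "\<dots> = nsum UNIV (\<lambda>k. nsum (\<X> k) (?b k))"
    by (rule nsum_int_shift[where g = "\<lambda>k. nsum (\<X> k) (?b k)"])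
  also have "\<dots> = nsum pts (\<lambda>i. ?b (fst i) (snd i))"
    by (simp add: nsum_pts)
  finally show ?thesis by (simp add: inf_square_function_def)
qed

text \<open>Squaring the bound for the amplitudes with Cauchy--Schwarz makes the wavelet square function at most
  a bump sum of the squared cell minima, and smoothing turns the bumps into cubes. The rescaling of the weights from
  level \<open>k\<close> to \<open>k + N\<close> costs a factor that depends on \<open>N\<close>.\<close>

lemma wavelet_square_function_le:
  assumes p: "p > 0"
  shows "\<exists>N0. \<forall>N\<ge>N0. \<exists>C>0. \<forall>f :: ('a \<Rightarrow> 'b) \<Rightarrow> 'b::{real_normed_field, banach, second_countable_topology}.
    (\<forall>L\<ge>G. \<forall>k. dominated_coeffs L k (wavelet_coeff \<psi> f k)) \<longrightarrow>
    Lp_norm M p (wavelet_square_function M \<X> Q \<psi> f) \<le> ennreal C * Lp_norm M p (inf_square_function \<X> Q \<psi> N f)"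
proof -
  obtain L0 where L0: "\<And>L C. L \<ge> L0 \<Longrightarrow> C > 0 \<Longrightarrow> \<exists>C'>0. \<forall>F b. (\<forall>i. b i \<ge> 0) \<longrightarrow> (\<forall>x. F x \<le> ennreal C * bump_series b L x) \<longrightarrow>
    Lp_norm M p (\<lambda>x. ennreal_powr (F x) (1/2)) \<le> ennreal C' * Lp_norm M p (\<lambda>x. ennreal_powr (cell_series b x) (1/2))"
    using Lp_norm_le_of_le_bump_series[OF p] by blast
  define L where "L = max G (max L0 (2 * \<omega> + 1))"
  have L: "L \<ge> L0" "L \<ge> 2 * \<omega> + 1" "L \<ge> 0" "L \<ge> G" using \<omega>_pos by (auto simp: L_def)
  obtain N0 C2 where C2: "C2 > 0" "\<And>N k (c :: 'a \<Rightarrow> 'b) \<alpha>. N \<ge> N0 \<Longrightarrow> dominated_coeffs L k c \<Longrightarrow> \<alpha> \<in> Y k \<Longrightarrow>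
    ennreal (amplitude k c \<alpha>)
      \<le> ennreal C2 * cell_min_sum L k N c \<alpha>"
    using amplitude_le_cell_min_sum[OF L(2), where 'b = 'b] by blast
  obtain Cp where Cp: "Cp \<ge> 1" "\<And>k x. nsum (\<X> k) (\<lambda>\<alpha>. ennreal (w L (scale k) x \<alpha>)) \<le> ennreal Cp"
    using bump_sum_bound L(2) by meson
  define Cd where "Cd = K * (1 / \<delta>) powr \<omega> * \<kappa>"
  have Cd: "Cd > 0" by (simp add: Cd_def)
  define D where "D = (A\<^sub>0 * (1 + 4 * A\<^sub>0\<^sup>2)) powr L"
  have D: "D > 0" unfolding D_def using A\<^sub>0_sq by auto
  have "\<exists>C>0. \<forall>f :: ('a \<Rightarrow> 'b) \<Rightarrow> 'b. (\<forall>L\<ge>G. \<forall>k. dominated_coeffs L k (wavelet_coeff \<psi> f k)) \<longrightarrow>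
    Lp_norm M p (wavelet_square_function M \<X> Q \<psi> f) \<le> ennreal C * Lp_norm M p (inf_square_function \<X> Q \<psi> N f)"
    if N: "N \<ge> N0" for N
  proof -
    define R where "R = (1 / \<delta> ^ N) powr L"
    have R: "R > 0" by (simp add: R_def)
    define C' where "C' = C2 * (D * R)"
    have C': "C' > 0" using C2(1) D R by (simp add: C'_def)
    define C3 where "C3 = Cd * (C'\<^sup>2 * Cp)"
    have C3: "C3 > 0" using Cd C' Cp by (simp add: C3_def)
    obtain C1 where C1: "C1 > 0" "\<And>F b. (\<And>i. b i \<ge> 0) \<Longrightarrow> (\<And>x. F x \<le> ennreal C3 * bump_series b L x) \<Longrightarrow>
    Lp_norm M p (\<lambda>x. ennreal_powr (F x) (1/2)) \<le> ennreal C1 * Lp_norm M p (\<lambda>x. ennreal_powr (cell_series b x) (1/2))"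
    using L0[OF L(1) C3] by blast
    have "Lp_norm M p (wavelet_square_function M \<X> Q \<psi> f)
        \<le> ennreal C1 * Lp_norm M p (inf_square_function \<X> Q \<psi> N f)"
      if dom: "\<forall>L\<ge>G. \<forall>k. dominated_coeffs L k (wavelet_coeff \<psi> f k)" for f :: "('a \<Rightarrow> 'b) \<Rightarrow> 'b"
    proof -
      let ?c = "wavelet_coeff \<psi> f"
      let ?F = "\<lambda>x. cell_series (coeff_weight ?c) x"
      define b where "b i = (cell_min (fst i - int N) N (?c (fst i - int N)) (snd i))\<^sup>2" for i
      have b0: "b i \<ge> 0" for i by (simp add: b_def)
      have W: "wavelet_square_function M \<X> Q \<psi> f = (\<lambda>x. ennreal_powr (?F x) (1/2))"
        by (rule ext) (rule wavelet_square_function_eq)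
      have G: "inf_square_function \<X> Q \<psi> N f = (\<lambda>x. ennreal_powr (cell_series b x) (1/2))"
        unfolding b_def by (rule ext) (rule inf_square_function_eq)
      have Fle: "?F x \<le> ennreal C3 * bump_series b L x" for x
      proof -
        let ?u = "\<lambda>k \<alpha>'. w L (scale (k + int N)) x \<alpha>'"
        let ?m = "\<lambda>k. cell_min k N (?c k)"
        let ?T = "\<lambda>k. nsum (\<X> (k + int N)) (\<lambda>\<alpha>'. ennreal ((?m k \<alpha>')\<^sup>2 * ?u k \<alpha>'))"
        have level: "ennreal ((norm (?c k \<alpha>))\<^sup>2 / measure M (Q (k + 1) \<alpha>)) \<le> ennreal C3 * ?T k"
          if \<alpha>: "\<alpha> \<in> Y k" and x: "x \<in> Q (k + 1) \<alpha>" for k \<alpha>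
        proof -
          have \<alpha>X: "\<alpha> \<in> \<X> (k + 1)" using \<alpha> new_points_subset by auto
          have dx: "d \<alpha> x \<le> 4 * A\<^sub>0\<^sup>2 * scale k"
          proof -
            have "d \<alpha> x \<le> 4 * A\<^sub>0\<^sup>2 * scale (k + 1)" by (rule cube_near[OF \<alpha>X x])
            also have "\<dots> \<le> 4 * A\<^sub>0\<^sup>2 * scale k" by (intro mult_left_mono scale_antimono) auto
            finally show ?thesis .
          qed
          have wle: "w L (scale k) \<alpha> \<alpha>' \<le> (D * R) * ?u k \<alpha>'" for \<alpha>'
          proof -
            have "w L (scale k) \<alpha> \<alpha>' \<le> D * w L (scale k) x \<alpha>'"
              unfolding D_def by (rule bump_shift[OF scale_pos L(3) dx])
            also have "w L (scale k) x \<alpha>' \<le> R * ?u k \<alpha>'"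
              using bump_rescale[of "scale (k + int N)" "scale k" L x \<alpha>'] scale_antimono[of k "k + int N"] L(3)
              by (simp add: scale_add R_def)
            finally show ?thesis using D by (simp add: mult.assoc)
          qed
          have "ennreal (amplitude k (?c k) \<alpha>) \<le> ennreal C2 * nsum (\<X> (k + int N)) (\<lambda>\<alpha>'. ennreal (?m k \<alpha>' * w L (scale k) \<alpha> \<alpha>'))"
            using dom L(4) by (intro C2 N \<alpha>) auto
          also have "\<dots> \<le> ennreal C2 * nsum (\<X> (k + int N)) (\<lambda>\<alpha>'. ennreal (D * R) * ennreal (?m k \<alpha>' * ?u k \<alpha>'))"
          proof (intro mult_left_mono nn_integral_mono)
            fix \<alpha>'
            have "?m k \<alpha>' * w L (scale k) \<alpha> \<alpha>' \<le> ?m k \<alpha>' * ((D * R) * ?u k \<alpha>')"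
              by (intro mult_left_mono wle) auto
            then have "ennreal (?m k \<alpha>' * w L (scale k) \<alpha> \<alpha>') \<le> ennreal ((D * R) * (?m k \<alpha>' * ?u k \<alpha>'))"
              by (intro ennreal_leI) (simp only: mult_ac)
            also have "\<dots> = ennreal (D * R) * ennreal (?m k \<alpha>' * ?u k \<alpha>')"
              using D R by (intro ennreal_mult) auto
            finally show "ennreal (?m k \<alpha>' * w L (scale k) \<alpha> \<alpha>') \<le> \<dots>" .
          qed auto
          also have "\<dots> = ennreal C' * nsum (\<X> (k + int N)) (\<lambda>\<alpha>'. ennreal (?m k \<alpha>' * ?u k \<alpha>'))"
            using C2(1) D R unfolding C'_def by (subst nn_integral_cmult, simp) (simp add: ennreal_mult mult.assoc)
          finally have "(ennreal (amplitude k (?c k) \<alpha>))\<^sup>2 \<le> (ennreal C' * nsum (\<X> (k + int N)) (\<lambda>\<alpha>'. ennreal (?m k \<alpha>' * ?u k \<alpha>')))\<^sup>2"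
            by (rule power_mono) simp
          also have "\<dots> = ennreal (C'\<^sup>2) * (nsum (\<X> (k + int N)) (\<lambda>\<alpha>'. ennreal (?m k \<alpha>' * ?u k \<alpha>')))\<^sup>2"
            using C' by (simp add: power_mult_distrib ennreal_power)
          also have "\<dots> \<le> ennreal (C'\<^sup>2) * (nsum (\<X> (k + int N)) (\<lambda>\<alpha>'. ennreal (?u k \<alpha>')) * ?T k)"
            by (intro mult_left_mono nsum_Cauchy_Schwarz countable_points) auto
          also have "\<dots> \<le> ennreal (C'\<^sup>2) * (ennreal Cp * ?T k)"
            by (intro mult_left_mono mult_right_mono Cp) auto
          finally have sq: "(ennreal (amplitude k (?c k) \<alpha>))\<^sup>2 \<le> ennreal (C'\<^sup>2) * (ennreal Cp * ?T k)" .
          have Vp: "V (scale k) \<alpha> > 0" by (rule V_pos) simp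
          have mp: "measure M (Q (k + 1) \<alpha>) > 0" by (rule cube_measure_pos[OF \<alpha>X])
          have "V (scale k) \<alpha> / measure M (Q (k + 1) \<alpha>) \<le> Cd"
            using V_le_new_cube[OF \<alpha>] mp by (simp add: Cd_def pos_divide_le_eq)
          then have "(amplitude k (?c k) \<alpha>)\<^sup>2 * (V (scale k) \<alpha> / measure M (Q (k + 1) \<alpha>)) \<le> (amplitude k (?c k) \<alpha>)\<^sup>2 * Cd"
            by (rule mult_left_mono) simp
          then have "(norm (?c k \<alpha>))\<^sup>2 / measure M (Q (k + 1) \<alpha>) \<le> Cd * (amplitude k (?c k) \<alpha>)\<^sup>2"
            using Vp by (simp add: amplitude_def power_divide mult.commute)
          then have "ennreal ((norm (?c k \<alpha>))\<^sup>2 / measure M (Q (k + 1) \<alpha>)) \<le> ennreal (Cd * (amplitude k (?c k) \<alpha>)\<^sup>2)"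
            by (rule ennreal_leI)
          also have "\<dots> = ennreal Cd * (ennreal (amplitude k (?c k) \<alpha>))\<^sup>2"
            using Cd by (simp add: ennreal_mult ennreal_power)
          also have "\<dots> \<le> ennreal Cd * (ennreal (C'\<^sup>2) * (ennreal Cp * ?T k))"
            by (intro mult_left_mono sq) auto
          also have "\<dots> = ennreal C3 * ?T k"
            using Cd C' Cp(1) unfolding C3_def by (simp add: ennreal_mult mult.assoc)
          finally show ?thesis .
        qed
        have "?F x = nsum UNIV (\<lambda>k. nsum (Y k) (\<lambda>\<alpha>. ennreal ((norm (?c k \<alpha>))\<^sup>2 / measure M (Q (k + 1) \<alpha>)) * indicator (cell (k + 1, \<alpha>)) x))"
          by (rule nsum_coeff_weight)
        also have "\<dots> \<le> nsum UNIV (\<lambda>k. ennreal C3 * ?T k)"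
        proof (intro nn_integral_mono)
          fix k
          have "nsum (Y k) (\<lambda>\<alpha>. ennreal ((norm (?c k \<alpha>))\<^sup>2 / measure M (Q (k + 1) \<alpha>)) * indicator (cell (k + 1, \<alpha>)) x)
             \<le> nsum (\<X> (k + 1)) (\<lambda>\<alpha>. (if \<alpha> \<in> Y k then ennreal ((norm (?c k \<alpha>))\<^sup>2 / measure M (Q (k + 1) \<alpha>)) else 0) * indicator (Q (k + 1) \<alpha>) x)"
            by (intro nsum_subset_mono new_points_subset) auto
          also have "\<dots> \<le> ennreal C3 * ?T k"
            using level by (intro nsum_cells_le) auto
          finally show "nsum (Y k) (\<lambda>\<alpha>. ennreal ((norm (?c k \<alpha>))\<^sup>2 / measure M (Q (k + 1) \<alpha>)) * indicator (cell (k + 1, \<alpha>)) x) \<le> ennreal C3 * ?T k" .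
        qed
        also have "\<dots> = ennreal C3 * nsum UNIV ?T" by (rule nn_integral_cmult) simp
        also have "nsum UNIV ?T = nsum UNIV (\<lambda>k. nsum (\<X> (k + int N)) (\<lambda>\<alpha>'. ennreal (b (k + int N, \<alpha>') * wt L (k + int N, \<alpha>') x)))"
          by (simp add: b_def)
        also have "\<dots> = nsum UNIV (\<lambda>k. nsum (\<X> k) (\<lambda>\<alpha>'. ennreal (b (k, \<alpha>') * wt L (k, \<alpha>') x)))"
          by (rule nsum_int_shift[where g = "\<lambda>k. nsum (\<X> k) (\<lambda>\<alpha>'. ennreal (b (k, \<alpha>') * wt L (k, \<alpha>') x))"])
        also have "\<dots> = bump_series b L x" by (simp add: nsum_pts)
        finally show ?thesis .
      qed
      show ?thesis unfolding W G by (intro C1(2) b0 Fle)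
    qed
    then show ?thesis using C1(1) by blast
  qed
  then show ?thesis by blast
qed

section \<open>Wavelet coefficients of distributions\<close>

text \<open>The weight in the definition of test functions decays only polynomially, hence more slowly than a
  wavelet.\<close>

lemma test_weight_lower:
  "\<exists>c>0. \<forall>x. c * (1 + d x x0) powr (- (\<omega> + \<gamma>)) \<le> test_weight M d x0 1 \<gamma> x"
proof -
  let ?V1 = "V 1 x0"
  define B where "B = 1 + K * (2 * A\<^sub>0) powr \<omega>"
  have V1: "?V1 > 0" by (rule V_pos) simp
  have B: "B > 0" unfolding B_def by (intro add_pos_nonneg) auto
  have "1 / (?V1 * B) * (1 + d x x0) powr (- (\<omega> + \<gamma>)) \<le> test_weight M d x0 1 \<gamma> x" for x
  proof -
    let ?e = "1 + d x x0"
    have e: "?e \<ge> 1" using dist_nonneg by simp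
    have "qball d x (d x x0) \<subseteq> qball d x0 ((2 * A\<^sub>0 * ?e) * 1)"
    proof
      fix y assume "y \<in> qball d x (d x x0)"
      then have y: "d x y < d x x0" by (simp add: qball_def)
      have "d x0 y \<le> A\<^sub>0 * (d x0 x + d x y)" by (rule quasi_triangle)
      also have "\<dots> < A\<^sub>0 * (2 * ?e)"
        using y dist_commute[of x0 x] by (intro mult_strict_left_mono) auto
      finally show "y \<in> qball d x0 ((2 * A\<^sub>0 * ?e) * 1)" by (simp add: qball_def algebra_simps)
    qed
    then have "V (d x x0) x \<le> V ((2 * A\<^sub>0 * ?e) * 1) x0"
      using e by (intro measure_mono_in_ball qball_measurable) auto
    also have "\<dots> \<le> K * (2 * A\<^sub>0 * ?e) powr \<omega> * ?V1"
    proof (rule growth)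
      have "1 * 1 \<le> (2 * A\<^sub>0) * ?e" using A\<^sub>0_ge_1 e by (intro mult_mono) auto
      then show "1 \<le> 2 * A\<^sub>0 * ?e" by simp
    qed simp
    also have "(2 * A\<^sub>0 * ?e) powr \<omega> = (2 * A\<^sub>0) powr \<omega> * ?e powr \<omega>" by (rule powr_mult)
    finally have "?V1 + V (d x x0) x \<le> ?V1 * ?e powr \<omega> + K * ((2 * A\<^sub>0) powr \<omega> * ?e powr \<omega>) * ?V1"
      using V1 e \<omega>_pos ge_one_powr_ge_zero[of ?e \<omega>] by (intro add_mono) auto
    also have "\<dots> = ?V1 * B * ?e powr \<omega>" by (simp add: B_def algebra_simps)
    finally have le: "?V1 + V (d x x0) x \<le> ?V1 * B * ?e powr \<omega>" .
    have "1 / (?V1 * B) * ?e powr (- (\<omega> + \<gamma>)) = 1 / (?V1 * B * ?e powr \<omega>) * (1 / ?e) powr \<gamma>"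
    proof -
      have "(1 / ?e) powr \<gamma> = 1 / ?e powr \<gamma>" by (simp add: powr_divide)
      then show ?thesis
        unfolding minus_add_distrib powr_add powr_minus by (simp add: divide_inverse)
    qed
    also have "\<dots> \<le> 1 / (?V1 + V (d x x0) x) * (1 / ?e) powr \<gamma>"
      using le V1 B e by (intro mult_right_mono divide_left_mono mult_pos_pos add_pos_nonneg) auto
    also have "\<dots> = test_weight M d x0 1 \<gamma> x" by (simp add: test_weight_def)
    finally show ?thesis .
  qed
  moreover have "1 / (?V1 * B) > 0" using V1 B by simp
  ultimately show ?thesis by blast
qed

text \<open>Every wavelet is a test function, with a norm that grows polynomially in the distance of its center
  from \<open>x0\<close>: move the decay from the center to \<open>x0\<close> by the submultiplicative inequality. The exponent
  \<open>\<omega> + \<gamma>\<close> accounts for the test weight and the additional \<open>\<eta>\<close> for the growing denominator in the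
  Hoelder condition. At distances beyond \<open>scale k\<close> that condition follows from the size estimate at
  both points.\<close>

lemma wavelet_test_bound:
  assumes \<gamma>: "\<gamma> > 0"
  shows "\<exists>T>0. \<forall>\<alpha>\<in>Y k. \<forall>\<beta>. 0 < \<beta> \<longrightarrow> \<beta> \<le> \<eta> \<longrightarrow>
    test_bound M d A\<^sub>0 x0 1 \<beta> \<gamma> (\<lambda>x. of_real (\<psi> k \<alpha> x) :: 'b::real_normed_field)
      (T / (sqrt (V (scale k) \<alpha>) * w (\<omega> + \<gamma> + \<eta>) (scale k) x0 \<alpha>))"
proof -
  define L where "L = \<omega> + \<gamma> + \<eta>"
  have L: "L \<ge> 0" using \<gamma> \<omega>_pos \<eta>_pos by (simp add: L_def)
  let ?r = "scale k"
  obtain C0 where C0: "C0 > 0"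
    and size: "\<And>k \<alpha> x. \<alpha> \<in> Y k \<Longrightarrow> \<bar>\<psi> k \<alpha> x\<bar> \<le> C0 / sqrt (V (scale k) \<alpha>) * w L (scale k) \<alpha> x"
    and reg: "\<And>k \<alpha> x y. \<alpha> \<in> Y k \<Longrightarrow> d x y \<le> scale k \<Longrightarrow> \<bar>\<psi> k \<alpha> x - \<psi> k \<alpha> y\<bar> \<le>
       C0 / sqrt (V (scale k) \<alpha>) * (d x y / scale k) powr \<eta> * w L (scale k) \<alpha> x"
    using wavelet_bump_bounds[OF L] by blast
  obtain cw where cw: "cw > 0" "\<And>x. cw * (1 + d x x0) powr (- (\<omega> + \<gamma>)) \<le> test_weight M d x0 1 \<gamma> x"
    using test_weight_lower[of x0 \<gamma>] by blast
  define \<rho> where "\<rho> = (max 1 ?r) powr L"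
  have \<rho>: "\<rho> > 0" by (simp add: \<rho>_def)
  define H where "H = 1 + (1 + (2 * A\<^sub>0) powr L) * ?r powr (- \<eta>)"
  have H: "H > 0" unfolding H_def by (intro add_pos_nonneg mult_nonneg_nonneg) auto
  define T where "T = C0 * A\<^sub>0 powr L * \<rho> * H / cw"
  have T: "T > 0" using C0 \<rho> H cw(1) by (simp add: T_def)
  have decay: "w L ?r \<alpha> x \<le> A\<^sub>0 powr L * \<rho> * (1 + d x x0) powr (- L) / w L ?r x0 \<alpha>" for \<alpha> x
  proof -
    have p: "w L ?r x0 \<alpha> > 0" by (rule bump_pos) simp
    have "w L ?r x0 \<alpha> * w L ?r \<alpha> x \<le> A\<^sub>0 powr L * w L ?r x0 x" by (rule bump_triangle[OF scale_pos L])
    also have "w L ?r x0 x \<le> \<rho> * (1 + d x x0) powr (- L)"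
    proof -
      have "1 + d x x0 \<le> max 1 ?r * (1 + d x x0 / ?r)"
      proof -
        have "max 1 ?r * (d x x0 / ?r) \<ge> ?r * (d x x0 / ?r)"
          using dist_nonneg by (intro mult_right_mono) auto
        then show ?thesis by (simp add: distrib_left)
      qed
      then have "(1 + d x x0) powr L \<le> (max 1 ?r * (1 + d x x0 / ?r)) powr L"
        using L dist_nonneg[of x x0] by (intro powr_mono2) auto
      also have "\<dots> = \<rho> * (1 + d x x0 / ?r) powr L" by (simp add: \<rho>_def powr_mult)
      finally have le: "(1 + d x x0) powr L \<le> \<rho> * (1 + d x x0 / ?r) powr L" .
      have inv: "inverse b \<le> \<rho> * inverse a" if "a \<le> \<rho> * b" "a > 0" "b > 0" for a b
        using that by (simp add: field_simps)
      have "0 < 1 + d x x0 / ?r" "0 < 1 + d x x0"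
        using dist_nonneg[of x x0] bump_base_ge_1[OF scale_pos[of k], of x x0] by linarith+
      then have "0 < (1 + d x x0 / ?r) powr L" "0 < (1 + d x x0) powr L" by simp_all
      then show ?thesis
        unfolding bump_def dist_commute[of x0 x] powr_minus by (intro inv le)
    qed
    finally show ?thesis using p by (simp add: field_simps mult_left_mono)
  qed
  have "test_bound M d A\<^sub>0 x0 1 \<beta> \<gamma> (\<lambda>x. of_real (\<psi> k \<alpha> x) :: 'b) (T / (sqrt (V ?r \<alpha>) * w L ?r x0 \<alpha>))"
    if \<alpha>: "\<alpha> \<in> Y k" and \<beta>: "0 < \<beta>" "\<beta> \<le> \<eta>" for \<alpha> \<beta>
  proof -
    define S where "S = C0 / sqrt (V ?r \<alpha>) * (A\<^sub>0 powr L * \<rho> / w L ?r x0 \<alpha>)"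
    have Vp: "V ?r \<alpha> > 0" by (rule V_pos) simp
    have wp: "w L ?r x0 \<alpha> > 0" by (rule bump_pos) simp
    have S: "S > 0" unfolding S_def using C0 Vp \<rho> wp by (intro mult_pos_pos divide_pos_pos) auto
    have T_eq: "T / (sqrt (V ?r \<alpha>) * w L ?r x0 \<alpha>) = S * H / cw"
      by (simp add: T_def S_def mult_ac)
    have Sx: "C0 / sqrt (V ?r \<alpha>) * w L ?r \<alpha> x \<le> S * (1 + d x x0) powr (- L)" for x
    proof -
      have "C0 / sqrt (V ?r \<alpha>) * w L ?r \<alpha> x \<le> C0 / sqrt (V ?r \<alpha>) * (A\<^sub>0 powr L * \<rho> * (1 + d x x0) powr (- L) / w L ?r x0 \<alpha>)"
        using C0 by (intro mult_left_mono decay) auto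
      then show ?thesis by (simp add: S_def)
    qed
    have e1: "1 + d x x0 \<ge> 1" for x using dist_nonneg by simp
    have wt_ge: "S * H * (1 + d x x0) powr (- (\<omega> + \<gamma>)) \<le> S * H / cw * test_weight M d x0 1 \<gamma> x" for x
    proof -
      have "(1 + d x x0) powr (- (\<omega> + \<gamma>)) \<le> test_weight M d x0 1 \<gamma> x / cw"
        using cw(1) cw(2)[of x] by (simp add: field_simps)
      then have "S * H * (1 + d x x0) powr (- (\<omega> + \<gamma>)) \<le> S * H * (test_weight M d x0 1 \<gamma> x / cw)"
        using S H by (intro mult_left_mono) auto
      then show ?thesis by simp
    qed
    show ?thesis
      unfolding test_bound_def T_eq
    proof (intro conjI allI impI)
      fix x
      have "norm (of_real (\<psi> k \<alpha> x) :: 'b) \<le> S * (1 + d x x0) powr (- L)"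
        using order_trans[OF size[OF \<alpha>] Sx] by simp
      also have "\<dots> \<le> S * (1 + d x x0) powr (- (\<omega> + \<gamma>))"
        using S e1[of x] \<eta>_pos by (intro mult_left_mono powr_mono) (auto simp: L_def)
      also have "\<dots> \<le> S * H * (1 + d x x0) powr (- (\<omega> + \<gamma>))"
      proof -
        have "1 \<le> H" unfolding H_def by (simp add: add_nonneg_nonneg)
        then have "S * 1 \<le> S * H" using S by (intro mult_left_mono) auto
        then show ?thesis by (intro mult_right_mono) auto
      qed
      also note wt_ge
      finally show "norm (of_real (\<psi> k \<alpha> x) :: 'b) \<le> S * H / cw * test_weight M d x0 1 \<gamma> x" .
    next
      fix x y assume near: "d x y < 1 / (2 * A\<^sub>0) * (1 + d x x0)"
      let ?e = "1 + d x x0" and ?t = "d x y / (1 + d x x0)"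
      have e: "?e \<ge> 1" by (rule e1)
      have t0: "?t \<ge> 0" using dist_nonneg e by simp
      have t1: "?t \<le> 1"
      proof -
        have "1 / (2 * A\<^sub>0) * ?e \<le> 1 * ?e"
          using A\<^sub>0_ge_1 e by (intro mult_right_mono) (auto simp: field_simps)
        from order.strict_trans2[OF near this] have "d x y \<le> ?e" by simp
        then show ?thesis using e by (simp add: pos_divide_le_eq)
      qed
      have dt: "(d x y / ?r) powr \<eta> = ?r powr (- \<eta>) * ?t powr \<eta> * ?e powr \<eta>"
      proof -
        have "d x y / ?r = (1 / ?r) * ?t * ?e" using e by simp
        then have "(d x y / ?r) powr \<eta> = ((1 / ?r) * ?t * ?e) powr \<eta>" by simp
        also have "\<dots> = (1 / ?r) powr \<eta> * ?t powr \<eta> * ?e powr \<eta>" by (simp only: powr_mult)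
        also have "(1 / ?r) powr \<eta> = ?r powr (- \<eta>)" by (simp add: powr_minus powr_divide inverse_eq_divide)
        finally show ?thesis .
      qed
      have eL: "?e powr \<eta> * ?e powr (- L) = ?e powr (- (\<omega> + \<gamma>))"
        using e by (simp add: powr_add[symmetric] L_def)
      have "\<bar>\<psi> k \<alpha> x - \<psi> k \<alpha> y\<bar> \<le> S * (1 + (2 * A\<^sub>0) powr L) * (d x y / ?r) powr \<eta> * ?e powr (- L)"
      proof (cases "d x y \<le> ?r")
        case True
        have "\<bar>\<psi> k \<alpha> x - \<psi> k \<alpha> y\<bar> \<le> (d x y / ?r) powr \<eta> * (C0 / sqrt (V ?r \<alpha>) * w L ?r \<alpha> x)"
          using reg[OF \<alpha> True] by (simp add: mult_ac)
        also have "\<dots> \<le> (d x y / ?r) powr \<eta> * (S * ?e powr (- L))"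
          by (intro mult_left_mono Sx) auto
        also have "\<dots> = S * 1 * (d x y / ?r) powr \<eta> * ?e powr (- L)" by (simp add: mult_ac)
        also have "\<dots> \<le> S * (1 + (2 * A\<^sub>0) powr L) * (d x y / ?r) powr \<eta> * ?e powr (- L)"
          using S by (intro mult_right_mono mult_left_mono) auto
        finally show ?thesis .
      next
        case False
        have half: "A\<^sub>0 * d x y \<le> ?e / 2"
          using near A\<^sub>0_pos(1) by (simp add: field_simps)
        have "?e \<le> A\<^sub>0 * 1 + A\<^sub>0 * (d x y + d y x0)"
          using quasi_triangle[of x x0 y] A\<^sub>0_ge_1 by simp
        also have "\<dots> = A\<^sub>0 * d x y + A\<^sub>0 * (1 + d y x0)" by (simp add: algebra_simps)
        finally have le: "?e \<le> A\<^sub>0 * d x y + A\<^sub>0 * (1 + d y x0)" .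
        have "e \<le> 2 * q" if "e \<le> p + q" "p \<le> e / 2" for e p q :: real
          using that by simp
        from this[OF le half] have "?e \<le> 2 * (A\<^sub>0 * (1 + d y x0))" .
        then have "?e \<le> 2 * A\<^sub>0 * (1 + d y x0)" by (simp only: mult.assoc)
        then have "(2 * A\<^sub>0 * (1 + d y x0)) powr (- L) \<le> ?e powr (- L)"
          using L e by (intro powr_mono2') auto
        then have "inverse ((2 * A\<^sub>0) powr L) * (1 + d y x0) powr (- L) \<le> ?e powr (- L)"
          by (simp only: powr_mult powr_minus[of "2 * A\<^sub>0"] powr_minus[of 2] powr_minus[of "A\<^sub>0"] inverse_mult_distrib)
        moreover have "u \<le> a * v" if "inverse a * u \<le> v" "a > 0" for a u v :: real
          using that by (simp add: field_simps)
        ultimately have ey: "(1 + d y x0) powr (- L) \<le> (2 * A\<^sub>0) powr L * ?e powr (- L)"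
          by simp
        have "\<bar>\<psi> k \<alpha> x - \<psi> k \<alpha> y\<bar> \<le> \<bar>\<psi> k \<alpha> x\<bar> + \<bar>\<psi> k \<alpha> y\<bar>" by simp
        also have "\<dots> \<le> S * ?e powr (- L) + S * (1 + d y x0) powr (- L)"
          by (intro add_mono order_trans[OF size[OF \<alpha>] Sx])
        also have "\<dots> \<le> S * ?e powr (- L) + S * ((2 * A\<^sub>0) powr L * ?e powr (- L))"
          using S ey by (intro add_left_mono mult_left_mono) auto
        also have "\<dots> = S * (1 + (2 * A\<^sub>0) powr L) * 1 * ?e powr (- L)" by (simp add: algebra_simps)
        also have "\<dots> \<le> S * (1 + (2 * A\<^sub>0) powr L) * (d x y / ?r) powr \<eta> * ?e powr (- L)"
        proof -
          have "1 \<le> d x y / ?r" using False by simp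
          then have "1 \<le> (d x y / ?r) powr \<eta>" using \<eta>_pos by (intro ge_one_powr_ge_zero) auto
          then show ?thesis using S by (intro mult_right_mono mult_left_mono mult_nonneg_nonneg add_nonneg_nonneg) auto
        qed
        finally show ?thesis .
      qed
      also have "\<dots> = S * ((1 + (2 * A\<^sub>0) powr L) * ?r powr (- \<eta>)) * ?t powr \<eta> * (?e powr \<eta> * ?e powr (- L))"
        unfolding dt by (simp only: mult_ac)
      also have "\<dots> = S * ((1 + (2 * A\<^sub>0) powr L) * ?r powr (- \<eta>)) * ?t powr \<eta> * ?e powr (- (\<omega> + \<gamma>))"
        by (simp only: eL)
      also have "\<dots> \<le> S * H * ?t powr \<beta> * ?e powr (- (\<omega> + \<gamma>))"
        using S t0 t1 \<beta> by (intro mult_right_mono mult_mono mult_left_mono powr_mono')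
          (auto simp: H_def intro!: mult_nonneg_nonneg add_nonneg_nonneg)
      also have "\<dots> = ?t powr \<beta> * (S * H * ?e powr (- (\<omega> + \<gamma>)))" by (simp only: mult_ac)
      also have "\<dots> \<le> ?t powr \<beta> * (S * H / cw * test_weight M d x0 1 \<gamma> x)"
        by (intro mult_left_mono wt_ge) auto
      finally have "\<bar>\<psi> k \<alpha> x - \<psi> k \<alpha> y\<bar> \<le> S * H / cw * ?t powr \<beta> * test_weight M d x0 1 \<gamma> x"
        by (simp only: mult_ac)
      then show "norm (of_real (\<psi> k \<alpha> x) - of_real (\<psi> k \<alpha> y) :: 'b) \<le> S * H / cw * ?t powr \<beta> * test_weight M d x0 1 \<gamma> x"
        by (simp only: of_real_diff[symmetric] norm_of_real)
    qed
  qed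
  then show ?thesis using T unfolding L_def by blast
qed

lemma test_norm_zero_less: "\<epsilon> > 0 \<Longrightarrow> test_norm M d A\<^sub>0 x0 1 \<beta> \<gamma> (\<lambda>x. 0 :: 'b::real_normed_vector) < \<epsilon>"
proof -
  assume \<epsilon>: "\<epsilon> > 0"
  have "test_norm M d A\<^sub>0 x0 1 \<beta> \<gamma> (\<lambda>x. 0 :: 'b) \<le> \<epsilon> / 2"
    unfolding test_norm_def
  proof (intro cInf_lower bdd_belowI[of _ 0])
    have "0 \<le> test_weight M d x0 1 \<gamma> x" for x
      unfolding test_weight_def by simp
    then show "\<epsilon> / 2 \<in> {C. 0 < C \<and> test_bound M d A\<^sub>0 x0 1 \<beta> \<gamma> (\<lambda>x. 0 :: 'b) C}"
      using \<epsilon> by (auto simp: test_bound_def intro!: mult_nonneg_nonneg)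
  qed auto
  then show ?thesis using \<epsilon> by simp
qed

text \<open>A bounded functional applied to the wavelets of one level yields coefficients of polynomial growth.
  The exponent of the weights must pay for the growth of the test norms (\<open>\<omega> + \<gamma> + \<eta>\<close>), for the volume in the
  amplitude (\<open>\<omega>\<close>) and for summability (\<open>2 * \<omega> + 1\<close>).\<close>

lemma dominated_coeffs_of_distribution:
  fixes f :: "('a \<Rightarrow> 'b) \<Rightarrow> 'b::{real_normed_field, banach, second_countable_topology}"
  assumes \<beta>: "0 < \<beta>" "\<beta> \<le> \<eta>" and \<gamma>: "\<gamma> > 0"
    and f: "f \<in> distributions M d A\<^sub>0 x0 \<eta> \<beta> \<gamma>"
    and L: "L \<ge> 4 * \<omega> + \<gamma> + \<eta> + 1"
  shows "dominated_coeffs L k (wavelet_coeff \<psi> f k)"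
proof -
  let ?r = "scale k" and ?P = "\<omega> + \<gamma> + \<eta>"
  obtain B where B: "\<And>g. g \<in> completed_test_space M d A\<^sub>0 x0 \<eta> \<beta> \<gamma> \<Longrightarrow> norm (f g) \<le> B * test_norm M d A\<^sub>0 x0 1 \<beta> \<gamma> g"
    using f unfolding distributions_def by blast
  obtain T where T: "T > 0" "\<And>\<alpha> \<beta>'. \<alpha> \<in> Y k \<Longrightarrow> 0 < \<beta>' \<Longrightarrow> \<beta>' \<le> \<eta> \<Longrightarrow>
    test_bound M d A\<^sub>0 x0 1 \<beta>' \<gamma> (\<lambda>x. of_real (\<psi> k \<alpha> x) :: 'b) (T / (sqrt (V ?r \<alpha>) * w ?P ?r x0 \<alpha>))"
    using wavelet_test_bound[OF \<gamma>, where 'b = 'b] by blast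
  define E where "E = \<bar>B\<bar> * T * (K * A\<^sub>0 powr \<omega> / V ?r x0)"
  have V0: "V ?r x0 > 0" by (rule V_pos) simp
  have E: "E \<ge> 0" using T(1) V0 by (simp add: E_def)
  have amp: "amplitude k (wavelet_coeff \<psi> f k) \<alpha> \<le> E / w (?P + \<omega>) ?r x0 \<alpha>" if \<alpha>: "\<alpha> \<in> Y k" for \<alpha>
  proof -
    let ?g = "\<lambda>x. of_real (\<psi> k \<alpha> x) :: 'b"
    let ?T = "T / (sqrt (V ?r \<alpha>) * w ?P ?r x0 \<alpha>)"
    have Vp: "V ?r \<alpha> > 0" by (rule V_pos) simp
    have wp: "w ?P ?r x0 \<alpha> > 0" "w \<omega> ?r x0 \<alpha> > 0" by (rule bump_pos, simp)+
    have Tp: "?T > 0" using T(1) Vp wp by simp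
    have int: "has_bochner_integral M ?g 0"
      using has_bochner_integral_bounded_linear[OF bounded_linear_of_real cancellation[OF \<alpha>]] by simp
    have test: "?g \<in> test_space M d A\<^sub>0 x0 1 \<beta>' \<gamma>" if "0 < \<beta>'" "\<beta>' \<le> \<eta>" for \<beta>'
      unfolding test_space_def using T(2)[OF \<alpha> that] Tp int by blast
    \<comment> \<open>the wavelet lies in the smaller space itself, so it is its own approximation\<close>
    have "?g \<in> completed_test_space M d A\<^sub>0 x0 \<eta> \<beta> \<gamma>"
      unfolding completed_test_space_def
    proof (intro CollectI conjI allI impI bexI[of _ ?g])
      fix \<epsilon> :: real assume "\<epsilon> > 0"
      then show "test_norm M d A\<^sub>0 x0 1 \<beta> \<gamma> (\<lambda>x. ?g x - ?g x) < \<epsilon>"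
        using test_norm_zero_less[where 'b = 'b] by simp
    qed (use test \<beta> \<eta>_pos in auto)
    then have "norm (f ?g) \<le> B * test_norm M d A\<^sub>0 x0 1 \<beta> \<gamma> ?g" by (rule B)
    also have "\<dots> \<le> \<bar>B\<bar> * ?T"
    proof -
      have "test_norm M d A\<^sub>0 x0 1 \<beta> \<gamma> ?g \<le> ?T"
        unfolding test_norm_def using T(2)[OF \<alpha> \<beta>] Tp
        by (intro cInf_lower bdd_belowI[of _ 0]) auto
      moreover have "test_norm M d A\<^sub>0 x0 1 \<beta> \<gamma> ?g \<ge> 0"
        unfolding test_norm_def using T(2)[OF \<alpha> \<beta>] Tp
        by (intro cInf_greatest) auto
      ultimately show ?thesis by (intro mult_mono) auto
    qed
    finally have "norm (wavelet_coeff \<psi> f k \<alpha>) \<le> \<bar>B\<bar> * ?T" by (simp add: wavelet_coeff_def)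
    then have "amplitude k (wavelet_coeff \<psi> f k) \<alpha> \<le> \<bar>B\<bar> * ?T / sqrt (V ?r \<alpha>)"
      unfolding amplitude_def by (intro divide_right_mono) auto
    also have "\<dots> = \<bar>B\<bar> * T / w ?P ?r x0 \<alpha> * (1 / V ?r \<alpha>)"
      using Vp by (simp add: field_simps)
    also have "\<dots> \<le> \<bar>B\<bar> * T / w ?P ?r x0 \<alpha> * (K * A\<^sub>0 powr \<omega> / V ?r x0 / w \<omega> ?r x0 \<alpha>)"
    proof (rule mult_left_mono)
      have "V ?r x0 * w \<omega> ?r x0 \<alpha> \<le> K * A\<^sub>0 powr \<omega> * V ?r \<alpha>"
        using V_compare[of ?r x0 \<alpha>] by (simp add: bump_commute)
      then show "1 / V ?r \<alpha> \<le> K * A\<^sub>0 powr \<omega> / V ?r x0 / w \<omega> ?r x0 \<alpha>"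
        using Vp V0 wp by (simp add: field_simps)
    qed (use T(1) in auto)
    also have "\<dots> = E / (w ?P ?r x0 \<alpha> * w \<omega> ?r x0 \<alpha>)" by (simp add: E_def)
    also have "w ?P ?r x0 \<alpha> * w \<omega> ?r x0 \<alpha> = w (?P + \<omega>) ?r x0 \<alpha>" by (rule bump_mult) simp
    finally show ?thesis .
  qed
  obtain Cp where Cp: "Cp \<ge> 1" "\<And>k x. nsum (\<X> k) (\<lambda>\<alpha>. ennreal (w (2 * \<omega> + 1) (scale k) x \<alpha>)) \<le> ennreal Cp"
    using bump_sum_bound by (meson order_refl)
  show ?thesis
    unfolding dominated_coeffs_def
  proof
    fix x
    let ?G = "?P + \<omega>"
    define D where "D = E * (A\<^sub>0 powr ?G / w ?G ?r x0 x) * (1 / \<delta>) powr (2 * \<omega> + 1)"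
    have wx: "w ?G ?r x0 x > 0" by (rule bump_pos) simp
    have D: "D \<ge> 0" using E wx by (simp add: D_def)
    have "amplitude_sum L k (wavelet_coeff \<psi> f k) (Y k) x
       \<le> nsum (\<X> (k + 1)) (\<lambda>\<alpha>. ennreal D * ennreal (w (2 * \<omega> + 1) (scale (k + 1)) x \<alpha>))"
    proof (intro nsum_subset_mono new_points_subset)
      fix \<alpha> assume \<alpha>: "\<alpha> \<in> Y k"
      have wa: "w ?G ?r x0 \<alpha> > 0" by (rule bump_pos) simp
      have "w L ?r x \<alpha> \<le> w (?G + (2 * \<omega> + 1)) ?r x \<alpha>"
        using L by (intro bump_antimono) auto
      also have "\<dots> = w ?G ?r x \<alpha> * w (2 * \<omega> + 1) ?r x \<alpha>" by (rule bump_mult[symmetric]) simp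
      also have "\<dots> \<le> (A\<^sub>0 powr ?G / w ?G ?r x0 x * w ?G ?r x0 \<alpha>) * ((1 / \<delta>) powr (2 * \<omega> + 1) * w (2 * \<omega> + 1) (scale (k + 1)) x \<alpha>)"
      proof (intro mult_mono)
        have "w ?G ?r x0 x * w ?G ?r x \<alpha> \<le> A\<^sub>0 powr ?G * w ?G ?r x0 \<alpha>"
          using \<omega>_pos \<gamma> \<eta>_pos by (intro bump_triangle) auto
        then show "w ?G ?r x \<alpha> \<le> A\<^sub>0 powr ?G / w ?G ?r x0 x * w ?G ?r x0 \<alpha>"
          using wx by (simp add: field_simps)
        show "w (2 * \<omega> + 1) ?r x \<alpha> \<le> (1 / \<delta>) powr (2 * \<omega> + 1) * w (2 * \<omega> + 1) (scale (k + 1)) x \<alpha>"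
          using \<omega>_pos by (intro bump_rescale_Suc) simp
      qed (use wx in auto)
      finally have "amplitude k (wavelet_coeff \<psi> f k) \<alpha> * w L ?r x \<alpha>
        \<le> (E / w ?G ?r x0 \<alpha>) * ((A\<^sub>0 powr ?G / w ?G ?r x0 x * w ?G ?r x0 \<alpha>) * ((1 / \<delta>) powr (2 * \<omega> + 1) * w (2 * \<omega> + 1) (scale (k + 1)) x \<alpha>))"
        using amp[OF \<alpha>] E wa by (intro mult_mono) auto
      also have "\<dots> = D * w (2 * \<omega> + 1) (scale (k + 1)) x \<alpha>"
        using wa by (simp add: D_def)
      finally show "ennreal (amplitude k (wavelet_coeff \<psi> f k) \<alpha> * w L ?r x \<alpha>) \<le> ennreal D * ennreal (w (2 * \<omega> + 1) (scale (k + 1)) x \<alpha>)"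
        using D by (subst ennreal_mult[symmetric]) (auto intro!: ennreal_leI)
    qed
    also have "\<dots> = ennreal D * nsum (\<X> (k + 1)) (\<lambda>\<alpha>. ennreal (w (2 * \<omega> + 1) (scale (k + 1)) x \<alpha>))"
      by (rule nn_integral_cmult) simp
    also have "\<dots> \<le> ennreal D * ennreal Cp" by (intro mult_left_mono Cp) auto
    also have "\<dots> < \<infinity>" by (simp add: ennreal_mult_less_top)
    finally show "amplitude_sum L k (wavelet_coeff \<psi> f k) (Y k) x < \<infinity>" .
  qed
qed

end

theorem theorem4p4:
  fixes M :: "'a measure" and d :: "'a \<Rightarrow> 'a \<Rightarrow> real"
    and A\<^sub>0 \<delta> \<eta> \<omega> \<beta> \<gamma> p :: real
    and \<X> :: "int \<Rightarrow> 'a set" and Q :: "int \<Rightarrow> 'a \<Rightarrow> 'a set"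
    and \<psi> :: "int \<Rightarrow> 'a \<Rightarrow> 'a \<Rightarrow> real" and x\<^sub>0 :: 'a
  assumes "wavelet_basis M d A\<^sub>0 \<delta> \<X> Q \<eta> \<psi>"
    and "upper_dimension M d \<omega>"
    and "0 < \<beta>" "\<beta> < \<eta>" "0 < \<gamma>" "\<gamma> < \<eta>"
    and "\<omega> / (\<omega> + \<eta>) < p"
  shows
    "(\<forall>N. \<exists>C>0. \<forall>f \<in> (distributions M d A\<^sub>0 x\<^sub>0 \<eta> \<beta> \<gamma> ::
          (('a \<Rightarrow> 'b) \<Rightarrow> 'b::{real_normed_field, banach, second_countable_topology}) set).
        Lp_norm M p (sup_square_function \<X> Q \<psi> N f)
          \<le> ennreal C * Lp_norm M p (wavelet_square_function M \<X> Q \<psi> f)) \<and>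
     (\<exists>N\<^sub>0. \<forall>N\<ge>N\<^sub>0. \<exists>C>0. \<forall>f \<in> (distributions M d A\<^sub>0 x\<^sub>0 \<eta> \<beta> \<gamma> ::
          (('a \<Rightarrow> 'b) \<Rightarrow> 'b) set).
        Lp_norm M p (wavelet_square_function M \<X> Q \<psi> f)
          \<le> ennreal C * Lp_norm M p (inf_square_function \<X> Q \<psi> N f))"
proof -
  interpret wavelet_basis M d A\<^sub>0 \<delta> \<X> Q \<eta> \<psi> by fact
  obtain K' where \<omega>: "\<omega> > 0" and K': "\<And>x t r. t \<ge> 1 \<Longrightarrow> r > 0 \<Longrightarrow>
      measure M (qball d x (t * r)) \<le> K' * t powr \<omega> * measure M (qball d x r)"
    using assms(2) unfolding upper_dimension_def by blast
  \<comment> \<open>the maximum with \<open>1\<close> makes the constant admissible for the locale\<close>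
  interpret doubling_wavelets M d A\<^sub>0 \<delta> \<X> Q \<omega> "max 1 K'" \<eta> \<psi>
  proof
    fix x and t r :: real assume tr: "t \<ge> 1" "r > 0"
    note K'[OF tr]
    also have "K' * t powr \<omega> * measure M (qball d x r) \<le> max 1 K' * t powr \<omega> * measure M (qball d x r)"
      by (intro mult_right_mono) auto
    finally show "measure M (qball d x (t * r)) \<le> max 1 K' * t powr \<omega> * measure M (qball d x r)" .
  qed (use \<omega> in auto)
  have p: "p > 0"
    using assms(7) \<omega> \<eta>_pos by (smt (verit) divide_pos_pos)
  let ?G = "4 * \<omega> + \<gamma> + \<eta> + 1"
  obtain N0 where N0: "\<And>N. N \<ge> N0 \<Longrightarrow> \<exists>C>0. \<forall>f :: ('a \<Rightarrow> 'b) \<Rightarrow> 'b.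
    (\<forall>L\<ge>?G. \<forall>k. dominated_coeffs L k (wavelet_coeff \<psi> f k)) \<longrightarrow>
    Lp_norm M p (wavelet_square_function M \<X> Q \<psi> f) \<le> ennreal C * Lp_norm M p (inf_square_function \<X> Q \<psi> N f)"
    using wavelet_square_function_le[OF p, of ?G, where 'b = 'b] by blast
  have dom: "dominated_coeffs L k (wavelet_coeff \<psi> f k)"
    if "f \<in> (distributions M d A\<^sub>0 x\<^sub>0 \<eta> \<beta> \<gamma> :: (('a \<Rightarrow> 'b) \<Rightarrow> 'b) set)" "L \<ge> ?G" for f L k
    using that assms(3-5) by (intro dominated_coeffs_of_distribution[where \<beta> = \<beta> and \<gamma> = \<gamma> and ?x0.0 = x\<^sub>0]) auto
  show ?thesis
  proof (intro conjI allI exI[of _ N0] impI)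
    fix N
    show "\<exists>C>0. \<forall>f \<in> (distributions M d A\<^sub>0 x\<^sub>0 \<eta> \<beta> \<gamma> :: (('a \<Rightarrow> 'b) \<Rightarrow> 'b) set).
        Lp_norm M p (sup_square_function \<X> Q \<psi> N f) \<le> ennreal C * Lp_norm M p (wavelet_square_function M \<X> Q \<psi> f)"
      using sup_square_function_le[OF p, of N, where 'b = 'b] by blast
  next
    fix N assume "N \<ge> N0"
    then show "\<exists>C>0. \<forall>f \<in> (distributions M d A\<^sub>0 x\<^sub>0 \<eta> \<beta> \<gamma> :: (('a \<Rightarrow> 'b) \<Rightarrow> 'b) set).
        Lp_norm M p (wavelet_square_function M \<X> Q \<psi> f) \<le> ennreal C * Lp_norm M p (inf_square_function \<X> Q \<psi> N f)"
      using N0 dom by (meson)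
  qed
qed

end
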